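(* Let $\mathcal{A}\in\mathbb{R}^{I_1\times I_2\times\dots\times I_N}$ and for each $n=1,\dots,N$ let $\mu_n$, $I_n$ and $K$ be positive integers such that $\mu_n\leq\mu_n+K\leq I_n'''$, where $I_n'''=\min\{I_n,\,\mu_1\cdots\mu_{n-1}I_{n+1}\cdots I_N\}$. For $\beta>1$ and $\gamma>1$, suppose that $$p=1-\sum_{n=1}^N\left(\frac{1}{4(\gamma^2-1)\sqrt{\pi\max\{I_n'''-\mu_n,\mu_n+K\}\gamma^2}}\left(\frac{2\gamma^2}{e^{\gamma^2-1}}\right)^2+\frac{1}{\sqrt{2\pi(K+1)}}\left(\frac{e}{K+1}\right)^{K+1}+\frac{1}{4(\gamma^2-1)\sqrt{\pi I_n\gamma^2}}\left(\frac{2\gamma^2}{e^{\gamma^2-1}}\right)^2\right)$$ is nonnegative. Let $\mathbf{Q}_1,\dots,\mathbf{Q}_N$ be the orthonormal matrices produced, with $q=1$, by the randomized ST-HOSVD algorithm with power scheme described in the context, and let $\widehat{\mathcal{A}}=\mathcal{A}\times_1(\mathbf{Q}_1\mathbf{Q}_1^\top)\cdots\times_N(\mathbf{Q}_N\mathbf{Q}_N^\top)$. Then $$\|\mathcal{A}-\widehat{\mathcal{A}}\|_F^2\leq 2\sum_{n=1}^N\mathrm{rank}(\mathbf{A}_{(n)})(1+\lambda_n)I_n\Delta_{\mu_n+1}(\mathbf{A}_{(n)},1)$$ holds with probability at least $p$, where $\mathbf{A}_{(n)}$ is the mode-$n$ unfolding of the original tensor $\mathcal{A}$ and $$\lamb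da_n=\left(\sqrt{\max\{I_n'''-\mu_n,\mu_n+K\}}+\sqrt{I_n}\right)\sqrt{2(\mu_n+K)}\,\gamma\beta.$$
   Context: $\sigma_i(\cdot)$ is the $i$th largest singular value; $\|\cdot\|_F$ is the Frobenius norm of a matrix or tensor. A matrix $\mathbf{Q}$ is orthonormal if $\mathbf{Q}^\top\mathbf{Q}$ is the identity. The mode-$n$ unfolding of a tensor is the matrix whose columns are its mode-$n$ fibers, and $\mathcal{A}\times_n\mathbf{B}$ is the mode-$n$ product, with entries $\sum_{i_n}a_{i_1\dots i_n\dots i_N}b_{j i_n}$. A standard Gaussian matrix has i.i.d. $N(0,1)$ entries. With $I_n'=\min\{I_n,\,I_1\cdots I_{n-1}I_{n+1}\cdots I_N\}$, put $\Delta_{\mu_n+1}(\mathbf{A}_{(n)},1)=\left(\sum_{i=\mu_n+1}^{I_n'}\sigma_i(\mathbf{A}_{(n)})^{4}\right)^{1/2}$. Randomized ST-HOSVD algorithm with power scheme (power $q\geq1$, oversampling $K$): process $n=1,2,\dots,N$ in this order. At step $n$ let $\mathcal{B}=\mathcal{A}\times_1\mathbf{Q}_1^\top\cdots\times_{n-1}\mathbf{Q}_{n-1}^\top$ (so $\mathcal{B}=\mathcal{A}$ for $n=1$) with mode-$n$ unfolding $\mathbf{B}_{(n)}\in\mathbb{R}^{I_n\times\mu_1\cdots\mu_{n-1}I_{n+1}\cdots I_N}$; generate a fresh (independent) standard Gaussian matrix $\mathbf{G}_n\in\mathbb{R}^{I_n\times(\mu_n+K)}$; set $\mathbf{C}_n=(\mathbf{B}_{(n)}\mathbf{B}_{(n)}^\top)^q\mathbf{G}_n$;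 find an orthonormal $\mathbf{Q}_n\in\mathbb{R}^{I_n\times\mu_n}$ for which there exists $\mathbf{R}_n\in\mathbb{R}^{\mu_n\times(\mu_n+K)}$ with $\|\mathbf{Q}_n\mathbf{R}_n-\mathbf{C}_n\|_F\leq\left(\sum_{k=\mu_n+1}^{\mu_n+K}\sigma_k(\mathbf{C}_n)^2\right)^{1/2}$ (for example, the first $\mu_n$ left singular vectors of $\mathbf{C}_n$). *)

theory Defs
  imports "HOL-Probability.Probability" "Jordan_Normal_Form.Char_Poly" "Jordan_Normal_Form.DL_Rank"
begin

section \<open>Matrices\<close>

definition mat_fnorm :: "real mat \<Rightarrow> real" where
  "mat_fnorm A = sqrt (\<Sum>i<dim_row A. \<Sum>j<dim_col A. (A $$ (i, j))\<^sup>2)"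

definition orthonormal_mat :: "real mat \<Rightarrow> bool" where
  "orthonormal_mat Q \<longleftrightarrow> transpose_mat Q * Q = 1\<^sub>m (dim_col Q)"

text \<open>
  The squares of the singular values of an \<open>m \<times> n\<close> matrix are the \<open>n\<close> eigenvalues of its Gram
  matrix, listed with algebraic multiplicity in descending order; singular values are counted from
  1, and indices beyond \<open>n\<close> give 0. If \<open>m < n\<close>, the values of index \<open>m + 1, \<dots>, n\<close> are 0
  automatically.
\<close>

definition singval :: "nat \<Rightarrow> real mat \<Rightarrow> real" where
  "singval i A =
    (let ev = rev (sorted_list_of_multiset (proots (char_poly (transpose_mat A * A))))
     in if 1 \<le> i \<and> i \<le> length ev then sqrt (ev ! (i - 1)) else 0)"

definition mat_rank :: "real mat \<Rightarrow> nat" where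
  "mat_rank A = vec_space.rank (dim_row A) A"


section \<open>Tensors\<close>

text \<open>
  An order-\<open>N\<close> tensor is a function of multi-indices. Modes are numbered \<open>1, \<dots>, N\<close>, entries along
  mode \<open>k\<close> are numbered \<open>0, \<dots>, d k - 1\<close>, and the dimensions \<open>d\<close> are passed separately: only the
  values on \<open>tensor_index N d\<close> matter.
\<close>

type_synonym tensor = "(nat \<Rightarrow> nat) \<Rightarrow> real"

definition tensor_index :: "nat \<Rightarrow> (nat \<Rightarrow> nat) \<Rightarrow> (nat \<Rightarrow> nat) set" where
  "tensor_index N d = (\<Pi>\<^sub>E k\<in>{1..N}. {..<d k})"

definition tensor_fnorm :: "nat \<Rightarrow> (nat \<Rightarrow> nat) \<Rightarrow> tensor \<Rightarrow> real" where
  "tensor_fnorm N d T = sqrt (\<Sum>i\<in>tensor_index N d. (T i)\<^sup>2)"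

definition mode_prod :: "tensor \<Rightarrow> nat \<Rightarrow> real mat \<Rightarrow> tensor" where
  "mode_prod T n B = (\<lambda>i. \<Sum>k<dim_col B. T (i(n := k)) * B $$ (i n, k))"

primrec mode_prods :: "tensor \<Rightarrow> (nat \<Rightarrow> real mat) \<Rightarrow> nat \<Rightarrow> tensor" where
  "mode_prods T B 0 = T"
| "mode_prods T B (Suc n) = mode_prod (mode_prods T B n) (Suc n) (B (Suc n))"

text \<open>
  The fibers are ordered as usual, with the index of the lowest remaining mode varying fastest:
  column \<open>j\<close> is the fiber whose indices \<open>i\<^sub>k\<close>, \<open>k \<noteq> n\<close>, are the mixed-radix digits of \<open>j\<close>.
\<close>

definition unfolding_mat :: "nat \<Rightarrow> (nat \<Rightarrow> nat) \<Rightarrow> nat \<Rightarrow> tensor \<Rightarrow> real mat" where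
  "unfolding_mat N d n T =
    Matrix.mat (d n) (\<Prod>m\<in>{1..N} - {n}. d m)
      (\<lambda>(r, j). T (\<lambda>k\<in>{1..N}. if k = n then r
                               else (j div (\<Prod>m\<in>{1..<k} - {n}. d m)) mod d k))"


section \<open>Random matrices\<close>

definition mat_borel :: "nat \<Rightarrow> nat \<Rightarrow> real mat measure" where
  "mat_borel r c =
    vimage_algebra (carrier_mat r c) (\<lambda>A. \<lambda>ij\<in>{..<r} \<times> {..<c}. A $$ ij)
      (Pi\<^sub>M ({..<r} \<times> {..<c}) (\<lambda>_. borel))"

definition std_gaussian_mat :: "'w measure \<Rightarrow> nat \<Rightarrow> nat \<Rightarrow> ('w \<Rightarrow> real mat) \<Rightarrow> bool" where
  "std_gaussian_mat M r c G \<longleftrightarrow>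
     G \<in> measurable M (mat_borel r c) \<and>
     prob_space.indep_vars M (\<lambda>_. borel) (\<lambda>ij \<omega>. G \<omega> $$ ij) ({..<r} \<times> {..<c}) \<and>
     (\<forall>ij\<in>{..<r} \<times> {..<c}. distributed M lborel (\<lambda>\<omega>. G \<omega> $$ ij) std_normal_density)"


section \<open>Randomized ST-HOSVD with power scheme\<close>

definition sthosvd_B ::
  "nat \<Rightarrow> (nat \<Rightarrow> nat) \<Rightarrow> (nat \<Rightarrow> nat) \<Rightarrow> tensor \<Rightarrow> (nat \<Rightarrow> real mat) \<Rightarrow> nat \<Rightarrow> real mat" where
  "sthosvd_B N I \<mu> T Q n =
    unfolding_mat N (\<lambda>k. if k < n then \<mu> k else I k) n
      (mode_prods T (\<lambda>k. transpose_mat (Q k)) (n - 1))"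

definition sthosvd_C ::
  "nat \<Rightarrow> (nat \<Rightarrow> nat) \<Rightarrow> (nat \<Rightarrow> nat) \<Rightarrow> nat \<Rightarrow> tensor \<Rightarrow> (nat \<Rightarrow> real mat) \<Rightarrow> (nat \<Rightarrow> real mat)
    \<Rightarrow> nat \<Rightarrow> real mat" where
  "sthosvd_C N I \<mu> q T G Q n =
    (sthosvd_B N I \<mu> T Q n * transpose_mat (sthosvd_B N I \<mu> T Q n)) ^\<^sub>m q * G n"

definition sthosvd_run ::
  "nat \<Rightarrow> (nat \<Rightarrow> nat) \<Rightarrow> (nat \<Rightarrow> nat) \<Rightarrow> nat \<Rightarrow> nat \<Rightarrow> tensor \<Rightarrow> (nat \<Rightarrow> real mat)
    \<Rightarrow> (nat \<Rightarrow> real mat) \<Rightarrow> bool" where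
  "sthosvd_run N I \<mu> K q T G Q \<longleftrightarrow>
    (\<forall>n\<in>{1..N}.
       Q n \<in> carrier_mat (I n) (\<mu> n) \<and> orthonormal_mat (Q n) \<and>
       (\<exists>R\<in>carrier_mat (\<mu> n) (\<mu> n + K).
          mat_fnorm (Q n * R - sthosvd_C N I \<mu> q T G Q n)
            \<le> sqrt (\<Sum>k=\<mu> n + 1..\<mu> n + K. (singval k (sthosvd_C N I \<mu> q T G Q n))\<^sup>2)))"

text \<open>
  The choice of \<open>Q\<^sub>n\<close> is only constrained by \<open>sthosvd_run\<close>: it may be any random matrix, possibly
  using randomness beyond the Gaussian matrices. That \<open>G\<^sub>n\<close> is fresh means that it is independent of
  everything produced in the steps before \<open>n\<close>, i.e. of all \<open>(G\<^sub>k, Q\<^sub>k)\<close> with \<open>k < n\<close> jointly.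
\<close>

definition randomized_sthosvd ::
  "'w measure \<Rightarrow> nat \<Rightarrow> (nat \<Rightarrow> nat) \<Rightarrow> (nat \<Rightarrow> nat) \<Rightarrow> nat \<Rightarrow> nat \<Rightarrow> tensor
    \<Rightarrow> (nat \<Rightarrow> 'w \<Rightarrow> real mat) \<Rightarrow> (nat \<Rightarrow> 'w \<Rightarrow> real mat) \<Rightarrow> bool" where
  "randomized_sthosvd M N I \<mu> K q T G Q \<longleftrightarrow>
    (\<forall>n\<in>{1..N}.
       std_gaussian_mat M (I n) (\<mu> n + K) (G n) \<and>
       Q n \<in> measurable M (mat_borel (I n) (\<mu> n)) \<and>
       prob_space.indep_set M
         (sets (vimage_algebra (space M) (G n) (mat_borel (I n) (\<mu> n + K))))
         (sets (vimage_algebra (space M) (\<lambda>\<omega>. \<lambda>k\<in>{1..<n}. (G k \<omega>, Q k \<omega>))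
            (Pi\<^sub>M {1..<n} (\<lambda>k. mat_borel (I k) (\<mu> k + K) \<Otimes>\<^sub>M mat_borel (I k) (\<mu> k)))))) \<and>
    (\<forall>\<omega>\<in>space M. sthosvd_run N I \<mu> K q T (\<lambda>n. G n \<omega>) (\<lambda>n. Q n \<omega>))"

definition sthosvd_approx :: "tensor \<Rightarrow> (nat \<Rightarrow> real mat) \<Rightarrow> nat \<Rightarrow> tensor" where
  "sthosvd_approx T Q N = mode_prods T (\<lambda>n. Q n * transpose_mat (Q n)) N"


section \<open>Quantities in the error bound\<close>

text \<open>
  \<open>min_dim\<close> (\<open>I\<^sub>n'\<close>) is the smaller dimension of the mode-\<open>n\<close> unfolding of the original tensor,
  \<open>min_dim_trunc\<close> (\<open>I\<^sub>n'''\<close>) that of the unfolding at step \<open>n\<close>, where the modes before \<open>n\<close> are already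
  truncated.
\<close>

definition min_dim :: "nat \<Rightarrow> (nat \<Rightarrow> nat) \<Rightarrow> nat \<Rightarrow> nat" where
  "min_dim N I n = min (I n) (\<Prod>m\<in>{1..N} - {n}. I m)"

definition min_dim_trunc :: "nat \<Rightarrow> (nat \<Rightarrow> nat) \<Rightarrow> (nat \<Rightarrow> nat) \<Rightarrow> nat \<Rightarrow> nat" where
  "min_dim_trunc N I \<mu> n = min (I n) ((\<Prod>m=1..<n. \<mu> m) * (\<Prod>m=n+1..N. I m))"

definition tail_Delta :: "nat \<Rightarrow> (nat \<Rightarrow> nat) \<Rightarrow> (nat \<Rightarrow> nat) \<Rightarrow> tensor \<Rightarrow> nat \<Rightarrow> real" where
  "tail_Delta N I \<mu> T n =
    sqrt (\<Sum>i=\<mu> n + 1..min_dim N I n. (singval i (unfolding_mat N I n T)) ^ 4)"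

definition max_dim_trunc :: "nat \<Rightarrow> (nat \<Rightarrow> nat) \<Rightarrow> (nat \<Rightarrow> nat) \<Rightarrow> nat \<Rightarrow> nat \<Rightarrow> nat" where
  "max_dim_trunc N I \<mu> K n = max (min_dim_trunc N I \<mu> n - \<mu> n) (\<mu> n + K)"

definition success_bound ::
  "nat \<Rightarrow> (nat \<Rightarrow> nat) \<Rightarrow> (nat \<Rightarrow> nat) \<Rightarrow> nat \<Rightarrow> real \<Rightarrow> real" where
  "success_bound N I \<mu> K \<gamma> =
    1 - (\<Sum>n=1..N.
        1 / (4 * (\<gamma>\<^sup>2 - 1) * sqrt (pi * real (max_dim_trunc N I \<mu> K n) * \<gamma>\<^sup>2))
          * (2 * \<gamma>\<^sup>2 / exp (\<gamma>\<^sup>2 - 1))\<^sup>2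
      + 1 / sqrt (2 * pi * (real K + 1)) * (exp 1 / (real K + 1)) ^ (K + 1)
      + 1 / (4 * (\<gamma>\<^sup>2 - 1) * sqrt (pi * real (I n) * \<gamma>\<^sup>2))
          * (2 * \<gamma>\<^sup>2 / exp (\<gamma>\<^sup>2 - 1))\<^sup>2)"

definition sthosvd_lambda ::
  "nat \<Rightarrow> (nat \<Rightarrow> nat) \<Rightarrow> (nat \<Rightarrow> nat) \<Rightarrow> nat \<Rightarrow> real \<Rightarrow> real \<Rightarrow> nat \<Rightarrow> real" where
  "sthosvd_lambda N I \<mu> K \<gamma> \<beta> n =
    (sqrt (real (max_dim_trunc N I \<mu> K n)) + sqrt (real (I n)))
      * sqrt (2 * real (\<mu> n + K)) * \<gamma> * \<beta>"

end

theory Submission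
  imports Defs
begin

text \<open>
  Since the projections act on different modes, the squared error is the sum over \<open>n\<close> of the step
  errors \<open>tr ((1 - Q\<^sub>n Q\<^sub>n\<^sup>T) D\<^sub>n)\<close> with \<open>D\<^sub>n = B\<^sub>n B\<^sub>n\<^sup>T\<close>. Let the columns of \<open>U\<close> span the leading
  \<open>\<mu>\<^sub>n\<close>-dimensional eigenspace of \<open>D\<^sub>n\<close>. By Courant--Fischer, \<open>D\<^sub>n (1 - U U\<^sup>T)\<close> has Frobenius norm at
  most \<open>\<Delta>\<close>. By Eckart--Young, \<open>(1 - Q\<^sub>n Q\<^sub>n\<^sup>T) D\<^sub>n G\<^sub>n\<close> is then small, and a right inverse \<open>F\<close> of
  \<open>U\<^sup>T G\<^sub>n\<close> turns this into a bound on \<open>(1 - Q\<^sub>n Q\<^sub>n\<^sup>T) D\<^sub>n\<close>.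

  The rows of \<open>U\<^sup>T G\<^sub>n\<close> are independent standard Gaussian vectors, and the norm of \<open>F\<close> is controlled by
  the distances of each row from the span of the others. Such a distance is the norm of a
  \<open>(K + 1)\<close>-dimensional Gaussian vector, whose small-ball probability follows from its Laplace
  transform. The Frobenius norm of \<open>G\<^sub>n\<close> is bounded by Chernoff's method. These estimates are weaker
  than those with spectral norms, which the factor \<open>rank (A\<^sub>(\<^sub>n\<^sub>)) \<surd>I\<^sub>n\<close> of the claimed bound
  compensates: if \<open>\<Delta> > 0\<close>, the rank exceeds \<open>\<mu>\<^sub>n\<close>.
\<close>

section \<open>Inner products and orthonormal families\<close>

text \<open>The step errors are traces linear in \<open>D\<close>, so the bound is linear in
  \<Delta> and no square root of a Gram matrix occurs. With \<open>q = 1\<close> the sketch is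
  \<open>D G\<close>, and the eigenvalues of \<open>D\<close> are squared singular values, whence
  the fourth powers in \<Delta>. Of the factor \<open>I n\<close>, one square root is lost in
  bounding a trace by a Frobenius norm, the other one comes from the norm of the Gaussian matrix.
  The unfolding at step \<open>n\<close> belongs to a tensor already truncated by random matrices,
  whereas the claim concerns the original tensor. Truncation in the other modes is a contraction, so
  \<open>D\<close> is dominated, as a quadratic form, by the Gram matrix of the original unfolding,
  uniformly in all earlier choices. The obstacle is that \<open>U\<close> has to be fixed before the
  freshness of the Gaussian matrix can be used, although it depends on the past. A measurable choice
  of eigenvectors is avoided: countably many candidate subspaces suffice. This inflates \<Delta> by
  3/2, and the constant 4/3 in \<open>dual_bound\<close> is what the factor 2 of the claim then
  leaves.\<close>

definition ip :: "nat \<Rightarrow> (nat \<Rightarrow> real) \<Rightarrow> (nat \<Rightarrow> real) \<Rightarrow> real" where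
  "ip n x y = (\<Sum>i<n. x i * y i)"

text \<open>A vector is a function of which only the first \<open>n\<close> values count, so
  families, sums and padded vectors carry no dimension conditions.\<close>

definition orthofam :: "nat \<Rightarrow> nat \<Rightarrow> (nat \<Rightarrow> nat \<Rightarrow> real) \<Rightarrow> bool" where
  "orthofam n k v \<longleftrightarrow> (\<forall>i<k. \<forall>j<k. ip n (v i) (v j) = of_bool (i = j))"

abbreviation ip_sq :: "nat \<Rightarrow> (nat \<Rightarrow> real) \<Rightarrow> real" where
  "ip_sq n x \<equiv> ip n x x"

lemma ip_commute: "ip n x y = ip n y x"
  by (simp add: ip_def mult.commute)

lemma ip_diff_left: "ip n (\<lambda>i. x i - y i) z = ip n x z - ip n y z"
  and ip_scale_left: "ip n (\<lambda>i. c * x i) z = c * ip n x z"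
  by (simp_all add: ip_def sum.distrib sum_subtractf algebra_simps sum_distrib_left)

lemma ip_add_right: "ip n z (\<lambda>i. x i + y i) = ip n z x + ip n z y"
  and ip_diff_right: "ip n z (\<lambda>i. x i - y i) = ip n z x - ip n z y"
  and ip_scale_right: "ip n z (\<lambda>i. c * x i) = c * ip n z x"
  by (simp_all add: ip_def sum.distrib sum_subtractf algebra_simps sum_distrib_left)

lemma ip_sum_left: "ip n (\<lambda>i. \<Sum>j\<in>J. c j * x j i) z = (\<Sum>j\<in>J. c j * ip n (x j) z)"
proof -
  have "ip n (\<lambda>i. \<Sum>j\<in>J. c j * x j i) z = (\<Sum>i<n. \<Sum>j\<in>J. c j * x j i * z i)"
    by (simp add: ip_def sum_distrib_right)
  also have "... = (\<Sum>j\<in>J. \<Sum>i<n. c j * x j i * z i)" by (rule sum.swap)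
  finally show ?thesis by (simp add: ip_def sum_distrib_left algebra_simps)
qed

lemma ip_sum_right: "ip n z (\<lambda>i. \<Sum>j\<in>J. c j * x j i) = (\<Sum>j\<in>J. c j * ip n z (x j))"
  using ip_sum_left[of n c x J z] by (simp add: ip_commute)

lemma ip_self_nonneg [simp]: "ip n x x \<ge> 0"
  by (simp add: ip_def sum_nonneg)

lemma ip_self_eq_0: "ip n x x = 0 \<Longrightarrow> i < n \<Longrightarrow> x i = 0"
  by (simp add: ip_def sum_nonneg_eq_0_iff)

lemma ip_cong: "(\<And>i. i < n \<Longrightarrow> x i = x' i) \<Longrightarrow> (\<And>i. i < n \<Longrightarrow> y i = y' i) \<Longrightarrow> ip n x y = ip n x' y'"
  by (simp add: ip_def)

lemma ip_Cauchy_Schwarz: "(ip n x y)\<^sup>2 \<le> ip n x x * ip n y y"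
  unfolding ip_def using Cauchy_Schwarz_ineq_sum[of x y "{..<n}"] by (simp add: power2_eq_square)

text \<open>The family may be longer than the sum: combinations of the leading vectors of a full
  eigenbasis are tested against the whole basis.\<close>

lemma ip_orthofam_coeff:
  assumes "orthofam n m w" "k \<le> m" "l < m"
  shows "ip n (w l) (\<lambda>i. \<Sum>j<k. c j * w j i) = (if l < k then c l else 0)"
proof -
  have "ip n (w l) (\<lambda>i. \<Sum>j<k. c j * w j i) = (\<Sum>j<k. c j * of_bool (l = j))"
    unfolding ip_sum_right using assms by (intro sum.cong) (auto simp: orthofam_def)
  then show ?thesis by (simp add: of_bool_def if_distrib cong: if_cong)
qed

lemma bessel:
  assumes "orthofam n k v"
  shows "(\<Sum>l<k. (ip n (v l) x)\<^sup>2) \<le> ip n x x"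
proof -
  define p where "p = (\<lambda>i. \<Sum>l<k. ip n (v l) x * v l i)"
  have vp: "ip n (v l) p = ip n (v l) x" if "l < k" for l
    using ip_orthofam_coeff[OF assms order_refl that] that by (simp add: p_def)
  have px: "ip n p x = (\<Sum>l<k. (ip n (v l) x)\<^sup>2)"
    unfolding p_def ip_sum_left by (simp add: power2_eq_square)
  have pp: "ip n p p = (\<Sum>l<k. (ip n (v l) x)\<^sup>2)"
    by (subst (1) p_def) (simp add: ip_sum_left vp power2_eq_square)
  have "0 \<le> ip_sq n (\<lambda>i. x i - p i)" by simp
  also have "... = ip n x x - 2 * ip n p x + ip n p p"
    by (simp add: ip_diff_left ip_diff_right ip_commute[of n x p])
  finally show ?thesis using px pp by simp
qed

section \<open>Orthogonal vectors by counting dimensions\<close>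

lemma ex_unit_multiple:
  assumes "i < n" "z i \<noteq> 0"
  shows "\<exists>c. ip_sq n (\<lambda>i. c * z i) = 1"
proof -
  have "ip n z z > 0" using ip_self_eq_0[of n z] ip_self_nonneg[of n z] assms by (auto simp: less_le)
  then have "inverse (sqrt (ip n z z)) * (inverse (sqrt (ip n z z)) * ip n z z) = 1"
    by (simp add: field_simps)
  then show ?thesis by (intro exI[of _ "inverse (sqrt (ip n z z))"]) (simp add: ip_scale_left ip_scale_right)
qed

text \<open>\<open>p < n\<close> linear equations in \<open>n\<close> unknowns: padded with zero
  rows to a square system, row \<open>p\<close> is zero, so the determinant vanishes and the kernel
  is nontrivial.\<close>

lemma ex_unit_orthogonal:
  assumes "p < n"
  shows "\<exists>x. ip n x x = 1 \<and> (\<forall>j<p. ip n (y j) x = 0)"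
proof -
  define A :: "real mat" where "A = Matrix.mat n n (\<lambda>(j, i). if j < p then y j i else 0)"
  have A: "A \<in> carrier_mat n n" by (simp add: A_def)
  have "A = mat\<^sub>r n n (\<lambda>j. if j = p then 0\<^sub>v n else Matrix.vec n (\<lambda>i. if j < p then y j i else 0))"
    using assms by (intro eq_matI) (auto simp: A_def)
  then have "det A = 0" using det_row_0[OF assms, of "\<lambda>j. Matrix.vec n (\<lambda>i. if j < p then y j i else 0)"] by auto
  then obtain v where v: "v \<in> carrier_vec n" "v \<noteq> 0\<^sub>v n" "A *\<^sub>v v = 0\<^sub>v n"
    using det_0_iff_vec_prod_zero[OF A] by auto
  define z where "z = (\<lambda>i. v $ i)"
  have z0: "ip n (y j) z = 0" if "j < p" for j
  proof -
    have "(A *\<^sub>v v) $ j = 0" using v that assms by simp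
    then have "(\<Sum>i\<in>{0..<n}. y j i * v $ i) = 0"
      using that assms v(1) by (simp add: A_def scalar_prod_def)
    then show ?thesis by (simp add: ip_def z_def atLeast0LessThan)
  qed
  have "\<exists>i<n. z i \<noteq> 0"
  proof (rule ccontr)
    assume "\<not> ?thesis"
    then have "v = 0\<^sub>v n" using v(1) by (intro eq_vecI) (auto simp: z_def)
    then show False using v by simp
  qed
  then obtain c where "ip_sq n (\<lambda>i. c * z i) = 1" using ex_unit_multiple by blast
  then show ?thesis using z0 by (intro exI[of _ "\<lambda>i. c * z i"]) (simp add: ip_scale_right)
qed

text \<open>Each new unit vector is required to be orthogonal to the \<open>y j\<close> and to the
  vectors already found; \<open>k + p \<le> n\<close> keeps the number of conditions below
  \<open>n\<close>.\<close>

lemma ex_orthofam_orthogonal: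
  assumes "k + p \<le> n"
  shows "\<exists>v. orthofam n k v \<and> (\<forall>l<k. \<forall>j<p. ip n (y j) (v l) = 0)"
  using assms
proof (induction k)
  case 0
  then show ?case by (simp add: orthofam_def)
next
  case (Suc k)
  then obtain v where v: "orthofam n k v" "\<And>l j. l < k \<Longrightarrow> j < p \<Longrightarrow> ip n (y j) (v l) = 0" by auto
  obtain x where x: "ip n x x = 1" "\<And>j. j < p + k \<Longrightarrow> ip n (if j < p then y j else v (j - p)) x = 0"
    using ex_unit_orthogonal[of "p + k" n "\<lambda>j. if j < p then y j else v (j - p)"] Suc.prems by auto
  have vx: "ip n (v l) x = 0" if "l < k" for l using x(2)[of "p + l"] that by simp
  have vx': "ip n x (v l) = 0" if "l < k" for l using vx[OF that] by (simp add: ip_commute)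
  have yx: "ip n (y j) x = 0" if "j < p" for j using x(2)[of j] that by simp
  have "orthofam n (Suc k) (v(k := x))"
    using v(1) x(1) vx vx' by (auto simp: orthofam_def less_Suc_eq)
  moreover have "\<forall>l<Suc k. \<forall>j<p. ip n (y j) ((v(k := x)) l) = 0"
    using v(2) yx by (auto simp: less_Suc_eq)
  ultimately show ?case by blast
qed

text \<open>A one-sided inverse of a square matrix is two-sided: orthonormal rows force orthonormal
  columns. This yields Parseval's identity.\<close>

lemma orthofam_complete:
  assumes "orthofam n n v" "a < n" "b < n"
  shows "(\<Sum>l<n. v l a * v l b) = of_bool (a = b)"
proof -
  define V where "V = Matrix.mat n n (\<lambda>(i, j). v i j)"
  have V: "V \<in> carrier_mat n n" by (simp add: V_def)
  have "V * transpose_mat V = 1\<^sub>m n"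
    using assms(1) by (intro eq_matI) (auto simp: V_def scalar_prod_def orthofam_def ip_def atLeast0LessThan)
  then have "transpose_mat V * V = 1\<^sub>m n"
    by (rule mat_mult_left_right_inverse[OF V, rotated]) (simp add: V)
  then have "(transpose_mat V * V) $$ (a, b) = of_bool (a = b)" using assms by simp
  then show ?thesis using assms(2,3) by (simp add: V_def scalar_prod_def atLeast0LessThan)
qed

lemma parseval:
  assumes "orthofam n n v"
  shows "(\<Sum>l<n. ip n (v l) x * ip n (v l) y) = ip n x y"
proof -
  have "(\<Sum>l<n. ip n (v l) x * ip n (v l) y) = (\<Sum>l<n. \<Sum>a<n. \<Sum>b<n. x a * y b * (v l a * v l b))"
    by (simp add: ip_def sum_product algebra_simps)
  also have "... = (\<Sum>a<n. \<Sum>b<n. \<Sum>l<n. x a * y b * (v l a * v l b))"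
    by (subst sum.swap) (rule sum.cong[OF refl], rule sum.swap)
  also have "... = (\<Sum>a<n. \<Sum>b<n. x a * y b * of_bool (a = b))"
    using orthofam_complete[OF assms] by (simp add: sum_distrib_left[symmetric])
  also have "... = ip n x y" by (simp add: ip_def of_bool_def if_distrib cong: if_cong)
  finally show ?thesis .
qed

text \<open>Gram-Schmidt on coefficients instead of vectors, since the \<open>z\<close> may be
  dependent: both \<open>y\<close> and the new \<open>z p\<close> are first projected onto the old
  span, then the rest of \<open>y\<close> is corrected along the rest \<open>w\<close> of
  \<open>z p\<close>.\<close>

lemma ex_projection:
  assumes "finite J"
  shows "\<exists>c. \<forall>j\<in>J. ip n (\<lambda>i. y i - (\<Sum>l\<in>J. c l * z l i)) (z j) = 0"
  using assms
proof (induction J arbitrary: y)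
  case empty
  then show ?case by simp
next
  case (insert p J)
  obtain a where a: "\<And>j. j \<in> J \<Longrightarrow> ip n (\<lambda>i. z p i - (\<Sum>l\<in>J. a l * z l i)) (z j) = 0"
    using insert.IH[of "z p"] by blast
  obtain b where b: "\<And>j. j \<in> J \<Longrightarrow> ip n (\<lambda>i. y i - (\<Sum>l\<in>J. b l * z l i)) (z j) = 0"
    using insert.IH[of y] by blast
  define w where "w = (\<lambda>i. z p i - (\<Sum>l\<in>J. a l * z l i))"
  define y' where "y' = (\<lambda>i. y i - (\<Sum>l\<in>J. b l * z l i))"
  have wz: "ip n w (z j) = 0" and y'z: "ip n y' (z j) = 0" if "j \<in> J" for j
    using a[OF that] b[OF that] by (auto simp: w_def y'_def)
  have zp: "z p = (\<lambda>i. w i + (\<Sum>l\<in>J. a l * z l i))" by (simp add: w_def)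
  have orth: "ip n u (z p) = ip n u w" if "\<And>j. j \<in> J \<Longrightarrow> ip n u (z j) = 0" for u
    by (subst zp) (simp add: ip_add_right ip_sum_right that)
  \<comment> \<open>If \<open>z p\<close> already lies in the old span, \<open>w\<close> vanishes
    and the division yields \<open>t = 0\<close>, which is then correct.\<close>
  define t where "t = ip n y' w / ip n w w"
  define r where "r = (\<lambda>i. y' i - t * w i)"
  have rz: "ip n r (z j) = 0" if "j \<in> J" for j
    using wz[OF that] y'z[OF that] by (simp add: r_def ip_diff_left ip_scale_left)
  have rw: "ip n r w = 0"
  proof (cases "ip n w w = 0")
    case True
    then have "\<And>i. i < n \<Longrightarrow> w i = 0" using ip_self_eq_0 by blast
    then show ?thesis by (simp add: ip_def)
  next
    case False
    have "ip n r w = ip n y' w - t * ip n w w" by (simp add: r_def ip_diff_left ip_scale_left)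
    then show ?thesis using False by (simp add: t_def)
  qed
  have "ip n r (z p) = 0" using orth[of r] rz rw by simp
  moreover have "r = (\<lambda>i. y i - (\<Sum>l\<in>insert p J. (if l = p then t else b l - t * a l) * z l i))"
  proof
    fix i
    have "(\<Sum>l\<in>J. (if l = p then t else b l - t * a l) * z l i) = (\<Sum>l\<in>J. b l * z l i - t * (a l * z l i))"
      using insert.hyps by (intro sum.cong) (auto simp: algebra_simps)
    then show "r i = y i - (\<Sum>l\<in>insert p J. (if l = p then t else b l - t * a l) * z l i)"
      using insert.hyps by (simp add: r_def y'_def w_def sum_subtractf sum_distrib_left algebra_simps)
  qed
  ultimately show ?case using rz
    by (intro exI[of _ "\<lambda>l. if l = p then t else b l - t * a l"]) auto
qed

text \<open>The dual vector of \<open>y i\<close> is its component \<open>p\<close> orthogonal to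
  the other rows, divided by the squared norm of \<open>p\<close>; its own squared norm is the
  reciprocal of that squared distance. The \<open>f i\<close> are the columns of a right inverse of
  the matrix with rows \<open>y j\<close>.\<close>

lemma ex_dual_family:
  fixes \<mu> :: nat and y :: "nat \<Rightarrow> nat \<Rightarrow> real"
  assumes "x > 0"
    and dist: "\<And>i c. i < \<mu> \<Longrightarrow>
      ip_sq n (\<lambda>a. y i a - (\<Sum>j\<in>{..<\<mu>} - {i}. c j * y j a)) \<ge> x"
  shows "\<exists>f. (\<forall>i<\<mu>. ip_sq n (f i) \<le> 1 / x) \<and> (\<forall>i<\<mu>. \<forall>j<\<mu>. ip n (y j) (f i) = of_bool (i = j))"
proof -
  have "\<exists>f. ip n f f \<le> 1 / x \<and> (\<forall>j<\<mu>. ip n (y j) f = of_bool (i = j))" if i: "i < \<mu>" for i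
  proof -
    have fin: "finite ({..<\<mu>} - {i})" by simp
    obtain c where c: "\<forall>j\<in>{..<\<mu>} - {i}. ip n (\<lambda>a. y i a - (\<Sum>l\<in>{..<\<mu>} - {i}. c l * y l a)) (y j) = 0"
      using ex_projection[of "{..<\<mu>} - {i}" n "y i" y, OF fin] by (elim exE)
    define p where "p = (\<lambda>a. y i a - (\<Sum>l\<in>{..<\<mu>} - {i}. c l * y l a))"
    have pp: "ip n p p \<ge> x" using dist[OF i] by (simp add: p_def)
    have pj: "ip n p (y j) = 0" if "j < \<mu>" "j \<noteq> i" for j using bspec[OF c, of j] that by (simp add: p_def)
    have yi: "y i = (\<lambda>a. p a + (\<Sum>l\<in>{..<\<mu>} - {i}. c l * y l a))" by (simp add: p_def)
    have pj': "ip n (y j) p = 0" if "j < \<mu>" "j \<noteq> i" for j using pj[OF that] by (simp add: ip_commute)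
    have pi: "ip n p (y i) = ip n p p"
      by (subst yi) (simp add: ip_add_right ip_sum_right pj)
    define q where "q = ip n p p"
    have pi': "ip n (y i) p = q" using pi by (simp add: ip_commute q_def)
    have q: "q \<ge> x" using pp by (simp add: q_def)
    have "ip_sq n (\<lambda>a. inverse q * p a) = inverse q"
      using q \<open>x > 0\<close> by (simp add: ip_scale_left ip_scale_right q_def[symmetric])
    also have "... \<le> 1 / x" using q \<open>x > 0\<close> by (simp add: field_simps)
    finally show ?thesis using pj' pi' q \<open>x > 0\<close>
      by (intro exI[of _ "\<lambda>a. inverse q * p a"]) (auto simp: ip_scale_right)
  qed
  then show ?thesis by metis
qed

section \<open>Singular values and the spectral theorem\<close>

definition mv :: "nat \<Rightarrow> (nat \<Rightarrow> nat \<Rightarrow> real) \<Rightarrow> (nat \<Rightarrow> real) \<Rightarrow> nat \<Rightarrow> real" where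
  "mv n a x = (\<lambda>i. \<Sum>j<n. a i j * x j)"

abbreviation mat_app :: "nat \<Rightarrow> real mat \<Rightarrow> (nat \<Rightarrow> real) \<Rightarrow> nat \<Rightarrow> real" where
  "mat_app n A \<equiv> mv n (\<lambda>i j. A $$ (i, j))"

abbreviation mat_app_t :: "nat \<Rightarrow> real mat \<Rightarrow> (nat \<Rightarrow> real) \<Rightarrow> nat \<Rightarrow> real" where
  "mat_app_t m A \<equiv> mv m (\<lambda>j i. A $$ (i, j))"

lemma ip_mv: "ip m (mv n a x) y = ip n x (mv m (\<lambda>j i. a i j) y)"
proof -
  have "ip m (mv n a x) y = (\<Sum>i<m. \<Sum>j<n. a i j * x j * y i)"
    by (simp add: ip_def mv_def sum_distrib_right)
  also have "... = (\<Sum>j<n. \<Sum>i<m. a i j * x j * y i)" by (rule sum.swap)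
  finally show ?thesis by (simp add: ip_def mv_def sum_distrib_left algebra_simps)
qed

lemma mv_sum: "mv n a (\<lambda>j. \<Sum>l\<in>L. c l * v l j) i = (\<Sum>l\<in>L. c l * mv n a (v l) i)"
proof -
  have "mv n a (\<lambda>j. \<Sum>l\<in>L. c l * v l j) i = (\<Sum>j<n. \<Sum>l\<in>L. a i j * (c l * v l j))"
    by (simp add: mv_def sum_distrib_left)
  also have "... = (\<Sum>l\<in>L. \<Sum>j<n. a i j * (c l * v l j))" by (rule sum.swap)
  finally show ?thesis by (simp add: mv_def sum_distrib_left algebra_simps)
qed

text \<open>Over the complex numbers an eigenvalue exists by the fundamental theorem of algebra. The
  Hermitian form \<open>q\<close> of the eigenvector equals its own conjugate because the matrix is
  real and symmetric, so the eigenvalue is real.\<close>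

lemma ex_real_eigenvector:
  assumes "n > 0" and sym: "\<And>i j. i < n \<Longrightarrow> j < n \<Longrightarrow> a i j = a j i"
  shows "\<exists>k x. ip n x x = 1 \<and> (\<forall>i<n. mv n a x i = k * x i)"
proof -
  define A :: "complex mat" where "A = Matrix.mat n n (\<lambda>(i, j). complex_of_real (a i j))"
  have A: "A \<in> carrier_mat n n" by (simp add: A_def)
  have "\<not> constant (poly (char_poly A))"
    using degree_monic_char_poly[OF A] \<open>n > 0\<close> by (simp add: constant_degree)
  then obtain k where "poly (char_poly A) k = 0" using fundamental_theorem_of_algebra by blast
  then have "eigenvalue A k" using eigenvalue_root_char_poly[OF A] by simp
  then obtain v where v: "v \<in> carrier_vec n" "v \<noteq> 0\<^sub>v n" "A *\<^sub>v v = k \<cdot>\<^sub>v v"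
    using A unfolding eigenvalue_def eigenvector_def by auto
  define z where "z = (\<lambda>i. v $ i)"
  have Az: "(\<Sum>j<n. complex_of_real (a i j) * z j) = k * z i" if "i < n" for i
  proof -
    have "(A *\<^sub>v v) $ i = k * z i" using v that by (simp add: z_def)
    then show ?thesis using that v(1) by (simp add: A_def scalar_prod_def z_def atLeast0LessThan)
  qed
  have nz: "\<exists>i<n. z i \<noteq> 0"
  proof (rule ccontr)
    assume "\<not> ?thesis"
    then have "v = 0\<^sub>v n" using v(1) by (intro eq_vecI) (auto simp: z_def)
    then show False using v by simp
  qed
  define q where "q = (\<Sum>i<n. \<Sum>j<n. complex_of_real (a i j) * cnj (z i) * z j)"
  define N where "N = (\<Sum>i<n. (cmod (z i))\<^sup>2)"
  have "q = (\<Sum>i<n. cnj (z i) * (k * z i))"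
    unfolding q_def by (intro sum.cong refl) (simp add: Az[symmetric] sum_distrib_left algebra_simps)
  also have "... = k * complex_of_real N"
    unfolding N_def of_real_sum sum_distrib_left
    by (intro sum.cong refl) (simp only: complex_norm_square mult_ac)
  finally have qk: "q = k * complex_of_real N" .
  have "cnj q = (\<Sum>i<n. \<Sum>j<n. complex_of_real (a i j) * z i * cnj (z j))" by (simp add: q_def)
  also have "... = (\<Sum>j<n. \<Sum>i<n. complex_of_real (a i j) * z i * cnj (z j))" by (rule sum.swap)
  also have "... = q" unfolding q_def by (intro sum.cong refl) (simp add: sym algebra_simps)
  finally have "cnj q = q" .
  moreover have N: "N > 0"
  proof -
    obtain i where "i < n" "z i \<noteq> 0" using nz by blast
    then show ?thesis unfolding N_def by (intro sum_pos2[of _ i]) auto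
  qed
  ultimately have "cnj k = k" by (simp add: qk)
  then obtain t where k: "k = complex_of_real t" by (metis Reals_cnj_iff Reals_cases)
  have re: "mv n a (\<lambda>j. Re (z j)) i = t * Re (z i)"
    and im: "mv n a (\<lambda>j. Im (z j)) i = t * Im (z i)" if "i < n" for i
    using arg_cong[OF Az[OF that], of Re] arg_cong[OF Az[OF that], of Im]
    by (simp_all add: k mv_def)
  \<comment> \<open>Real and imaginary part both satisfy the eigenvalue equation, and at least one
    of them is nonzero.\<close>
  define y where "y = (if \<exists>i<n. Re (z i) \<noteq> 0 then (\<lambda>i. Re (z i)) else (\<lambda>i. Im (z i)))"
  have y: "mv n a y i = t * y i" if "i < n" for i using re im that by (simp add: y_def)
  have "\<exists>i<n. y i \<noteq> 0" using nz unfolding y_def by (auto simp: complex_eq_iff)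
  then obtain c where "ip_sq n (\<lambda>i. c * y i) = 1" using ex_unit_multiple by blast
  moreover have "mv n a (\<lambda>i. c * y i) i = t * (c * y i)" if "i < n" for i
  proof -
    have "mv n a (\<lambda>i. c * y i) i = c * mv n a y i"
      by (simp add: mv_def sum_distrib_left algebra_simps)
    then show ?thesis using y[OF that] by simp
  qed
  ultimately show ?thesis by blast
qed

text \<open>Deflation: on an orthonormal basis \<open>v\<close> of the complement of the vectors
  found so far, the compressed matrix is again symmetric and has an eigenvector. It lifts to
  \<open>x\<close>, and the residual \<open>r\<close> is orthogonal to both families, hence
  zero.\<close>

lemma ex_orthonormal_eigenvectors:
  assumes sym: "\<And>i j. i < n \<Longrightarrow> j < n \<Longrightarrow> a i j = a j i" and "k \<le> n"
  shows "\<exists>w e. orthofam n k w \<and> (\<forall>l<k. \<forall>i<n. mv n a (w l) i = e l * w l i)"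
  using \<open>k \<le> n\<close>
proof (induction k)
  case 0
  then show ?case by (simp add: orthofam_def)
next
  case (Suc k)
  then obtain w e where w: "orthofam n k w" and we: "\<And>l i. l < k \<Longrightarrow> i < n \<Longrightarrow> mv n a (w l) i = e l * w l i"
    by auto
  obtain v where v: "orthofam n (n - k) v" and vw: "\<And>l j. l < n - k \<Longrightarrow> j < k \<Longrightarrow> ip n (w j) (v l) = 0"
    using ex_orthofam_orthogonal[of "n - k" k n w] Suc.prems by auto
  have self: "ip n (mv n a x) y = ip n x (mv n a y)" for x y
    unfolding ip_mv using sym by (intro ip_cong) (auto simp: mv_def)
  obtain t y where y: "ip (n - k) y y = 1"
    and ty: "\<And>l. l < n - k \<Longrightarrow> mv (n - k) (\<lambda>l l'. ip n (v l) (mv n a (v l'))) y l = t * y l"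
    using ex_real_eigenvector[of "n - k" "\<lambda>l l'. ip n (v l) (mv n a (v l'))"] Suc.prems self
    by (auto simp: ip_commute)
  define x where "x = (\<lambda>i. \<Sum>l<n - k. y l * v l i)"
  have wx: "ip n (w l) x = 0" if "l < k" for l
    unfolding x_def ip_sum_right using vw that by simp
  have vx: "ip n (v l) x = y l" if "l < n - k" for l
    using ip_orthofam_coeff[OF v order_refl that] that by (simp add: x_def)
  have xx: "ip n x x = 1"
    by (subst (1) x_def) (simp add: ip_sum_left vx flip: y, simp add: ip_def)
  define r where "r = (\<lambda>i. mv n a x i - t * x i)"
  have wr: "ip n (w l) r = 0" if "l < k" for l
  proof -
    have "ip n (w l) (mv n a x) = ip n (\<lambda>i. e l * w l i) x"
      unfolding self[symmetric] using we that by (intro ip_cong) auto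
    then show ?thesis using wx[OF that] by (simp add: r_def ip_diff_right ip_scale_right ip_scale_left)
  qed
  have vr: "ip n (v l) r = 0" if "l < n - k" for l
  proof -
    have "ip n (v l) (mv n a x) = ip n (v l) (\<lambda>i. \<Sum>l'<n - k. y l' * mv n a (v l') i)"
      unfolding x_def by (intro ip_cong) (auto simp: mv_sum)
    also have "... = t * y l"
      using ty[OF that] by (simp add: ip_sum_right mv_def mult.commute)
    finally show ?thesis using vx[OF that] by (simp add: r_def ip_diff_right ip_scale_right)
  qed
  define u where "u = (\<lambda>l. if l < k then w l else v (l - k))"
  have vw': "ip n (v l) (w j) = 0" if "l < n - k" "j < k" for l j
    using vw[OF that] by (simp add: ip_commute)
  have "orthofam n n u"
    using w v vw vw' by (auto simp: orthofam_def u_def)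
  then have "ip n r r = (\<Sum>l<n. ip n (u l) r * ip n (u l) r)" by (rule parseval[symmetric])
  also have "... = 0"
    using wr vr by (intro sum.neutral) (auto simp: u_def)
  finally have "ip n r r = 0" .
  then have r0: "\<And>i. i < n \<Longrightarrow> mv n a x i = t * x i" using ip_self_eq_0[of n r] by (simp add: r_def)
  have wx': "ip n x (w l) = 0" if "l < k" for l using wx[OF that] by (simp add: ip_commute)
  have "orthofam n (Suc k) (w(k := x))"
    using w xx wx wx' by (auto simp: orthofam_def less_Suc_eq)
  moreover have "\<forall>l<Suc k. \<forall>i<n. mv n a ((w(k := x)) l) i = (e(k := t)) l * (w(k := x)) l i"
    using we r0 by (auto simp: less_Suc_eq)
  ultimately show ?case by blast
qed

text \<open>\<open>singval\<close> is defined by roots of a characteristic polynomial; similarity to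
  a diagonal matrix identifies these roots, with multiplicity, with the eigenvalues of an
  eigenbasis.\<close>

lemma char_poly_orthonormal_eigenvectors:
  assumes w: "orthofam n n w" and A: "A \<in> carrier_mat n n"
    and we: "\<And>l i. l < n \<Longrightarrow> i < n \<Longrightarrow> (\<Sum>j<n. A $$ (i, j) * w l j) = e l * w l i"
  shows "proots (char_poly A) = mset (map e [0..<n])"
proof -
  define W where "W = Matrix.mat n n (\<lambda>(i, l). w l i)"
  define E where "E = Matrix.mat n n (\<lambda>(i, j). if i = j then e i else 0)"
  have W: "W \<in> carrier_mat n n" and E: "E \<in> carrier_mat n n" by (simp_all add: W_def E_def)
  have WtW: "transpose_mat W * W = 1\<^sub>m n"
    using w by (intro eq_matI) (auto simp: W_def scalar_prod_def orthofam_def ip_def atLeast0LessThan)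
  then have WWt: "W * transpose_mat W = 1\<^sub>m n"
    by (rule mat_mult_left_right_inverse[rotated 2]) (simp_all add: W)
  have AW: "A * W = W * E"
  proof (rule eq_matI)
    fix i l assume il: "i < dim_row (W * E)" "l < dim_col (W * E)"
    then have il: "i < n" "l < n" using W E by auto
    have "(W * E) $$ (i, l) = (\<Sum>j<n. w j i * (if j = l then e j else 0))"
      using il by (simp add: W_def E_def scalar_prod_def atLeast0LessThan)
    also have "... = e l * w l i" using il by (simp add: if_distrib cong: if_cong)
    also have "... = (A * W) $$ (i, l)"
      using il A we[of l i] by (simp add: W_def scalar_prod_def atLeast0LessThan)
    finally show "(A * W) $$ (i, l) = (W * E) $$ (i, l)" by simp
  qed (use A W E in auto)
  have "A = A * (W * transpose_mat W)" using A WWt by simp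
  also have "... = W * E * transpose_mat W"
    using A W AW by (subst assoc_mult_mat[symmetric, of _ n n _ n _ n]) auto
  finally have "similar_mat_wit A E W (transpose_mat W)"
    using A W E WWt WtW by (intro similar_mat_witI) auto
  then have "char_poly A = char_poly E"
    by (intro char_poly_similar) (auto simp: similar_mat_def)
  also have "... = (\<Prod>a\<leftarrow>diag_mat E. [:- a, 1:])"
    by (rule char_poly_upper_triangular[OF E]) (auto simp: E_def)
  also have "diag_mat E = map e [0..<n]"
    by (auto simp: diag_mat_def E_def)
  finally have "char_poly A = (\<Prod>a\<leftarrow>map e [0..<n]. [:- a, 1:])" .
  moreover have "proots (\<Prod>a\<leftarrow>as. [:- a, 1:]) = mset as" for as :: "real list"
  proof (induction as)
    case (Cons a as)
    have "(\<Prod>a\<leftarrow>as. [:- a, 1:]) \<noteq> (0 :: real poly)" by (auto simp: prod_list_zero_iff)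
    then show ?case using Cons by (simp add: proots_mult del: mult_pCons_left)
  qed simp
  ultimately show ?thesis by metis
qed

text \<open>The only access to \<open>singval\<close> from here on: the Gram form of
  \<open>C\<close> is diagonal in an eigenbasis listed in the same descending order as the singular
  values.\<close>

lemma singval_spectral:
  assumes C: "C \<in> carrier_mat m s"
  shows "\<exists>w. orthofam s s w \<and>
     (\<forall>x y. ip m (mat_app s C x) (mat_app s C y)
        = (\<Sum>l<s. (singval (Suc l) C)\<^sup>2 * ip s (w l) x * ip s (w l) y))" (is "?A")
    and "\<And>i. singval i C \<ge> 0"
    and "\<And>i j. 1 \<le> i \<Longrightarrow> i \<le> j \<Longrightarrow> singval j C \<le> singval i C"
    and "\<And>i. i > s \<Longrightarrow> singval i C = 0"
proof -
  define c where "c = (\<lambda>r j. C $$ (r, j))"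
  define A where "A = transpose_mat C * C"
  define ev where "ev = rev (sorted_list_of_multiset (proots (char_poly A)))"
  have A: "A \<in> carrier_mat s s" using C by (auto simp: A_def)
  have A_eq: "A $$ (i, j) = (\<Sum>r<m. c r i * c r j)" if "i < s" "j < s" for i j
    using that C by (auto simp: A_def c_def scalar_prod_def atLeast0LessThan)
  have sv: "singval i C = (if 1 \<le> i \<and> i \<le> length ev then sqrt (ev ! (i - 1)) else 0)" for i
    unfolding singval_def ev_def A_def Let_def by simp
  obtain w e where w: "orthofam s s w"
    and we: "\<And>l i. l < s \<Longrightarrow> i < s \<Longrightarrow> mat_app s A (w l) i = e l * w l i"
    using ex_orthonormal_eigenvectors[of s "\<lambda>i j. A $$ (i, j)" s] by (auto simp: A_eq mult.commute)
  have "proots (char_poly A) = mset (map e [0..<s])"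
    using char_poly_orthonormal_eigenvectors[OF w A, of e] we by (simp add: mv_def)
  then have mset: "mset ev = mset (map e [0..<s])" by (simp add: ev_def)
  then have len: "length ev = s" by (metis length_map length_upt minus_nat.diff_0 size_mset)
  \<comment> \<open>The eigenvectors come in arbitrary order; equality of multisets provides the
    permutation that sorts them like \<open>ev\<close>.\<close>
  obtain p where p: "p permutes {..<s}" "permute_list p (map e [0..<s]) = ev"
    using mset_eq_permutation[OF mset] by auto
  have ev_nth: "ev ! l = e (p l)" and p_less: "p l < s" if "l < s" for l
    using permute_list_nth[of p "map e [0..<s]" l] p that permutes_in_image[OF p(1), of l] by auto
  define w' where "w' = (\<lambda>l. w (p l))"
  have w': "orthofam s s w'"
    using w p_less permutes_inj[OF p(1)] by (auto simp: orthofam_def w'_def inj_eq)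
  have Aw': "mat_app s A (w' l) i = ev ! l * w' l i" if "l < s" "i < s" for l i
    using we[OF p_less[OF that(1)] that(2)] ev_nth[OF that(1)] by (simp add: w'_def)
  have CC: "ip m (mv s c x) (mv s c y) = ip s x (mat_app s A y)" for x y
  proof -
    have "mv m (\<lambda>j r. c r j) (mv s c y) i = mat_app s A y i" if "i < s" for i
    proof -
      have "mv m (\<lambda>j r. c r j) (mv s c y) i = (\<Sum>r<m. \<Sum>j<s. c r i * c r j * y j)"
        by (simp add: mv_def sum_distrib_left algebra_simps)
      also have "... = (\<Sum>j<s. \<Sum>r<m. c r i * c r j * y j)" by (rule sum.swap)
      finally show ?thesis using that by (simp add: mv_def A_eq sum_distrib_right)
    qed
    then show ?thesis unfolding ip_mv by (intro ip_cong) auto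
  qed
  have CCw: "ip m (mv s c x) (mv s c (w' l)) = ev ! l * ip s x (w' l)" if "l < s" for x l
  proof -
    have "ip m (mv s c x) (mv s c (w' l)) = ip s x (\<lambda>i. ev ! l * w' l i)"
      unfolding CC using Aw'[OF that] by (intro ip_cong) auto
    then show ?thesis by (simp add: ip_scale_right)
  qed
  \<comment> \<open>An eigenvalue of the Gram matrix is the squared norm of the image of its unit
    eigenvector. This allows squaring to undo the \<open>sqrt\<close> in
    \<open>singval\<close>.\<close>
  have ev_nonneg: "ev ! l \<ge> 0" if "l < s" for l
  proof -
    have "ip_sq s (w' l) = 1" using w' that by (auto simp: orthofam_def)
    then show ?thesis using CCw[OF that, of "w' l"] ip_self_nonneg[of m "mv s c (w' l)"] by simp
  qed
  show nonneg: "singval i C \<ge> 0" for i using ev_nonneg[of "i - 1"] by (cases "i - 1 < s") (auto simp: sv len)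
  show "singval i C = 0" if "i > s" for i using that by (simp add: sv len)
  have "sorted (rev ev)" by (simp add: ev_def)
  then have dec: "ev ! j \<le> ev ! i" if "i \<le> j" "j < s" for i j
    using that len sorted_rev_nth_mono[of ev i j] by simp
  show "singval j C \<le> singval i C" if "1 \<le> i" "i \<le> j" for i j
    using that dec[of "i - 1" "j - 1"] ev_nonneg[of "i - 1"] by (auto simp: sv len)
  have sv2: "(singval (Suc l) C)\<^sup>2 = ev ! l" if "l < s" for l
    using that ev_nonneg[OF that] by (simp add: sv len)
  have "ip m (mv s c x) (mv s c y) = (\<Sum>l<s. (singval (Suc l) C)\<^sup>2 * ip s (w' l) x * ip s (w' l) y)" for x y
  proof -
    have "ip m (mv s c x) (mv s c y) = (\<Sum>l<s. ip s (w' l) x * ip s (w' l) (mat_app s A y))"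
      unfolding CC by (rule parseval[OF w', symmetric])
    also have "... = (\<Sum>l<s. (singval (Suc l) C)\<^sup>2 * ip s (w' l) x * ip s (w' l) y)"
    proof (intro sum.cong refl)
      fix l assume "l \<in> {..<s}"
      then have "ip s (w' l) (mat_app s A y) = (singval (Suc l) C)\<^sup>2 * ip s y (w' l)"
        using CCw[of l y] by (simp add: CC[symmetric] sv2 ip_commute)
      then show "ip s (w' l) x * ip s (w' l) (mat_app s A y) = (singval (Suc l) C)\<^sup>2 * ip s (w' l) x * ip s (w' l) y"
        by (simp add: ip_commute)
    qed
    finally show ?thesis .
  qed
  then show ?A using w' unfolding c_def by blast
qed

section \<open>Low-rank approximation and rank\<close>

lemma ip_orthofam_sum:
  assumes "orthofam n k w"
  shows "ip_sq n (\<lambda>i. \<Sum>l<k. c l * w l i) = (\<Sum>l<k. (c l)\<^sup>2)"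
proof -
  have "ip n (w l) (\<lambda>i. \<Sum>l<k. c l * w l i) = c l" if "l < k" for l
    using ip_orthofam_coeff[OF assms order_refl that] that by simp
  then show ?thesis by (subst ip_sum_left) (simp add: power2_eq_square)
qed

lemma frobenius_bessel:
  assumes "orthofam s k v"
  shows "(\<Sum>l<k. ip_sq m (mv s R (v l))) \<le> (\<Sum>r<m. \<Sum>j<s. (R r j)\<^sup>2)"
proof -
  have "(\<Sum>l<k. ip_sq m (mv s R (v l))) = (\<Sum>l<k. \<Sum>r<m. (ip s (v l) (R r))\<^sup>2)"
    by (simp add: ip_def mv_def power2_eq_square mult.commute)
  also have "... = (\<Sum>r<m. \<Sum>l<k. (ip s (v l) (R r))\<^sup>2)" by (rule sum.swap)
  also have "... \<le> (\<Sum>r<m. ip_sq s (R r))" by (intro sum_mono bessel assms)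
  also have "... = (\<Sum>r<m. \<Sum>j<s. (R r j)\<^sup>2)" by (simp add: ip_def power2_eq_square)
  finally show ?thesis .
qed

text \<open>Weights in [0,1] of fixed total give the smallest sum against a decreasing sequence when
  they sit on its end. Subtracting \<open>e \<mu>\<close> from all terms makes this visible
  termwise: the head becomes nonnegative, the tail nonpositive.\<close>

lemma sum_tail_le_weighted_sum:
  fixes e p :: "nat \<Rightarrow> real"
  assumes dec: "\<And>i j. i \<le> j \<Longrightarrow> j < s \<Longrightarrow> e j \<le> e i"
    and e0: "\<And>i. i < s \<Longrightarrow> 0 \<le> e i"
    and p: "\<And>i. i < s \<Longrightarrow> 0 \<le> p i" "\<And>i. i < s \<Longrightarrow> p i \<le> 1"
    and sum_p: "(\<Sum>i<s. p i) = real (s - \<mu>)" and "\<mu> \<le> s"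
  shows "(\<Sum>i=\<mu>..<s. e i) \<le> (\<Sum>i<s. e i * p i)"
proof (cases "\<mu> < s")
  case False
  then show ?thesis using e0 p by (auto intro!: sum_nonneg mult_nonneg_nonneg)
next
  case True
  have split: "{..<s} = {..<\<mu>} \<union> {\<mu>..<s}" using True by auto
  have "(\<Sum>i=\<mu>..<s. e i) - e \<mu> * real (s - \<mu>) = (\<Sum>i=\<mu>..<s. e i - e \<mu>)"
    by (simp add: sum_subtractf)
  also have "... \<le> (\<Sum>i=\<mu>..<s. (e i - e \<mu>) * p i)"
  proof (intro sum_mono)
    fix i assume "i \<in> {\<mu>..<s}"
    then show "e i - e \<mu> \<le> (e i - e \<mu>) * p i"
      using dec[of \<mu> i] p(2)[of i] mult_left_mono_neg[of "p i" 1 "e i - e \<mu>"] by simp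
  qed
  also have "... \<le> (\<Sum>i<\<mu>. (e i - e \<mu>) * p i) + (\<Sum>i=\<mu>..<s. (e i - e \<mu>) * p i)"
    using dec p(1) True by (auto intro!: sum_nonneg mult_nonneg_nonneg)
  also have "... = (\<Sum>i<s. (e i - e \<mu>) * p i)"
    unfolding split by (subst sum.union_disjoint) auto
  also have "... = (\<Sum>i<s. e i * p i) - e \<mu> * real (s - \<mu>)"
    by (simp add: algebra_simps sum_subtractf sum_distrib_right[symmetric] sum_p) (simp add: sum_distrib_left[symmetric] sum_p)
  finally show ?thesis by simp
qed

text \<open>The subtracted matrix has rank at most \<open>\<mu>\<close> and vanishes on
  \<open>s - \<mu>\<close> orthonormal vectors \<open>v l\<close> orthogonal to all
  \<open>y j\<close>, so there the residual acts like \<open>C\<close>. The squared norms of the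
  images \<open>C (v l)\<close> sum up to the squared singular values with weights
  \<open>p\<close>.\<close>

lemma eckart_young:
  assumes C: "C \<in> carrier_mat m s" and "\<mu> \<le> s"
  shows "(\<Sum>k=\<mu> + 1..s. (singval k C)\<^sup>2)
    \<le> (\<Sum>r<m. \<Sum>j<s. (C $$ (r, j) - (\<Sum>l<\<mu>. X r l * y l j))\<^sup>2)"
proof -
  define R where "R = (\<lambda>r j. C $$ (r, j) - (\<Sum>l<\<mu>. X r l * y l j))"
  obtain w where w: "orthofam s s w"
    and spec: "\<And>x y. ip m (mat_app s C x) (mat_app s C y)
        = (\<Sum>l<s. (singval (Suc l) C)\<^sup>2 * ip s (w l) x * ip s (w l) y)"
    using singval_spectral(1)[OF C] by blast
  obtain v where v: "orthofam s (s - \<mu>) v" and yv: "\<And>l j. l < s - \<mu> \<Longrightarrow> j < \<mu> \<Longrightarrow> ip s (y j) (v l) = 0"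
    using ex_orthofam_orthogonal[of "s - \<mu>" \<mu> s y] \<open>\<mu> \<le> s\<close> by auto
  have Rv: "mv s R (v l) r = mat_app s C (v l) r" if "l < s - \<mu>" for l r
  proof -
    have "(\<Sum>j<s. (\<Sum>l<\<mu>. X r l * y l j) * v l j) = ip s (\<lambda>j. \<Sum>l<\<mu>. X r l * y l j) (v l)"
      by (simp add: ip_def)
    also have "... = 0" by (subst ip_sum_left) (simp add: yv that)
    finally show ?thesis by (simp add: mv_def R_def left_diff_distrib sum_subtractf)
  qed
  \<comment> \<open>\<open>p i\<close> is the squared length of the projection of \<open>w i\<close>
    onto the span of the \<open>v l\<close>: at most 1 by Bessel, with total
    \<open>s - \<mu>\<close> by Parseval.\<close>
  define p where "p = (\<lambda>i. \<Sum>l<s - \<mu>. (ip s (w i) (v l))\<^sup>2)"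
  have w1: "ip_sq s (w i) = 1" if "i < s" for i using w that by (simp add: orthofam_def)
  have p1: "p i \<le> 1" if "i < s" for i
    using bessel[OF v, of "w i"] w1[OF that] by (simp add: p_def ip_commute)
  have "(\<Sum>i<s. p i) = (\<Sum>l<s - \<mu>. \<Sum>i<s. ip s (w i) (v l) * ip s (w i) (v l))"
    unfolding p_def power2_eq_square by (rule sum.swap)
  also have "... = (\<Sum>l<s - \<mu>. 1)"
    unfolding parseval[OF w] using v by (intro sum.cong) (auto simp: orthofam_def)
  finally have sum_p: "(\<Sum>i<s. p i) = real (s - \<mu>)" by simp
  have "(\<Sum>k=\<mu> + 1..s. (singval k C)\<^sup>2) = (\<Sum>i=\<mu>..<s. (singval (Suc i) C)\<^sup>2)"
    using sum.shift_bounds_Suc_ivl[of "\<lambda>k. (singval k C)\<^sup>2" \<mu> s] by (simp add: atLeastLessThanSuc_atLeastAtMost)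
  also have "... \<le> (\<Sum>i<s. (singval (Suc i) C)\<^sup>2 * p i)"
    using singval_spectral(2,3)[OF C] p1 sum_p \<open>\<mu> \<le> s\<close>
    by (intro sum_tail_le_weighted_sum power_mono) (auto simp: p_def sum_nonneg)
  also have "... = (\<Sum>i<s. \<Sum>l<s - \<mu>. (singval (Suc i) C)\<^sup>2 * ip s (w i) (v l) * ip s (w i) (v l))"
    by (simp add: p_def sum_distrib_left power2_eq_square mult.assoc)
  also have "... = (\<Sum>l<s - \<mu>. \<Sum>i<s. (singval (Suc i) C)\<^sup>2 * ip s (w i) (v l) * ip s (w i) (v l))"
    by (rule sum.swap)
  also have "... = (\<Sum>l<s - \<mu>. ip_sq m (mv s R (v l)))"
    unfolding spec[symmetric] by (intro sum.cong refl) (auto simp: Rv intro!: ip_cong)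
  also have "... \<le> (\<Sum>r<m. \<Sum>j<s. (R r j)\<^sup>2)" by (rule frobenius_bessel[OF v])
  finally show ?thesis by (simp add: R_def)
qed

text \<open>Courant--Fischer, stated for two matrices with the same number of rows so that the
  Gram matrices on the row side can be compared although \<open>singval\<close> is defined by the
  Gram matrix on the column side.\<close>

lemma singval_transpose_mono:
  assumes A: "A \<in> carrier_mat m c" and B: "B \<in> carrier_mat m c'"
    and le: "\<And>x. ip_sq c' (mat_app_t m B x)
                 \<le> ip_sq c (mat_app_t m A x)"
  shows "singval (Suc i) (transpose_mat B) \<le> singval (Suc i) A"
proof (cases "i < m")
  case False
  then have "singval (Suc i) (transpose_mat B) = 0"
    using singval_spectral(4)[of "transpose_mat B" c' m "Suc i"] B by simp
  then show ?thesis using singval_spectral(2)[OF A] by simp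
next
  case True
  have Bt: "transpose_mat B \<in> carrier_mat c' m" using B by simp
  let ?Bt = "\<lambda>j r. transpose_mat B $$ (j, r)"
  obtain w where w: "orthofam m m w"
    and Bspec: "\<And>x y. ip c' (mv m ?Bt x) (mv m ?Bt y)
        = (\<Sum>l<m. (singval (Suc l) (transpose_mat B))\<^sup>2 * ip m (w l) x * ip m (w l) y)"
    using singval_spectral(1)[OF Bt] by blast
  obtain v where v: "orthofam c c v"
    and Aspec: "\<And>x y. ip m (mat_app c A x) (mat_app c A y)
        = (\<Sum>l<c. (singval (Suc l) A)\<^sup>2 * ip c (v l) x * ip c (v l) y)"
    using singval_spectral(1)[OF A] by blast
  define At where "At = (\<lambda>j r. A $$ (r, j))"
  \<comment> \<open>\<open>x\<close> will be a unit vector in the span of the first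
    \<open>i + 1\<close> eigenvectors of \<open>B B^T\<close> whose image \<open>z\<close> under the
    transpose of \<open>A\<close> is orthogonal to the first \<open>i\<close> right singular vectors
    of \<open>A\<close>: \<open>i\<close> conditions on \<open>i + 1\<close> coefficients. Indices
    from \<open>c\<close> on impose no condition.\<close>
  define y where "y = (\<lambda>j l. if j < c then ip c (mv m At (w l)) (v j) else 0)"
  obtain a where a: "ip (Suc i) a a = 1" and ya: "\<And>j. j < i \<Longrightarrow> ip (Suc i) (y j) a = 0"
    using ex_unit_orthogonal[of i "Suc i" y] by auto
  define x where "x = (\<lambda>r. \<Sum>l<Suc i. a l * w l r)"
  define z where "z = mv m At x"
  have w': "orthofam m (Suc i) w" using w True by (auto simp: orthofam_def)
  have xx: "ip m x x = 1"
    unfolding x_def ip_orthofam_sum[OF w'] using a by (simp add: ip_def power2_eq_square)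
  have z: "ip c z (v j) = 0" if "j < i" "j < c" for j
  proof -
    have "ip c z (v j) = ip c (\<lambda>r. \<Sum>l<Suc i. a l * mv m At (w l) r) (v j)"
      unfolding z_def x_def by (intro ip_cong) (simp_all only: mv_sum)
    also have "... = ip (Suc i) (y j) a"
      unfolding ip_sum_left using that by (simp add: ip_def[of "Suc i"] y_def algebra_simps)
    finally show ?thesis using ya that by simp
  qed
  have wx: "ip m (w l) x = (if l < Suc i then a l else 0)" if "l < m" for l
    unfolding x_def using True that by (intro ip_orthofam_coeff[OF w]) auto
  define d where "d = (singval (Suc i) (transpose_mat B))\<^sup>2"
  define t where "t = (singval (Suc i) A)\<^sup>2"
  have "d = (\<Sum>l<Suc i. d * (a l)\<^sup>2)"
    using a by (simp add: ip_def power2_eq_square sum_distrib_left[symmetric] del: sum.lessThan_Suc)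
  also have "... \<le> (\<Sum>l<Suc i. (singval (Suc l) (transpose_mat B))\<^sup>2 * (a l)\<^sup>2)"
    unfolding d_def using singval_spectral(2,3)[OF Bt]
    by (intro sum_mono mult_right_mono power_mono) auto
  also have "... = (\<Sum>l<Suc i. (singval (Suc l) (transpose_mat B))\<^sup>2 * ip m (w l) x * ip m (w l) x)"
    using True by (intro sum.cong refl) (auto simp: wx power2_eq_square)
  also have "... \<le> (\<Sum>l<m. (singval (Suc l) (transpose_mat B))\<^sup>2 * ip m (w l) x * ip m (w l) x)"
    using True by (intro sum_mono2) (auto simp: mult.assoc)
  also have "... = ip_sq c' (mat_app_t m B x)"
    unfolding Bspec[symmetric] using B by (intro ip_cong) (auto simp: mv_def)
  also have "... \<le> ip c z z" using le by (simp add: z_def At_def)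
  finally have dz: "d \<le> ip c z z" .
  \<comment> \<open>The singular values of \<open>A\<close> control \<open>A z\<close>, not
    \<open>z\<close>. Writing the squared norm of \<open>z\<close> as the inner product of
    \<open>x\<close> and \<open>A z\<close> bounds its square by \<open>t\<close> times itself, and
    one factor cancels. In the sum below, the terms \<open>l < i\<close> vanish by the choice of
    \<open>x\<close>.\<close>
  have "(ip c z z)\<^sup>2 = (ip m x (mat_app c A z))\<^sup>2"
    by (subst (1) z_def) (simp add: ip_mv At_def)
  also have "... \<le> ip_sq m (mat_app c A z)"
    using ip_Cauchy_Schwarz[of m x] by (simp add: xx)
  also have "... = (\<Sum>l<c. (singval (Suc l) A)\<^sup>2 * (ip c (v l) z * ip c (v l) z))"
    by (simp add: Aspec mult.assoc)
  also have "... \<le> (\<Sum>l<c. t * (ip c (v l) z * ip c (v l) z))"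
  proof (intro sum_mono)
    fix l assume l: "l \<in> {..<c}"
    show "(singval (Suc l) A)\<^sup>2 * (ip c (v l) z * ip c (v l) z) \<le> t * (ip c (v l) z * ip c (v l) z)"
    proof (cases "l < i")
      case True
      then show ?thesis using z[of l] l by (simp add: ip_commute)
    next
      case False
      then show ?thesis unfolding t_def using singval_spectral(2,3)[OF A]
        by (intro mult_right_mono power_mono) auto
    qed
  qed
  also have "... = t * ip c z z" by (simp add: sum_distrib_left[symmetric] parseval[OF v])
  finally have "(ip c z z)\<^sup>2 \<le> t * ip c z z" .
  then have "ip c z z \<le> t"
    using ip_self_nonneg[of c z] by (cases "ip c z z = 0") (auto simp: power2_eq_square t_def)
  with dz have "d \<le> t" by simp
  then show ?thesis unfolding d_def t_def
    using singval_spectral(2)[OF A] by (rule power2_le_imp_le)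
qed

text \<open>\<open>U\<close> takes the eigenvectors of \<open>D\<close> with the
  \<open>\<mu>\<close> largest eigenvalues. What remains has the other eigenvalues, which are
  squared singular values; squaring them again in the Frobenius norm gives fourth powers.\<close>

lemma ex_truncated_eigenspace:
  assumes B: "B \<in> carrier_mat m c" and "\<mu> \<le> m"
    and D: "\<And>a b. a < m \<Longrightarrow> b < m \<Longrightarrow> D a b = (\<Sum>j<c. B $$ (a, j) * B $$ (b, j))"
  shows "\<exists>U. orthofam m \<mu> U \<and>
     (\<Sum>a<m. \<Sum>b<m. (D a b - (\<Sum>l<\<mu>. mv m D (U l) a * U l b))\<^sup>2)
       = (\<Sum>i=\<mu>..<m. singval (Suc i) (transpose_mat B) ^ 4)"
proof -
  have Bt: "transpose_mat B \<in> carrier_mat c m" using B by simp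
  let ?Bt = "\<lambda>j r. transpose_mat B $$ (j, r)"
  obtain w where w: "orthofam m m w"
    and spec: "\<And>x y. ip c (mv m ?Bt x) (mv m ?Bt y)
        = (\<Sum>l<m. (singval (Suc l) (transpose_mat B))\<^sup>2 * ip m (w l) x * ip m (w l) y)"
    using singval_spectral(1)[OF Bt] by blast
  define d where "d = (\<lambda>l. (singval (Suc l) (transpose_mat B))\<^sup>2)"
  have Deq: "D a b = (\<Sum>l<m. d l * w l a * w l b)" if ab: "a < m" "b < m" for a b
  proof -
    \<comment> \<open>Entries of \<open>D\<close> are values of the Gram form at coordinate vectors,
      which turns \<open>spec\<close> into an entrywise eigendecomposition.\<close>
    have e: "mv m ?Bt (\<lambda>r. of_bool (r = a)) j = B $$ (a, j)" if "a < m" "j < c" for a j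
      using that B by (simp add: mv_def of_bool_def if_distrib cong: if_cong)
    have e': "ip m u (\<lambda>r. of_bool (r = a)) = u a" if "a < m" for a and u :: "nat \<Rightarrow> real"
      using that by (simp add: ip_def of_bool_def if_distrib cong: if_cong)
    have "D a b = ip c (mv m ?Bt (\<lambda>r. of_bool (r = a))) (mv m ?Bt (\<lambda>r. of_bool (r = b)))"
      unfolding D[OF ab] ip_def using e ab by simp
    then show ?thesis using ab by (simp add: spec e' d_def)
  qed
  have Dw: "mv m D (w l) a = d l * w l a" if "l < m" "a < m" for l a
  proof -
    have "mv m D (w l) a = ip m (\<lambda>b. \<Sum>l'<m. (d l' * w l' a) * w l' b) (w l)"
      unfolding mv_def ip_def using that by (intro sum.cong) (auto simp: Deq)
    also have "... = d l * w l a"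
      using ip_orthofam_coeff[OF w order_refl, of l "\<lambda>l'. d l' * w l' a"] that by (simp add: ip_commute)
    finally show ?thesis .
  qed
  define g where "g = (\<lambda>l. if l < \<mu> then 0 else d l)"
  have res: "D a b - (\<Sum>l<\<mu>. mv m D (w l) a * w l b) = (\<Sum>l<m. (g l * w l a) * w l b)"
    if ab: "a < m" "b < m" for a b
  proof -
    have "(\<Sum>l<\<mu>. mv m D (w l) a * w l b) = (\<Sum>l<\<mu>. d l * w l a * w l b)"
      using ab \<open>\<mu> \<le> m\<close> by (intro sum.cong) (auto simp: Dw)
    also have "... = (\<Sum>l<m. (d l - g l) * w l a * w l b)"
      using \<open>\<mu> \<le> m\<close> by (intro sum.mono_neutral_cong_left) (auto simp: g_def)
    finally show ?thesis using ab by (simp add: Deq sum_subtractf[symmetric] algebra_simps)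
  qed
  have "(\<Sum>a<m. \<Sum>b<m. (D a b - (\<Sum>l<\<mu>. mv m D (w l) a * w l b))\<^sup>2)
      = (\<Sum>a<m. ip_sq m (\<lambda>b. \<Sum>l<m. (g l * w l a) * w l b))"
    using res by (simp add: ip_def power2_eq_square)
  also have "... = (\<Sum>a<m. \<Sum>l<m. (g l * w l a)\<^sup>2)" by (simp add: ip_orthofam_sum[OF w])
  also have "... = (\<Sum>l<m. \<Sum>a<m. (g l * w l a)\<^sup>2)" by (rule sum.swap)
  also have "... = (\<Sum>l<m. (g l)\<^sup>2 * ip_sq m (w l))"
    by (simp add: ip_def power_mult_distrib sum_distrib_left power2_eq_square mult_ac)
  also have "... = (\<Sum>l<m. (g l)\<^sup>2)" using w by (simp add: orthofam_def)
  also have "... = (\<Sum>i=\<mu>..<m. singval (Suc i) (transpose_mat B) ^ 4)"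
    by (rule sum.mono_neutral_cong_right) (auto simp: g_def d_def)
  finally show ?thesis using w \<open>\<mu> \<le> m\<close> by (intro exI[of _ w]) (auto simp: orthofam_def)
qed

text \<open>The rank counts a maximal independent set \<open>S\<close> of columns, and by maximality
  every column is a combination of \<open>S\<close>.\<close>

lemma rank_factorization:
  fixes A :: "real mat"
  assumes A: "A \<in> carrier_mat m c"
  shows "\<exists>X Z. \<forall>i<m. \<forall>j<c. A $$ (i, j) = (\<Sum>l<mat_rank A. X i l * Z l j)"
proof -
  interpret vec_space "TYPE(real)" m .
  have cA: "set (cols A) \<subseteq> carrier_vec m" using A cols_dim by blast
  have lin_indpt_empty: "lin_indpt {}" by (rule finite_lin_indpt2) auto
  obtain S where S: "maximal S (\<lambda>T. T \<subseteq> set (cols A) \<and> lin_indpt T)" "finite S"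
    using maximal_exists_superset[of "set (cols A)" "\<lambda>T. T \<subseteq> set (cols A) \<and> lin_indpt T" "{}"]
      lin_indpt_empty by auto
  have rank: "mat_rank A = card S"
    using rank_card_indpt[OF A S(1)] A by (simp add: mat_rank_def)
  have S': "S \<subseteq> set (cols A)" "lin_indpt S" using S(1) by (auto simp: maximal_def)
  have Sc: "S \<subseteq> carrier_vec m" using S' cA by auto
  have span: "v \<in> span S" if v: "v \<in> set (cols A)" for v
  proof (cases "v \<in> S")
    case True
    then show ?thesis using span_mem Sc by auto
  next
    case False
    have "lin_dep (insert v S)"
      using S(1) False v S' unfolding maximal_def by (metis insertI1 insert_subset subset_insertI)
    then show ?thesis using lin_dep_iff_in_span[of S v] Sc S' v cA False by auto
  qed
  obtain f where f: "bij_betw f {..<card S} S"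
    using ex_bij_betw_nat_finite[OF S(2)] by (auto simp: atLeast0LessThan)
  have "\<exists>a. col A j = lincomb a S" if "j < c" for j
  proof -
    have "col A j \<in> set (cols A)" using that A by (metis carrier_matD(2) cols_length cols_nth nth_mem)
    then show ?thesis using span finite_span[OF S(2)] Sc by auto
  qed
  then obtain a where a: "\<And>j. j < c \<Longrightarrow> col A j = lincomb (a j) S" by metis
  have "A $$ (i, j) = (\<Sum>l<mat_rank A. f l $ i * a j (f l))" if ij: "i < m" "j < c" for i j
  proof -
    have "A $$ (i, j) = col A j $ i" using ij A by simp
    also have "... = (\<Sum>x\<in>S. a j x * x $ i)" using a[OF ij(2)] lincomb_index[OF ij(1) Sc] by simp
    also have "... = (\<Sum>l<card S. a j (f l) * f l $ i)" by (rule sum.reindex_bij_betw[OF f, symmetric])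
    finally show ?thesis by (simp add: rank mult.commute)
  qed
  then show ?thesis by (intro exI[of _ "\<lambda>i l. f l $ i"] exI[of _ "\<lambda>l j. a j (f l)"]) auto
qed

text \<open>If the rank were at most \<open>\<mu>\<close>, the equations given by the
  \<open>Z j\<close> would have a unit solution \<open>x\<close> in the span of the first
  \<open>\<mu> + 1\<close> right singular vectors; then \<open>A x = 0\<close>, although its norm is
  at least the singular value of index \<open>\<mu> + 1\<close>. This lets the rank in the error
  bound pay for a factor \<open>\<mu> + 1\<close>.\<close>

lemma mat_rank_gt_if_singval_pos:
  assumes A: "A \<in> carrier_mat m c" and pos: "singval (Suc \<mu>) A > 0"
  shows "\<mu> < mat_rank A"
proof (rule ccontr)
  assume "\<not> \<mu> < mat_rank A"
  then have le: "mat_rank A < Suc \<mu>" by simp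
  have \<mu>: "\<mu> < c" using singval_spectral(4)[OF A, of "Suc \<mu>"] pos by force
  obtain X Z where XZ: "\<And>i j. i < m \<Longrightarrow> j < c \<Longrightarrow> A $$ (i, j) = (\<Sum>l<mat_rank A. X i l * Z l j)"
    using rank_factorization[OF A] by blast
  obtain w where w: "orthofam c c w"
    and spec: "\<And>x y. ip m (mat_app c A x) (mat_app c A y)
        = (\<Sum>l<c. (singval (Suc l) A)\<^sup>2 * ip c (w l) x * ip c (w l) y)"
    using singval_spectral(1)[OF A] by blast
  obtain a where a: "ip (Suc \<mu>) a a = 1" "\<And>j. j < mat_rank A \<Longrightarrow> ip (Suc \<mu>) (\<lambda>l. ip c (Z j) (w l)) a = 0"
    using ex_unit_orthogonal[OF le, of "\<lambda>j l. ip c (Z j) (w l)"] by auto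
  define x where "x = (\<lambda>j. \<Sum>l<Suc \<mu>. a l * w l j)"
  have Zx: "ip c (Z j) x = 0" if "j < mat_rank A" for j
    unfolding x_def ip_sum_right using a(2)[OF that] by (simp add: ip_def[of "Suc \<mu>"] mult.commute)
  have Ax: "mat_app c A x i = 0" if "i < m" for i
  proof -
    have "mat_app c A x i = ip c (\<lambda>j. \<Sum>l<mat_rank A. X i l * Z l j) x"
      unfolding mv_def ip_def using that by (intro sum.cong) (auto simp: XZ)
    also have "... = 0" unfolding ip_sum_left using Zx by simp
    finally show ?thesis .
  qed
  have wx: "ip c (w l) x = (if l < Suc \<mu> then a l else 0)" if "l < c" for l
    unfolding x_def using \<mu> that by (intro ip_orthofam_coeff[OF w]) auto
  have "(singval (Suc \<mu>) A)\<^sup>2 = (\<Sum>l<Suc \<mu>. (singval (Suc \<mu>) A)\<^sup>2 * (a l)\<^sup>2)"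
    using a(1) by (simp add: ip_def power2_eq_square sum_distrib_left[symmetric] del: sum.lessThan_Suc)
  also have "... \<le> (\<Sum>l<Suc \<mu>. (singval (Suc l) A)\<^sup>2 * (a l)\<^sup>2)"
    using singval_spectral(2,3)[OF A] by (intro sum_mono mult_right_mono power_mono) auto
  also have "... = (\<Sum>l<Suc \<mu>. (singval (Suc l) A)\<^sup>2 * ip c (w l) x * ip c (w l) x)"
    using \<mu> by (intro sum.cong refl) (auto simp: wx power2_eq_square)
  also have "... \<le> (\<Sum>l<c. (singval (Suc l) A)\<^sup>2 * ip c (w l) x * ip c (w l) x)"
    using \<mu> by (intro sum_mono2) (auto simp: mult.assoc)
  also have "... = 0" unfolding spec[symmetric] using Ax by (simp add: ip_def)
  finally show False using pos by simp
qed

section \<open>Projection error of a sketch\<close>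

text \<open>Encoded through \<open>L2_set\<close> to inherit its triangle inequality.\<close>

definition fro :: "nat \<Rightarrow> nat \<Rightarrow> (nat \<Rightarrow> nat \<Rightarrow> real) \<Rightarrow> real" where
  "fro m n F = L2_set (\<lambda>(i, j). F i j) ({..<m} \<times> {..<n})"

definition mm :: "nat \<Rightarrow> (nat \<Rightarrow> nat \<Rightarrow> real) \<Rightarrow> (nat \<Rightarrow> nat \<Rightarrow> real) \<Rightarrow> nat \<Rightarrow> nat \<Rightarrow> real" where
  "mm n A B = (\<lambda>i j. \<Sum>k<n. A i k * B k j)"

lemma fro_def': "fro m n F = sqrt (\<Sum>i<m. \<Sum>j<n. (F i j)\<^sup>2)"
  by (simp add: fro_def L2_set_def sum.cartesian_product case_prod_unfold)

lemma fro_nonneg [simp]: "fro m n F \<ge> 0"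
  by (simp add: fro_def)

lemma fro_power2: "(fro m n F)\<^sup>2 = (\<Sum>i<m. \<Sum>j<n. (F i j)\<^sup>2)"
  by (simp add: fro_def' sum_nonneg)

lemma fro_cong: "(\<And>i j. i < m \<Longrightarrow> j < n \<Longrightarrow> F i j = F' i j) \<Longrightarrow> fro m n F = fro m n F'"
  by (simp add: fro_def')

lemma fro_triangle: "fro m n (\<lambda>i j. F i j + F' i j) \<le> fro m n F + fro m n F'"
  unfolding fro_def using L2_set_triangle_ineq[of "\<lambda>(i, j). F i j" "\<lambda>(i, j). F' i j" "{..<m} \<times> {..<n}"]
  by (simp add: case_prod_unfold)

lemma fro_minus: "fro m n (\<lambda>i j. - F i j) = fro m n F"
  by (simp add: fro_def')

lemma fro_triangle_diff: "fro m n (\<lambda>i j. F i j - F' i j) \<le> fro m n F + fro m n F'"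
  using fro_triangle[of m n F "\<lambda>i j. - F' i j"] by (simp add: fro_minus)

lemma fro_mm: "fro m n (mm k A B) \<le> fro m k A * fro k n B"
proof -
  have "(fro m n (mm k A B))\<^sup>2 \<le> (\<Sum>i<m. \<Sum>j<n. (\<Sum>l<k. (A i l)\<^sup>2) * (\<Sum>l<k. (B l j)\<^sup>2))"
    unfolding fro_power2 mm_def by (intro sum_mono Cauchy_Schwarz_ineq_sum)
  also have "... = (\<Sum>i<m. \<Sum>l<k. (A i l)\<^sup>2) * (\<Sum>j<n. \<Sum>l<k. (B l j)\<^sup>2)"
    by (simp add: sum_product)
  also have "(\<Sum>j<n. \<Sum>l<k. (B l j)\<^sup>2) = (\<Sum>l<k. \<Sum>j<n. (B l j)\<^sup>2)" by (rule sum.swap)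
  finally have "(fro m n (mm k A B))\<^sup>2 \<le> (fro m k A * fro k n B)\<^sup>2"
    by (simp add: fro_power2 power_mult_distrib)
  then show ?thesis by (rule power2_le_imp_le) simp
qed

lemma mm_assoc: "mm n (mm k A B) C i j = mm k A (mm n B C) i j"
proof -
  have "mm n (mm k A B) C i j = (\<Sum>b<n. \<Sum>a<k. A i a * B a b * C b j)"
    by (simp add: mm_def sum_distrib_right)
  also have "... = (\<Sum>a<k. \<Sum>b<n. A i a * B a b * C b j)" by (rule sum.swap)
  finally show ?thesis by (simp add: mm_def sum_distrib_left algebra_simps)
qed

text \<open>The matrix \<open>1 - q q^T\<close>, where \<open>q\<close> has the given vectors as
  columns; for orthonormal vectors, the projection onto their orthogonal complement.\<close>

definition orth_compl :: "nat \<Rightarrow> (nat \<Rightarrow> nat \<Rightarrow> real) \<Rightarrow> nat \<Rightarrow> nat \<Rightarrow> real" where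
  "orth_compl \<mu> q = (\<lambda>i a. of_bool (i = a) - (\<Sum>l<\<mu>. q l i * q l a))"

lemma mm_orth_compl:
  assumes "i < m"
  shows "mm m (orth_compl \<mu> q) X i j = X i j - (\<Sum>l<\<mu>. ip m (q l) (\<lambda>a. X a j) * q l i)"
proof -
  have "mm m (orth_compl \<mu> q) X i j = (\<Sum>a<m. of_bool (i = a) * X a j) - (\<Sum>a<m. \<Sum>l<\<mu>. q l i * q l a * X a j)"
    by (simp add: mm_def orth_compl_def left_diff_distrib sum_subtractf sum_distrib_right)
  also have "(\<Sum>a<m. of_bool (i = a) * X a j) = X i j"
  proof -
    have "(\<Sum>a<m. of_bool (i = a) * X a j) = (\<Sum>a<m. if i = a then X a j else 0)"
      by (intro sum.cong) auto
    then show ?thesis using assms by simp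
  qed
  also have "(\<Sum>a<m. \<Sum>l<\<mu>. q l i * q l a * X a j) = (\<Sum>l<\<mu>. \<Sum>a<m. q l i * q l a * X a j)" by (rule sum.swap)
  finally show ?thesis by (simp add: ip_def sum_distrib_left algebra_simps)
qed

text \<open>Pythagoras in each column of \<open>X\<close>.\<close>

lemma fro_orth_compl:
  assumes q: "orthofam m \<mu> q"
  shows "fro m n (mm m (orth_compl \<mu> q) X) \<le> fro m n X"
proof -
  have "(\<Sum>i<m. (mm m (orth_compl \<mu> q) X i j)\<^sup>2) \<le> (\<Sum>i<m. (X i j)\<^sup>2)" for j
  proof -
    define x where "x = (\<lambda>a. X a j)"
    define c where "c = (\<lambda>l. ip m (q l) x)"
    define p where "p = (\<lambda>i. \<Sum>l<\<mu>. c l * q l i)"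
    have "ip m p x = (\<Sum>l<\<mu>. (c l)\<^sup>2)" unfolding p_def ip_sum_left by (simp add: c_def power2_eq_square)
    moreover have "ip m p p = (\<Sum>l<\<mu>. (c l)\<^sup>2)" unfolding p_def by (rule ip_orthofam_sum[OF q])
    ultimately have "ip_sq m (\<lambda>i. x i - p i) = ip m x x - (\<Sum>l<\<mu>. (c l)\<^sup>2)"
      by (simp add: ip_diff_left ip_diff_right ip_commute[of m x p])
    also have "... \<le> ip m x x" by (simp add: sum_nonneg)
    finally show ?thesis
      by (simp add: ip_def mm_orth_compl x_def p_def c_def power2_eq_square)
  qed
  then have "(\<Sum>j<n. \<Sum>i<m. (mm m (orth_compl \<mu> q) X i j)\<^sup>2) \<le> (\<Sum>j<n. \<Sum>i<m. (X i j)\<^sup>2)"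
    by (rule sum_mono)
  then have "(fro m n (mm m (orth_compl \<mu> q) X))\<^sup>2 \<le> (fro m n X)\<^sup>2"
    unfolding fro_power2
    by (simp only: sum.swap[of "\<lambda>i j. (mm m (orth_compl \<mu> q) X i j)\<^sup>2" "{..<n}" "{..<m}"]
        sum.swap[of "\<lambda>i j. (X i j)\<^sup>2" "{..<n}" "{..<m}"])
  then show ?thesis by (rule power2_le_imp_le) simp
qed

lemma fro_orthofam_outer:
  assumes U: "orthofam m \<mu> U"
  shows "(fro s m (\<lambda>j a. \<Sum>l<\<mu>. f l j * U l a))\<^sup>2 = (\<Sum>l<\<mu>. ip_sq s (f l))"
proof -
  have "(fro s m (\<lambda>j a. \<Sum>l<\<mu>. f l j * U l a))\<^sup>2 = (\<Sum>j<s. \<Sum>l<\<mu>. (f l j)\<^sup>2)"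
    unfolding fro_power2 using ip_orthofam_sum[OF U] by (simp add: ip_def power2_eq_square)
  also have "... = (\<Sum>l<\<mu>. \<Sum>j<s. (f l j)\<^sup>2)" by (rule sum.swap)
  finally show ?thesis by (simp add: ip_def power2_eq_square)
qed

text \<open>With \<open>R = D (1 - U U^T)\<close>, \<open>Y = U^T G\<close> and \<open>f\<close> a
  right inverse of \<open>Y\<close>, the identity \<open>D U Y = D G - R G\<close> gives
  \<open>D U = (D G - R G) f\<close>. So \<open>D\<close> is \<open>R\<close> plus terms passing
  through \<open>D G\<close> or \<open>R G\<close>, and the projection is small on each: by
  contraction on \<open>R\<close> and \<open>R G\<close>, by the hypothesis \<open>C\<close> on
  \<open>D G\<close>.\<close>

lemma fro_orth_compl_bound:
  assumes q: "orthofam m \<mu>' q" and U: "orthofam m \<mu> U"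
    and \<kappa>: "fro m m (\<lambda>a b. D a b - (\<Sum>l<\<mu>. mv m D (U l) a * U l b)) \<le> \<kappa>"
    and Y: "\<And>l j. Y l j = ip m (U l) (\<lambda>a. G a j)"
    and dual: "\<And>i j. i < \<mu> \<Longrightarrow> j < \<mu> \<Longrightarrow> ip s (Y j) (f i) = of_bool (i = j)"
    and f: "(\<Sum>l<\<mu>. ip_sq s (f l)) \<le> t\<^sup>2" and t: "t \<ge> 0"
    and C: "fro m s (mm m (orth_compl \<mu>' q) (mm m D G))
        \<le> fro m s (\<lambda>r j. mm m D G r j - (\<Sum>l<\<mu>. mv m D (U l) r * Y l j))"
  shows "fro m m (mm m (orth_compl \<mu>' q) D) \<le> \<kappa> * (1 + 2 * fro m s G * t)"
proof -
  define R where "R = (\<lambda>a b. D a b - (\<Sum>l<\<mu>. mv m D (U l) a * U l b))"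
  define F where "F = (\<lambda>j a. \<Sum>l<\<mu>. f l j * U l a)"
  define E where "E = orth_compl \<mu>' q"
  have \<kappa>': "fro m m R \<le> \<kappa>" using \<kappa> by (simp add: R_def)
  have \<kappa>0: "\<kappa> \<ge> 0" using \<kappa>' fro_nonneg[of m m R] by linarith
  have RG: "mm m R G r j = mm m D G r j - (\<Sum>l<\<mu>. mv m D (U l) r * Y l j)" for r j
  proof -
    have "(\<Sum>b<m. (\<Sum>l<\<mu>. mv m D (U l) r * U l b) * G b j) = ip m (\<lambda>b. \<Sum>l<\<mu>. mv m D (U l) r * U l b) (\<lambda>b. G b j)"
      by (simp add: ip_def)
    also have "... = (\<Sum>l<\<mu>. mv m D (U l) r * Y l j)" unfolding ip_sum_left by (simp add: Y)
    finally show ?thesis by (simp add: mm_def R_def left_diff_distrib sum_subtractf)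
  qed
  have froF: "fro s m F \<le> t"
    using fro_orthofam_outer[OF U, of s f] f t by (intro power2_le_imp_le[of "fro s m F" t]) (auto simp: F_def)
  have froRG: "fro m s (mm m R G) \<le> \<kappa> * fro m s G"
    using fro_mm[of m s m R G] mult_right_mono[OF \<kappa>', of "fro m s G"] by simp
  have froEC: "fro m s (mm m E (mm m D G)) \<le> \<kappa> * fro m s G"
    using C froRG by (simp add: E_def RG[abs_def])
  have DU: "mv m D (U l) r = (\<Sum>j<s. (mm m D G r j - mm m R G r j) * f l j)" if "l < \<mu>" for l r
  proof -
    have "(\<Sum>j<s. (mm m D G r j - mm m R G r j) * f l j) = ip s (\<lambda>j. \<Sum>l'<\<mu>. mv m D (U l') r * Y l' j) (f l)"
      by (simp add: RG ip_def)
    also have "... = (\<Sum>l'<\<mu>. mv m D (U l') r * of_bool (l = l'))"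
      unfolding ip_sum_left using dual that by (intro sum.cong) auto
    also have "... = mv m D (U l) r" using that by (simp add: of_bool_def if_distrib cong: if_cong)
    finally show ?thesis by simp
  qed
  \<comment> \<open>\<open>D = R + (D U) U^T\<close> with \<open>D U\<close> expressed through the
    sketch; here \<open>F = f U^T\<close>.\<close>
  have D: "D a b = R a b + mm s (mm m D G) F a b - mm s (mm m R G) F a b" for a b
  proof -
    have "(\<Sum>l<\<mu>. mv m D (U l) a * U l b) = (\<Sum>l<\<mu>. \<Sum>j<s. (mm m D G a j - mm m R G a j) * f l j * U l b)"
      by (simp add: DU sum_distrib_right)
    also have "... = (\<Sum>j<s. \<Sum>l<\<mu>. (mm m D G a j - mm m R G a j) * f l j * U l b)" by (rule sum.swap)
    also have "... = mm s (mm m D G) F a b - mm s (mm m R G) F a b"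
      unfolding mm_def[of s] F_def by (simp add: sum_distrib_left algebra_simps sum_subtractf)
    finally show ?thesis by (simp add: R_def)
  qed
  have ED: "mm m E D i j = mm m E R i j + mm s (mm m E (mm m D G)) F i j - mm m E (mm s (mm m R G) F) i j" for i j
  proof -
    have "mm m E D i j = mm m E (\<lambda>a b. R a b + mm s (mm m D G) F a b - mm s (mm m R G) F a b) i j"
      unfolding mm_def[of m E] by (rule sum.cong[OF refl]) (rule arg_cong[OF D])
    also have "... = mm m E R i j + mm m E (mm s (mm m D G) F) i j - mm m E (mm s (mm m R G) F) i j"
      unfolding mm_def[of m E] by (simp add: algebra_simps sum.distrib sum_subtractf)
    finally show ?thesis by (simp add: mm_assoc)
  qed
  have "fro m m (mm m E D)
      \<le> fro m m (mm m E R) + fro m m (mm s (mm m E (mm m D G)) F) + fro m m (mm m E (mm s (mm m R G) F))"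
  proof -
    have "fro m m (mm m E D)
      = fro m m (\<lambda>i j. mm m E R i j + mm s (mm m E (mm m D G)) F i j - mm m E (mm s (mm m R G) F) i j)"
      by (rule fro_cong) (rule ED)
    also have "... \<le> fro m m (\<lambda>i j. mm m E R i j + mm s (mm m E (mm m D G)) F i j) + fro m m (mm m E (mm s (mm m R G) F))"
      by (rule fro_triangle_diff)
    also have "fro m m (\<lambda>i j. mm m E R i j + mm s (mm m E (mm m D G)) F i j)
        \<le> fro m m (mm m E R) + fro m m (mm s (mm m E (mm m D G)) F)" by (rule fro_triangle)
    finally show ?thesis by simp
  qed
  also have "fro m m (mm m E R) \<le> \<kappa>"
    using fro_orth_compl[OF q, of m R] \<kappa>' by (simp add: E_def)
  also have "fro m m (mm s (mm m E (mm m D G)) F) \<le> \<kappa> * fro m s G * t"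
    using fro_mm[of m m s "mm m E (mm m D G)" F] mult_mono[OF froEC froF] \<kappa>0 by simp
  also have "fro m m (mm m E (mm s (mm m R G) F)) \<le> \<kappa> * fro m s G * t"
    using fro_orth_compl[OF q, of m "mm s (mm m R G) F"] fro_mm[of m m s "mm m R G" F]
      mult_mono[OF froRG froF] \<kappa>0 by (simp add: E_def)
  finally show ?thesis by (simp add: E_def algebra_simps)
qed

lemma trace_le_fro: "(\<Sum>i<m. X i i) \<le> sqrt (real m) * fro m m X"
proof -
  have "(\<Sum>i<m. X i i)\<^sup>2 \<le> (\<Sum>i<m. 1\<^sup>2) * (\<Sum>i<m. (X i i)\<^sup>2)"
    using Cauchy_Schwarz_ineq_sum[of "\<lambda>_. 1" "\<lambda>i. X i i" "{..<m}"] by simp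
  also have "... \<le> real m * (fro m m X)\<^sup>2"
  proof -
    have "(\<Sum>i<m. (X i i)\<^sup>2) \<le> (\<Sum>i<m. \<Sum>j<m. (X i j)\<^sup>2)"
      by (intro sum_mono member_le_sum[of _ "{..<m}"]) auto
    then show ?thesis by (simp add: fro_power2 mult_left_mono)
  qed
  also have "... = (sqrt (real m) * fro m m X)\<^sup>2" by (simp add: power_mult_distrib)
  finally show ?thesis by (rule power2_le_imp_le) simp
qed

text \<open>Links the acceptance criterion for \<open>Q\<close> to the abstract bound. The
  projection off \<open>Q\<close> annihilates \<open>Q R\<close>, so on the sketch it leaves at most
  the residual, hence at most the singular tail of the sketch; by Eckart-Young that is at most the
  error of any competitor of rank at most \<open>\<mu>\<close>. Passing from the Frobenius norm to
  the trace costs \<open>sqrt m\<close>.\<close>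

lemma sketch_projection_error:
  assumes B: "B \<in> carrier_mat m c" and Q: "Q \<in> carrier_mat m \<mu>" "orthonormal_mat Q"
    and G: "G \<in> carrier_mat m (\<mu> + K)" and R: "R \<in> carrier_mat \<mu> (\<mu> + K)"
    and QR: "mat_fnorm (Q * R - B * transpose_mat B * G)
        \<le> sqrt (\<Sum>k=\<mu> + 1..\<mu> + K. (singval k (B * transpose_mat B * G))\<^sup>2)"
    and D: "\<And>a b. a < m \<Longrightarrow> b < m \<Longrightarrow> D a b = (\<Sum>j<c. B $$ (a, j) * B $$ (b, j))"
    and U: "orthofam m \<mu> U"
    and \<kappa>: "fro m m (\<lambda>a b. D a b - (\<Sum>l<\<mu>. mv m D (U l) a * U l b)) \<le> \<kappa>"
    and dual: "\<And>i j. i < \<mu> \<Longrightarrow> j < \<mu> \<Longrightarrow>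
        ip (\<mu> + K) (\<lambda>b. \<Sum>a<m. U j a * G $$ (a, b)) (f i) = of_bool (i = j)"
    and f: "(\<Sum>l<\<mu>. ip (\<mu> + K) (f l) (f l)) \<le> t\<^sup>2" and t: "t \<ge> 0"
  shows "(\<Sum>a<m. D a a) - (\<Sum>l<\<mu>. \<Sum>a<m. \<Sum>b<m. Q $$ (a, l) * D a b * Q $$ (b, l))
    \<le> sqrt (real m) * (\<kappa> * (1 + 2 * mat_fnorm G * t))"
proof -
  let ?s = "\<mu> + K"
  define g where "g = (\<lambda>a b. G $$ (a, b))"
  define q where "q = (\<lambda>l a. Q $$ (a, l))"
  define C where "C = B * transpose_mat B * G"
  define E where "E = orth_compl \<mu> q"
  have q: "orthofam m \<mu> q"
  proof -
    have "ip m (q i) (q j) = of_bool (i = j)" if "i < \<mu>" "j < \<mu>" for i j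
    proof -
      have "ip m (q i) (q j) = (transpose_mat Q * Q) $$ (i, j)"
        using Q that by (simp add: ip_def q_def scalar_prod_def atLeast0LessThan)
      also have "transpose_mat Q * Q = 1\<^sub>m \<mu>" using Q by (simp add: orthonormal_mat_def)
      finally show ?thesis using that by simp
    qed
    then show ?thesis by (simp add: orthofam_def)
  qed
  have C: "C \<in> carrier_mat m ?s" using B G by (auto simp: C_def)
  have BB: "(B * transpose_mat B) $$ (a, b) = D a b" if "a < m" "b < m" for a b
    using B that by (simp add: D scalar_prod_def atLeast0LessThan)
  have Ceq: "C $$ (a, j) = mm m D g a j" if "a < m" "j < ?s" for a j
  proof -
    have "C $$ (a, j) = (\<Sum>b<m. (B * transpose_mat B) $$ (a, b) * G $$ (b, j))"
      unfolding C_def using B G that by (subst index_mult_mat) (auto simp: scalar_prod_def atLeast0LessThan)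
    then show ?thesis using BB that by (simp add: mm_def g_def)
  qed
  have QRC: "(Q * R - C) $$ (a, j) = (\<Sum>l<\<mu>. Q $$ (a, l) * R $$ (l, j)) - mm m D g a j" if "a < m" "j < ?s" for a j
    using Q R C Ceq that by (simp add: scalar_prod_def atLeast0LessThan)
  define Z where "Z = (\<lambda>a j. mm m D g a j - (\<Sum>l<\<mu>. R $$ (l, j) * q l a))"
  have "fro m ?s (mm m E (mm m D g)) = fro m ?s (mm m E Z)"
  proof (rule fro_cong)
    fix i j assume ij: "i < m" "j < ?s"
    have "ip m (q l) (\<lambda>a. Z a j) = ip m (q l) (\<lambda>a. mm m D g a j) - R $$ (l, j)" if "l < \<mu>" for l
    proof -
      have "ip m (q l) (\<lambda>a. \<Sum>l<\<mu>. R $$ (l, j) * q l a) = R $$ (l, j)"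
        using ip_orthofam_coeff[OF q order_refl that] that by simp
      then show ?thesis by (simp add: Z_def ip_diff_right)
    qed
    then show "mm m E (mm m D g) i j = mm m E Z i j"
      unfolding E_def mm_orth_compl[OF ij(1)] by (simp add: Z_def left_diff_distrib sum_subtractf)
  qed
  also have "... \<le> fro m ?s Z" unfolding E_def by (rule fro_orth_compl[OF q])
  also have "... = mat_fnorm (Q * R - C)"
  proof -
    have dim: "dim_row (Q * R - C) = m" "dim_col (Q * R - C) = ?s" using C by auto
    show ?thesis
      unfolding mat_fnorm_def fro_def' dim
      by (intro arg_cong[of _ _ sqrt] sum.cong refl)
        (auto simp: QRC Z_def q_def power2_commute mult.commute simp del: index_minus_mat)
  qed
  also have "... \<le> sqrt (\<Sum>k=\<mu> + 1..\<mu> + K. (singval k C)\<^sup>2)" using QR by (simp add: C_def)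
  \<comment> \<open>The competitor is \<open>(D U) (U^T G)\<close>, whose error is
    \<open>D (1 - U U^T) G\<close>.\<close>
  also have "... \<le> fro m ?s (\<lambda>r j. mm m D g r j - (\<Sum>l<\<mu>. mv m D (U l) r * (\<Sum>a<m. U l a * g a j)))"
    unfolding fro_def'
    using eckart_young[OF C, of \<mu> "\<lambda>r l. mv m D (U l) r" "\<lambda>l j. \<Sum>a<m. U l a * g a j"]
    by (simp add: Ceq)
  finally have "fro m m (mm m E D) \<le> \<kappa> * (1 + 2 * fro m ?s g * t)"
    unfolding E_def using q U \<kappa> dual f t
    by (intro fro_orth_compl_bound[where Y = "\<lambda>l j. \<Sum>a<m. U l a * g a j" and f = f and U = U])
       (auto simp: ip_def[of m] g_def)
  moreover have "fro m ?s g = mat_fnorm G" using G by (simp add: fro_def' mat_fnorm_def g_def)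
  moreover have "(\<Sum>i<m. mm m E D i i) = (\<Sum>a<m. D a a) - (\<Sum>l<\<mu>. \<Sum>a<m. \<Sum>b<m. Q $$ (a, l) * D a b * Q $$ (b, l))"
  proof -
    have "(\<Sum>i<m. mm m E D i i) = (\<Sum>a<m. D a a) - (\<Sum>b<m. \<Sum>l<\<mu>. \<Sum>a<m. q l a * D a b * q l b)"
      by (simp add: E_def mm_orth_compl sum_subtractf ip_def sum_distrib_right)
    also have "(\<Sum>b<m. \<Sum>l<\<mu>. \<Sum>a<m. q l a * D a b * q l b) = (\<Sum>l<\<mu>. \<Sum>b<m. \<Sum>a<m. q l a * D a b * q l b)"
      by (rule sum.swap)
    also have "... = (\<Sum>l<\<mu>. \<Sum>a<m. \<Sum>b<m. q l a * D a b * q l b)"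
      by (intro sum.cong refl sum.swap)
    finally show ?thesis by (simp add: q_def)
  qed
  ultimately show ?thesis
    using trace_le_fro[of "mm m E D" m] mult_left_mono[of "fro m m (mm m E D)" "\<kappa> * (1 + 2 * mat_fnorm G * t)" "sqrt (real m)"]
    by simp
qed

section \<open>Gaussian measure\<close>

abbreviation std_normal :: "real measure" where
  "std_normal \<equiv> density lborel (\<lambda>x. ennreal (std_normal_density x))"

abbreviation PiL :: "'i set \<Rightarrow> ('i \<Rightarrow> real) measure" where
  "PiL I \<equiv> Pi\<^sub>M I (\<lambda>_. lborel)"

abbreviation PiB :: "'i set \<Rightarrow> ('i \<Rightarrow> real) measure" where
  "PiB I \<equiv> Pi\<^sub>M I (\<lambda>_. borel)"

definition gauss :: "'i set \<Rightarrow> ('i \<Rightarrow> real) measure" where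
  "gauss I = Pi\<^sub>M I (\<lambda>_. std_normal)"

lemma prob_space_std_normal: "prob_space std_normal"
  by (rule prob_space_normal_density) simp

lemma product_sigma_finite_lborel: "product_sigma_finite (\<lambda>_ :: 'i. lborel :: real measure)"
  by standard

lemma sets_gauss [simp, measurable_cong]: "sets (gauss I) = sets (PiB I)"
  unfolding gauss_def by (rule sets_PiM_cong) auto

lemma space_gauss [simp]: "space (gauss I) = (\<Pi>\<^sub>E i\<in>I. UNIV)"
  by (simp add: gauss_def space_PiM)

lemma prob_space_gauss: "prob_space (gauss I)"
  unfolding gauss_def by (intro prob_space_PiM prob_space_std_normal)

lemma sets_PiM_lborel [measurable_cong]: "sets (PiL I) = sets (PiB I)"
  by (rule sets_PiM_cong) auto

text \<open>The product form gives independence; the density form is what the change of variables in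
  \<open>gauss_swap\<close> works with.\<close>

lemma gauss_eq_density:
  assumes "finite I"
  shows "gauss I = density (PiL I) (\<lambda>x. ennreal (\<Prod>i\<in>I. std_normal_density (x i)))"
proof -
  interpret P: product_sigma_finite "\<lambda>_ :: 'a. std_normal"
    using prob_space_std_normal
    by (simp add: product_sigma_finite_def prob_space_imp_sigma_finite)
  interpret L: product_sigma_finite "\<lambda>_ :: 'a. lborel :: real measure" by (rule product_sigma_finite_lborel)
  let ?f = "\<lambda>x. ennreal (\<Prod>i\<in>I. std_normal_density (x i))"
  have f [measurable]: "?f \<in> borel_measurable (PiL I)" by measurable
  show ?thesis unfolding gauss_def
  proof (rule P.PiM_eqI[OF assms, symmetric])
    show "sets (density (PiL I) ?f) = sets (Pi\<^sub>M I (\<lambda>_. std_normal))"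
      by (simp cong: sets_PiM_cong)
    fix A assume A: "\<And>i. i \<in> I \<Longrightarrow> A i \<in> sets std_normal"
    then have A': "\<And>i. i \<in> I \<Longrightarrow> A i \<in> sets lborel" by simp
    then have "emeasure (density (PiL I) ?f) (Pi\<^sub>E I A)
      = (\<integral>\<^sup>+x. ?f x * indicator (Pi\<^sub>E I A) x \<partial>PiL I)"
      by (intro emeasure_density f sets_PiM_I_finite assms) auto
    also have "... = (\<integral>\<^sup>+x. (\<Prod>i\<in>I. ennreal (std_normal_density (x i)) * indicator (A i) (x i)) \<partial>PiL I)"
    proof (rule nn_integral_cong)
      fix x :: "'a \<Rightarrow> real" assume x: "x \<in> space (PiL I)"
      have "(indicator (Pi\<^sub>E I A) x :: ennreal) = (\<Prod>i\<in>I. indicator (A i) (x i))"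
        using x assms by (auto simp: indicator_def space_PiM PiE_iff prod_zero_iff)
      then show "?f x * indicator (Pi\<^sub>E I A) x = (\<Prod>i\<in>I. ennreal (std_normal_density (x i)) * indicator (A i) (x i))"
        by (simp add: prod.distrib prod_ennreal)
    qed
    also have "... = (\<Prod>i\<in>I. \<integral>\<^sup>+x. ennreal (std_normal_density x) * indicator (A i) x \<partial>lborel)"
      using A' by (intro L.product_nn_integral_prod assms) auto
    also have "... = (\<Prod>i\<in>I. emeasure std_normal (A i))"
      using A' by (intro prod.cong refl) (simp add: emeasure_density)
    finally show "emeasure (density (PiL I) ?f) (Pi\<^sub>E I A)
      = (\<Prod>i\<in>I. emeasure std_normal (A i))" .
  qed
qed

lemma std_normal_density_prod:
  "finite I \<Longrightarrow> (\<Prod>i\<in>I. std_normal_density (x i)) = (1 / sqrt (2 * pi)) ^ card I * exp (- (\<Sum>i\<in>I. (x i)\<^sup>2) / 2)"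
proof -
  assume I: "finite I"
  have "(\<Prod>i\<in>I. std_normal_density (x i)) = (\<Prod>i\<in>I. 1 / sqrt (2 * pi) * exp (- (x i)\<^sup>2 / 2))"
    by (simp add: std_normal_density_def)
  also have "... = (1 / sqrt (2 * pi)) ^ card I * exp (\<Sum>i\<in>I. - (x i)\<^sup>2 / 2)"
    using I by (simp only: prod.distrib prod_constant exp_sum)
  also have "(\<Sum>i\<in>I. - (x i)\<^sup>2 / 2) = - (\<Sum>i\<in>I. (x i)\<^sup>2) / 2"
    by (simp only: sum_divide_distrib[symmetric] sum_negf)
  finally show ?thesis .
qed

section \<open>Integration against the Gaussian product measure\<close>

lemma nn_integral_gauss:
  assumes "finite I" "f \<in> borel_measurable (PiB I)"
  shows "(\<integral>\<^sup>+x. f x \<partial>gauss I) = (\<integral>\<^sup>+x. ennreal (\<Prod>i\<in>I. std_normal_density (x i)) * f x \<partial>PiL I)"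
proof -
  have [measurable]: "f \<in> borel_measurable (PiL I)"
    using assms(2) by (simp cong: measurable_cong_sets add: sets_PiM_lborel)
  show ?thesis unfolding gauss_eq_density[OF assms(1)] by (subst nn_integral_density) auto
qed

lemma nn_integral_gauss_prod:
  assumes "finite I" "\<And>i. i \<in> I \<Longrightarrow> f i \<in> borel_measurable borel"
  shows "(\<integral>\<^sup>+x. (\<Prod>i\<in>I. f i (x i)) \<partial>gauss I)
    = (\<Prod>i\<in>I. \<integral>\<^sup>+x. ennreal (std_normal_density x) * f i x \<partial>lborel)"
proof -
  interpret P: product_sigma_finite "\<lambda>_ :: 'a. std_normal"
    using prob_space_std_normal
    by (simp add: product_sigma_finite_def prob_space_imp_sigma_finite)
  have "(\<integral>\<^sup>+x. (\<Prod>i\<in>I. f i (x i)) \<partial>gauss I)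
      = (\<Prod>i\<in>I. \<integral>\<^sup>+x. f i x \<partial>std_normal)"
    unfolding gauss_def using assms by (intro P.product_nn_integral_prod) auto
  also have "... = (\<Prod>i\<in>I. \<integral>\<^sup>+x. ennreal (std_normal_density x) * f i x \<partial>lborel)"
    using assms by (intro prod.cong refl) (subst nn_integral_density, auto)
  finally show ?thesis .
qed

text \<open>By Fubini, a shear reduces to a translation whose offset depends on variables held
  fixed. On rectangles the claim is the translation invariance of each factor.\<close>

lemma nn_integral_PiM_lborel_translate:
  assumes "finite I" and f: "f \<in> borel_measurable (PiB I)"
  shows "(\<integral>\<^sup>+x. f (\<lambda>i\<in>I. x i + c i) \<partial>PiL I) = (\<integral>\<^sup>+x. f x \<partial>PiL I)"
proof -
  interpret L: product_sigma_finite "\<lambda>_ :: 'a. lborel :: real measure" by (rule product_sigma_finite_lborel)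
  let ?T = "\<lambda>x. \<lambda>i\<in>I. x i + c i"
  have T: "?T \<in> measurable (PiL I) (PiL I)"
    by (rule measurable_restrict) (simp add: borel_measurable_add)
  have "distr (PiL I) (PiL I) ?T = PiL I"
  proof (rule L.PiM_eqI[OF assms(1)])
    fix A :: "'a \<Rightarrow> real set" assume A: "\<And>i. i \<in> I \<Longrightarrow> A i \<in> sets lborel"
    have vim: "(\<lambda>x. x + c i) -` A i \<in> sets lborel" if "i \<in> I" for i
    proof -
      have "(\<lambda>x. x + c i) \<in> measurable borel borel" by simp
      from measurable_sets[OF this, of "A i"] show ?thesis using A[OF that] by simp
    qed
    have "emeasure (distr (PiL I) (PiL I) ?T) (Pi\<^sub>E I A)
      = emeasure (PiL I) (?T -` Pi\<^sub>E I A \<inter> space (PiL I))"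
      using A by (intro emeasure_distr T sets_PiM_I_finite assms(1)) auto
    also have "?T -` Pi\<^sub>E I A \<inter> space (PiL I) = Pi\<^sub>E I (\<lambda>i. (\<lambda>x. x + c i) -` A i)"
      by (auto simp: space_PiM PiE_iff extensional_def)
    also have "emeasure (PiL I) ... = (\<Prod>i\<in>I. emeasure lborel ((\<lambda>x. x + c i) -` A i))"
      using vim by (intro L.emeasure_PiM assms(1)) auto
    also have "... = (\<Prod>i\<in>I. emeasure lborel (A i))"
    proof (intro prod.cong refl)
      fix i assume i: "i \<in> I"
      have "emeasure lborel (A i) = emeasure (distr lborel borel ((+) (c i))) (A i)"
        by (simp add: lborel_distr_plus)
      also have "... = emeasure lborel ((\<lambda>x. x + c i) -` A i)"
      proof -
        have "(\<lambda>x. x + c i) = (+) (c i)" by (auto simp: fun_eq_iff)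
        then show ?thesis using A[OF i] by (subst emeasure_distr) auto
      qed
      finally show "emeasure lborel ((\<lambda>x. x + c i) -` A i) = emeasure lborel (A i)" by simp
    qed
    finally show "emeasure (distr (PiL I) (PiL I) ?T) (Pi\<^sub>E I A)
      = (\<Prod>i\<in>I. emeasure lborel (A i))" .
  qed simp
  then have "(\<integral>\<^sup>+x. f x \<partial>PiL I) = (\<integral>\<^sup>+x. f x \<partial>distr (PiL I) (PiL I) ?T)"
    by simp
  also have "... = (\<integral>\<^sup>+x. f (?T x) \<partial>PiL I)"
    by (rule nn_integral_distr[OF T]) (use f in \<open>simp cong: measurable_cong_sets add: sets_PiM_lborel\<close>)
  finally show ?thesis by simp
qed

text \<open>This expansion makes the exchange in \<open>gauss_swap\<close> preserve the Gaussian
  exponent.\<close>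

lemma sum_power2_diff_orthonormal:
  fixes c :: "'j \<Rightarrow> 'i \<Rightarrow> real"
  assumes "finite J" and c: "\<And>j j'. j \<in> J \<Longrightarrow> j' \<in> J \<Longrightarrow> (\<Sum>i\<in>I. c j i * c j' i) = of_bool (j = j')"
  shows "(\<Sum>i\<in>I. (g i - (\<Sum>j\<in>J. c j i * z j))\<^sup>2)
    = (\<Sum>i\<in>I. (g i)\<^sup>2) - 2 * (\<Sum>j\<in>J. z j * (\<Sum>i\<in>I. c j i * g i)) + (\<Sum>j\<in>J. (z j)\<^sup>2)"
proof -
  have 1: "(\<Sum>i\<in>I. g i * (\<Sum>j\<in>J. c j i * z j)) = (\<Sum>j\<in>J. z j * (\<Sum>i\<in>I. c j i * g i))"
    by (simp add: sum_distrib_left, subst sum.swap) (simp add: algebra_simps)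
  have "(\<Sum>i\<in>I. (\<Sum>j\<in>J. c j i * z j)\<^sup>2) = (\<Sum>i\<in>I. \<Sum>j\<in>J. \<Sum>j'\<in>J. z j * z j' * (c j i * c j' i))"
    by (simp add: power2_eq_square sum_product algebra_simps)
  also have "... = (\<Sum>j\<in>J. \<Sum>i\<in>I. \<Sum>j'\<in>J. z j * z j' * (c j i * c j' i))" by (rule sum.swap)
  also have "... = (\<Sum>j\<in>J. \<Sum>j'\<in>J. \<Sum>i\<in>I. z j * z j' * (c j i * c j' i))"
    by (intro sum.cong refl) (rule sum.swap)
  also have "... = (\<Sum>j\<in>J. \<Sum>j'\<in>J. z j * z j' * of_bool (j = j'))"
    by (simp add: sum_distrib_left[symmetric] c)
  also have "... = (\<Sum>j\<in>J. \<Sum>j'\<in>J. if j = j' then z j * z j' else 0)"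
    by (intro sum.cong) auto
  also have "... = (\<Sum>j\<in>J. (z j)\<^sup>2)" using \<open>finite J\<close> by (simp add: power2_eq_square)
  finally have 2: "(\<Sum>i\<in>I. (\<Sum>j\<in>J. c j i * z j)\<^sup>2) = (\<Sum>j\<in>J. (z j)\<^sup>2)" .
  have "(\<Sum>i\<in>I. (g i - (\<Sum>j\<in>J. c j i * z j))\<^sup>2)
      = (\<Sum>i\<in>I. (g i)\<^sup>2) - 2 * (\<Sum>i\<in>I. g i * (\<Sum>j\<in>J. c j i * z j)) + (\<Sum>i\<in>I. (\<Sum>j\<in>J. c j i * z j)\<^sup>2)"
    by (simp add: power2_diff sum.distrib sum_subtractf sum_distrib_left algebra_simps)
  then show ?thesis by (simp only: 1 2)
qed


text \<open>Rotation invariance of the Gaussian law in the form needed here: the coordinates of \<open>g\<close>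
  along an orthonormal family \<open>c\<close> can be replaced by fresh independent coordinates, as long as
  the rest of the integrand ignores the span of \<open>c\<close>. The map
  \<open>(y, g) \<mapsto> (- L g, g + L\<^sup>T (y - L g))\<close> exchanging them preserves the joint density, and it is a
  composition of three shears, each of which preserves Lebesgue measure by translation invariance.\<close>

lemma gauss_swap:
  fixes c :: "'j \<Rightarrow> 'i \<Rightarrow> real"
  defines "L \<equiv> \<lambda>I J (g :: 'i \<Rightarrow> real). \<lambda>j\<in>J. \<Sum>i\<in>I. c j i * g i"
  assumes I: "finite I" and J: "finite J"
    and c: "\<And>j j'. j \<in> J \<Longrightarrow> j' \<in> J \<Longrightarrow> (\<Sum>i\<in>I. c j i * c j' i) = of_bool (j = j')"
    and h: "(\<lambda>(y, g). h y g) \<in> borel_measurable (PiB J \<Otimes>\<^sub>M PiB I)"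
    and inv: "\<And>y g a. h y (\<lambda>i\<in>I. g i + (\<Sum>j\<in>J. c j i * a j)) = h y g"
  shows "(\<integral>\<^sup>+g. h (L I J g) g \<partial>gauss I) = (\<integral>\<^sup>+g. \<integral>\<^sup>+y. h (\<lambda>j\<in>J. - y j) g \<partial>gauss J \<partial>gauss I)"
proof -
  let ?LI = "PiL I" and ?LJ = "PiL J"
  let ?BI = "PiB I" and ?BJ = "PiB J"
  interpret LI: product_sigma_finite "\<lambda>_ :: 'i. lborel :: real measure" by (rule product_sigma_finite_lborel)
  interpret LJ: product_sigma_finite "\<lambda>_ :: 'j. lborel :: real measure" by (rule product_sigma_finite_lborel)
  interpret SI: sigma_finite_measure ?LI by (rule LI.sigma_finite[OF I])
  interpret SJ: sigma_finite_measure ?LJ by (rule LJ.sigma_finite[OF J])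
  interpret P: pair_sigma_finite ?LI ?LJ by standard
  interpret GJ: prob_space "gauss J" by (rule prob_space_gauss)
  note [measurable_cong] = sets_PiM_lborel
  have h_comp: "(\<lambda>x. h (f x) (g x)) \<in> borel_measurable M"
    if "f \<in> measurable M ?BJ" "g \<in> measurable M ?BI" for f g M
    using measurable_compose[OF measurable_Pair[OF that] h] by simp
  define l where "l = (\<lambda>g j. \<Sum>i\<in>I. c j i * g i)"
  define lt where "lt = (\<lambda>y i. \<Sum>j\<in>J. c j i * y j)"
  \<comment> \<open>Joint density of \<open>(y, g)\<close>, kept as one exponential so that only the
    total squared norm matters.\<close>
  define Phi :: "('j \<Rightarrow> real) \<Rightarrow> ('i \<Rightarrow> real) \<Rightarrow> ennreal" where
    "Phi = (\<lambda>y g. ennreal ((1 / sqrt (2 * pi)) ^ card J * (1 / sqrt (2 * pi)) ^ card I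
        * exp (- ((\<Sum>j\<in>J. (y j)\<^sup>2) + (\<Sum>i\<in>I. (g i)\<^sup>2)) / 2)))"
  have Phi: "Phi y g = ennreal (\<Prod>j\<in>J. std_normal_density (y j)) * ennreal (\<Prod>i\<in>I. std_normal_density (g i))" for y g
  proof -
    have exp_split: "exp (- (a + b) / 2) = exp (- a / 2) * exp (- b / 2)" for a b :: real
      by (simp add: exp_add[symmetric] add_divide_distrib)
    show ?thesis
      unfolding Phi_def std_normal_density_prod[OF I] std_normal_density_prod[OF J] exp_split
      by (simp add: ennreal_mult'[symmetric] mult_ac)
  qed
  have l_shift: "l (\<lambda>i\<in>I. g i + - lt y i) j = l g j - y j" if "j \<in> J" for g y j
  proof -
    have "(\<Sum>i\<in>I. c j i * lt y i) = (\<Sum>j'\<in>J. \<Sum>i\<in>I. y j' * (c j i * c j' i))"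
      unfolding lt_def by (simp add: sum_distrib_left, subst sum.swap) (simp add: algebra_simps)
    also have "... = (\<Sum>j'\<in>J. if j = j' then y j' else 0)"
      using that by (simp add: sum_distrib_left[symmetric] c) (intro sum.cong, auto)
    also have "... = y j" using that J by simp
    finally show ?thesis by (simp add: l_def algebra_simps sum_subtractf)
  qed
  have meas_l: "(\<lambda>g. l g j) \<in> borel_measurable ?BI" for j
    unfolding l_def by measurable
  have meas_lt: "(\<lambda>y. lt y i) \<in> borel_measurable ?BJ" for i
    unfolding lt_def by measurable
  \<comment> \<open>The exchange map is an isometry: the squared norms of \<open>L g\<close> and
    \<open>g - L^T (y + L g)\<close> add up to those of \<open>y\<close> and
    \<open>g\<close>.\<close>
  have Phi_shear: "Phi (\<lambda>j. l g j) (\<lambda>i. g i - lt (\<lambda>j. y j + l g j) i) = Phi y g" for y g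
  proof -
    have "(\<Sum>i\<in>I. (g i - lt (\<lambda>j. y j + l g j) i)\<^sup>2)
      = (\<Sum>i\<in>I. (g i)\<^sup>2) - 2 * (\<Sum>j\<in>J. (y j + l g j) * l g j) + (\<Sum>j\<in>J. (y j + l g j)\<^sup>2)"
      unfolding lt_def l_def by (rule sum_power2_diff_orthonormal[OF J c])
    moreover have "(\<Sum>j\<in>J. (l g j)\<^sup>2 - 2 * ((y j + l g j) * l g j) + (y j + l g j)\<^sup>2 - (y j)\<^sup>2) = 0"
      by (intro sum.neutral) (auto simp: power2_eq_square algebra_simps)
    then have "(\<Sum>j\<in>J. (l g j)\<^sup>2) - 2 * (\<Sum>j\<in>J. (y j + l g j) * l g j) + (\<Sum>j\<in>J. (y j + l g j)\<^sup>2) - (\<Sum>j\<in>J. (y j)\<^sup>2) = 0"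
      by (simp only: sum.distrib sum_subtractf sum_distrib_left)
    ultimately have "(\<Sum>j\<in>J. (l g j)\<^sup>2) + (\<Sum>i\<in>I. (g i - lt (\<lambda>j. y j + l g j) i)\<^sup>2)
        = (\<Sum>j\<in>J. (y j)\<^sup>2) + (\<Sum>i\<in>I. (g i)\<^sup>2)"
      by linarith
    then show ?thesis unfolding Phi_def by simp
  qed
  have Phi_cong: "Phi y g = Phi y' g'" if "\<And>j. j \<in> J \<Longrightarrow> y j = y' j" "\<And>i. i \<in> I \<Longrightarrow> g i = g' i" for y y' g g'
    unfolding Phi_def using that by (simp cong: sum.cong)
  have Phi_meas: "(\<lambda>x. Phi (f x) (g x)) \<in> borel_measurable M"
    if "\<And>j. j \<in> J \<Longrightarrow> (\<lambda>x. f x j) \<in> borel_measurable M" "\<And>i. i \<in> I \<Longrightarrow> (\<lambda>x. g x i) \<in> borel_measurable M" for f g M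
    unfolding Phi_def using that by (intro measurable_compose[OF _ measurable_ennreal] borel_measurable_times
      borel_measurable_const borel_measurable_exp[THEN measurable_compose_rev] borel_measurable_divide
      borel_measurable_uminus borel_measurable_add borel_measurable_sum borel_measurable_power) auto
  have L_meas: "(\<lambda>p. \<lambda>j\<in>J. l (f p) j) \<in> measurable M ?BJ" if "f \<in> measurable M ?BI" for f and M :: "'z measure"
    using that meas_l by (intro measurable_restrict measurable_compose[OF that])
  have y_meas: "(\<lambda>p. f p j) \<in> borel_measurable M" if "f \<in> measurable M ?BJ" "j \<in> J" for f j and M :: "'z measure"
    by (rule measurable_compose[OF that(1)]) (use that(2) in measurable)
  have g_meas: "(\<lambda>p. f p i) \<in> borel_measurable M" if "f \<in> measurable M ?BI" "i \<in> I" for f i and M :: "'z measure"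
    by (rule measurable_compose[OF that(1)]) (use that(2) in measurable)
  have l_meas: "(\<lambda>p. l (f p) j) \<in> borel_measurable M" if "f \<in> measurable M ?BI" for f j and M :: "'z measure"
    by (rule measurable_compose[OF that meas_l])
  have lt_meas: "(\<lambda>p. lt (f p) i) \<in> borel_measurable M" if "f \<in> measurable M ?BJ" for f i and M :: "'z measure"
    by (rule measurable_compose[OF that meas_lt])

  \<comment> \<open>Integrands between the shears, starting from a dummy variable \<open>y\<close>
    that \<open>h\<close> does not see: first \<open>y\<close> is shifted by \<open>L g\<close>,
    then \<open>g\<close> by \<open>- L^T y\<close>, where \<open>inv\<close> removes the shift from
    \<open>h\<close>, then \<open>y\<close> by \<open>L g\<close> again. The sign in
    \<open>F4\<close> comes from \<open>L g - (y + L g)\<close>.\<close>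
  define F1 where "F1 = (\<lambda>y g. Phi y g * h (\<lambda>j\<in>J. l g j) g)"
  define F2 where "F2 = (\<lambda>y g. Phi (\<lambda>j\<in>J. y j + l g j) g * h (\<lambda>j\<in>J. l g j) g)"
  define F3 where "F3 = (\<lambda>y g. Phi (\<lambda>j\<in>J. l g j) (\<lambda>i\<in>I. g i - lt y i) * h (\<lambda>j\<in>J. l g j - y j) g)"
  define F4 where "F4 = (\<lambda>y g. Phi y g * h (\<lambda>j\<in>J. - y j) g)"
  have F1_meas: "(\<lambda>p. F1 (f p) (k p)) \<in> borel_measurable M"
    and F2_meas: "(\<lambda>p. F2 (f p) (k p)) \<in> borel_measurable M"
    and F3_meas: "(\<lambda>p. F3 (f p) (k p)) \<in> borel_measurable M"
    and F4_meas: "(\<lambda>p. F4 (f p) (k p)) \<in> borel_measurable M"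
    if "f \<in> measurable M ?BJ" "k \<in> measurable M ?BI" for f k and M :: "'z measure"
    unfolding F1_def F2_def F3_def F4_def
    by (auto intro!: borel_measurable_times_ennreal Phi_meas h_comp measurable_restrict y_meas[OF that(1)] g_meas[OF that(2)]
        l_meas[OF that(2)] lt_meas[OF that(1)] that borel_measurable_add borel_measurable_diff borel_measurable_uminus)
  have constm: "(\<lambda>_. u) \<in> measurable M N" if "u \<in> space N" for u M N
    using that by simp
  have split: "(\<integral>\<^sup>+g. \<integral>\<^sup>+y. k y g \<partial>gauss J \<partial>gauss I) = (\<integral>\<^sup>+g. \<integral>\<^sup>+y. Phi y g * k y g \<partial>?LJ \<partial>?LI)"
    if k: "(\<lambda>(y, g). k y g) \<in> borel_measurable (?BJ \<Otimes>\<^sub>M ?BI)" for k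
  proof -
    have k_comp: "(\<lambda>x. k (f x) (g x)) \<in> borel_measurable M"
      if "f \<in> measurable M ?BJ" "g \<in> measurable M ?BI" for f g M
      using measurable_compose[OF measurable_Pair[OF that] k] by simp
    have "(\<integral>\<^sup>+g. \<integral>\<^sup>+y. k y g \<partial>gauss J \<partial>gauss I)
       = (\<integral>\<^sup>+g. ennreal (\<Prod>i\<in>I. std_normal_density (g i)) * (\<integral>\<^sup>+y. k y g \<partial>gauss J) \<partial>?LI)"
    proof (rule nn_integral_gauss[OF I])
      have "(\<lambda>(g, y). k y g) \<in> borel_measurable (?BI \<Otimes>\<^sub>M gauss J)"
        unfolding case_prod_beta by (rule k_comp) measurable
      then show "(\<lambda>g. \<integral>\<^sup>+y. k y g \<partial>gauss J) \<in> borel_measurable ?BI"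
        by (rule GJ.borel_measurable_nn_integral)
    qed
    also have "... = (\<integral>\<^sup>+g. \<integral>\<^sup>+y. Phi y g * k y g \<partial>?LJ \<partial>?LI)"
    proof (rule nn_integral_cong)
      fix g assume g: "g \<in> space ?LI"
      have m: "(\<lambda>y. k y g) \<in> borel_measurable ?BJ"
        using g by (intro k_comp constm) (auto simp: space_PiM)
      then have m': "(\<lambda>y. ennreal (\<Prod>j\<in>J. std_normal_density (y j)) * k y g) \<in> borel_measurable ?LJ"
        by measurable
      show "ennreal (\<Prod>i\<in>I. std_normal_density (g i)) * (\<integral>\<^sup>+y. k y g \<partial>gauss J) = (\<integral>\<^sup>+y. Phi y g * k y g \<partial>?LJ)"
        unfolding nn_integral_gauss[OF J m] nn_integral_cmult[OF m', symmetric]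
        by (simp add: Phi mult_ac)
    qed
    finally show ?thesis .
  qed
  have swap: "(\<integral>\<^sup>+g. \<integral>\<^sup>+y. F y g \<partial>?LJ \<partial>?LI) = (\<integral>\<^sup>+y. \<integral>\<^sup>+g. F y g \<partial>?LI \<partial>?LJ)"
    if "(\<lambda>p. F (snd p) (fst p)) \<in> borel_measurable (?LI \<Otimes>\<^sub>M ?LJ)" for F
    using P.Fubini'[of "\<lambda>g y. F y g"] that by (simp add: case_prod_beta')
  have "(\<integral>\<^sup>+g. h (L I J g) g \<partial>gauss I) = (\<integral>\<^sup>+g. \<integral>\<^sup>+y. h (\<lambda>j\<in>J. l g j) g \<partial>gauss J \<partial>gauss I)"
    using GJ.emeasure_space_1 by (simp add: L_def l_def)
  also have "... = (\<integral>\<^sup>+g. \<integral>\<^sup>+y. F1 y g \<partial>?LJ \<partial>?LI)"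
    unfolding F1_def by (rule split, unfold case_prod_beta, intro h_comp L_meas measurable_snd)
  also have "... = (\<integral>\<^sup>+g. \<integral>\<^sup>+y. F2 y g \<partial>?LJ \<partial>?LI)"
  proof (rule nn_integral_cong)
    fix g assume g: "g \<in> space ?LI"
    have "(\<integral>\<^sup>+y. F1 (\<lambda>j\<in>J. y j + l g j) g \<partial>?LJ) = (\<integral>\<^sup>+y. F1 y g \<partial>?LJ)"
      by (intro nn_integral_PiM_lborel_translate J F1_meas constm) (use g in \<open>auto simp: space_PiM\<close>)
    then show "(\<integral>\<^sup>+y. F1 y g \<partial>?LJ) = (\<integral>\<^sup>+y. F2 y g \<partial>?LJ)" by (simp add: F1_def F2_def)
  qed
  also have "... = (\<integral>\<^sup>+y. \<integral>\<^sup>+g. F2 y g \<partial>?LI \<partial>?LJ)"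
    by (rule swap) (auto intro!: F2_meas)
  also have "... = (\<integral>\<^sup>+y. \<integral>\<^sup>+g. F3 y g \<partial>?LI \<partial>?LJ)"
  proof (rule nn_integral_cong)
    fix y assume y: "y \<in> space ?LJ"
    have "(\<integral>\<^sup>+g. F2 y (\<lambda>i\<in>I. g i + - lt y i) \<partial>?LI) = (\<integral>\<^sup>+g. F2 y g \<partial>?LI)"
      by (intro nn_integral_PiM_lborel_translate I F2_meas constm) (use y in \<open>auto simp: space_PiM\<close>)
    moreover have "F2 y (\<lambda>i\<in>I. g i + - lt y i) = F3 y g" for g
    proof -
      have "(\<lambda>i\<in>I. g i + - lt y i) = (\<lambda>i\<in>I. g i + (\<Sum>j\<in>J. c j i * - y j))"
        by (simp add: lt_def sum_negf)
      then have "h (\<lambda>j\<in>J. l g j - y j) (\<lambda>i\<in>I. g i + - lt y i) = h (\<lambda>j\<in>J. l g j - y j) g"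
        by (simp only: inv)
      moreover have "(\<lambda>j\<in>J. l (\<lambda>i\<in>I. g i + - lt y i) j) = (\<lambda>j\<in>J. l g j - y j)"
        using l_shift by (intro restrict_ext) auto
      moreover have "Phi (\<lambda>j\<in>J. y j + l (\<lambda>i\<in>I. g i + - lt y i) j) (\<lambda>i\<in>I. g i + - lt y i) = Phi (\<lambda>j\<in>J. l g j) (\<lambda>i\<in>I. g i - lt y i)"
        using l_shift by (intro Phi_cong) auto
      ultimately show ?thesis unfolding F2_def F3_def by (simp only:)
    qed
    ultimately show "(\<integral>\<^sup>+g. F2 y g \<partial>?LI) = (\<integral>\<^sup>+g. F3 y g \<partial>?LI)" by simp
  qed
  also have "... = (\<integral>\<^sup>+g. \<integral>\<^sup>+y. F3 y g \<partial>?LJ \<partial>?LI)"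
    by (rule swap[symmetric]) (auto intro!: F3_meas)
  also have "... = (\<integral>\<^sup>+g. \<integral>\<^sup>+y. F4 y g \<partial>?LJ \<partial>?LI)"
  proof (rule nn_integral_cong)
    fix g assume g: "g \<in> space ?LI"
    have "(\<integral>\<^sup>+y. F3 (\<lambda>j\<in>J. y j + l g j) g \<partial>?LJ) = (\<integral>\<^sup>+y. F3 y g \<partial>?LJ)"
      by (intro nn_integral_PiM_lborel_translate J F3_meas constm) (use g in \<open>auto simp: space_PiM\<close>)
    moreover have "F3 (\<lambda>j\<in>J. y j + l g j) g = F4 y g" for y
    proof -
      have "Phi (\<lambda>j\<in>J. l g j) (\<lambda>i\<in>I. g i - lt (\<lambda>j\<in>J. y j + l g j) i) = Phi (l g) (\<lambda>i. g i - lt (\<lambda>j. y j + l g j) i)"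
        by (intro Phi_cong) (auto simp: lt_def)
      also have "... = Phi y g" using Phi_shear[of g y] by simp
      finally have "Phi (\<lambda>j\<in>J. l g j) (\<lambda>i\<in>I. g i - lt (\<lambda>j\<in>J. y j + l g j) i) = Phi y g" .
      moreover have "(\<lambda>j\<in>J. l g j - (\<lambda>j\<in>J. y j + l g j) j) = (\<lambda>j\<in>J. - y j)"
        by (intro restrict_ext) auto
      ultimately show ?thesis unfolding F3_def F4_def by (simp only:)
    qed
    ultimately show "(\<integral>\<^sup>+y. F3 y g \<partial>?LJ) = (\<integral>\<^sup>+y. F4 y g \<partial>?LJ)" by simp
  qed
  also have "... = (\<integral>\<^sup>+g. \<integral>\<^sup>+y. h (\<lambda>j\<in>J. - y j) g \<partial>gauss J \<partial>gauss I)"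
    unfolding F4_def
    by (rule split[symmetric], unfold case_prod_beta,
        intro h_comp measurable_restrict borel_measurable_uminus y_meas measurable_fst measurable_snd)
  finally show ?thesis .
qed

section \<open>Tail bounds\<close>

text \<open>The integrand is a multiple of a centred normal density of variance
  \<open>1 / (1 + 2 \<theta>)\<close>. A negative \<open>\<theta>\<close> serves the upper tail, a
  positive one the small ball.\<close>

lemma nn_integral_std_normal_exp:
  assumes "\<theta> > - 1 / 2"
  shows "(\<integral>\<^sup>+x. ennreal (std_normal_density x) * ennreal (exp (- \<theta> * x\<^sup>2)) \<partial>lborel) = ennreal (1 / sqrt (1 + 2 * \<theta>))"
proof -
  define \<sigma> where "\<sigma> = 1 / sqrt (1 + 2 * \<theta>)"
  have \<sigma>: "\<sigma> > 0" and \<sigma>2: "\<sigma>\<^sup>2 = 1 / (1 + 2 * \<theta>)" using assms by (auto simp: \<sigma>_def power_divide)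
  have "std_normal_density x * exp (- \<theta> * x\<^sup>2) = \<sigma> * normal_density 0 \<sigma> x" for x
  proof -
    have "exp (- x\<^sup>2 / 2) * exp (- \<theta> * x\<^sup>2) = exp (- (x - 0)\<^sup>2 / (2 * \<sigma>\<^sup>2))"
      using assms by (simp add: exp_add[symmetric] \<sigma>2 field_simps)
    moreover have "1 / sqrt (2 * pi) = \<sigma> * (1 / sqrt (2 * pi * \<sigma>\<^sup>2))"
      using \<sigma> by (simp add: real_sqrt_mult)
    ultimately show ?thesis by (simp add: std_normal_density_def normal_density_def)
  qed
  then have "(\<integral>\<^sup>+x. ennreal (std_normal_density x) * ennreal (exp (- \<theta> * x\<^sup>2)) \<partial>lborel)
      = (\<integral>\<^sup>+x. ennreal \<sigma> * ennreal (normal_density 0 \<sigma> x) \<partial>lborel)"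
    using \<sigma> by (simp add: ennreal_mult'[symmetric])
  also have "... = ennreal \<sigma> * (\<integral>\<^sup>+x. ennreal (normal_density 0 \<sigma> x) \<partial>lborel)"
    by (rule nn_integral_cmult) simp
  also have "(\<integral>\<^sup>+x. ennreal (normal_density 0 \<sigma> x) \<partial>lborel) = 1"
  proof -
    interpret prob_space "density lborel (\<lambda>x. ennreal (normal_density 0 \<sigma> x))"
      using \<sigma> by (rule prob_space_normal_density)
    show ?thesis using emeasure_space_1 by (simp add: emeasure_density)
  qed
  finally show ?thesis by (simp add: \<sigma>_def)
qed

text \<open>Chernoff with parameter 1/4, for which one squared coordinate has exponential moment
  \<open>sqrt 2\<close>.\<close>

lemma gauss_sum_squares_upper_tail:
  assumes I: "finite I"
  shows "emeasure (gauss I) {g \<in> space (gauss I). (\<Sum>i\<in>I. (g i)\<^sup>2) > a} \<le> ennreal (exp (- a / 4) * sqrt 2 ^ card I)"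
proof -
  have [measurable]: "(\<lambda>g. \<Sum>i\<in>I. (g i)\<^sup>2) \<in> borel_measurable (gauss I)" by measurable
  have "emeasure (gauss I) {g \<in> space (gauss I). (\<Sum>i\<in>I. (g i)\<^sup>2) > a}
      = (\<integral>\<^sup>+g. indicator {g \<in> space (gauss I). (\<Sum>i\<in>I. (g i)\<^sup>2) > a} g \<partial>gauss I)"
    by (rule nn_integral_indicator[symmetric]) measurable
  also have "... \<le> (\<integral>\<^sup>+g. ennreal (exp (- a / 4)) * (\<Prod>i\<in>I. ennreal (exp ((g i)\<^sup>2 / 4))) \<partial>gauss I)"
  proof (intro nn_integral_mono)
    fix g
    have "ennreal (exp (- a / 4)) * (\<Prod>i\<in>I. ennreal (exp ((g i)\<^sup>2 / 4))) = ennreal (exp (((\<Sum>i\<in>I. (g i)\<^sup>2) - a) / 4))"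
      using I by (simp add: prod_ennreal ennreal_mult'[symmetric] exp_sum[symmetric] exp_add[symmetric]
        sum_divide_distrib[symmetric] diff_divide_distrib)
    then show "indicator {g \<in> space (gauss I). (\<Sum>i\<in>I. (g i)\<^sup>2) > a} g
        \<le> ennreal (exp (- a / 4)) * (\<Prod>i\<in>I. ennreal (exp ((g i)\<^sup>2 / 4)))"
      by (auto simp: indicator_def)
  qed
  also have "... = ennreal (exp (- a / 4)) * (\<integral>\<^sup>+g. (\<Prod>i\<in>I. ennreal (exp ((g i)\<^sup>2 / 4))) \<partial>gauss I)"
    by (rule nn_integral_cmult) measurable
  also have "(\<integral>\<^sup>+g. (\<Prod>i\<in>I. ennreal (exp ((g i)\<^sup>2 / 4))) \<partial>gauss I) = ennreal (sqrt 2) ^ card I"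
    using nn_integral_gauss_prod[OF I, of "\<lambda>_ x. ennreal (exp (x\<^sup>2 / 4))"] nn_integral_std_normal_exp[of "- 1 / 4"]
    by (simp add: real_sqrt_divide)
  finally show ?thesis by (simp add: ennreal_power ennreal_mult'[symmetric])
qed

text \<open>Markov's inequality for \<open>exp (- \<theta> S)\<close>, with \<open>S\<close> the sum
  of squares. \<open>gauss_swap\<close>, for an \<open>h\<close> that ignores its second argument,
  reduces the expectation to independent standard normal coordinates.\<close>

lemma gauss_orthonormal_small_ball:
  fixes c :: "nat \<Rightarrow> 'i \<Rightarrow> real"
  assumes I: "finite I" and k: "k > 0" and x: "x > 0"
    and c: "\<And>j j'. j < k \<Longrightarrow> j' < k \<Longrightarrow> (\<Sum>i\<in>I. c j i * c j' i) = of_bool (j = j')"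
  shows "emeasure (gauss I) {g \<in> space (gauss I). (\<Sum>j<k. (\<Sum>i\<in>I. c j i * g i)\<^sup>2) < x}
    \<le> ennreal (sqrt (exp 1 * x / real k) ^ k)"
proof -
  \<comment> \<open>The minimiser of \<open>exp (\<theta> x) / sqrt (2 \<theta>) ^ k\<close>, the
    bound left after replacing \<open>1 + 2 \<theta>\<close> by \<open>2 \<theta>\<close>.\<close>
  define \<theta> where "\<theta> = real k / (2 * x)"
  have \<theta>: "\<theta> > 0" using k x by (simp add: \<theta>_def)
  define h :: "(nat \<Rightarrow> real) \<Rightarrow> ('i \<Rightarrow> real) \<Rightarrow> ennreal" where
    "h = (\<lambda>y g. \<Prod>j<k. ennreal (exp (- \<theta> * (y j)\<^sup>2)))"
  interpret GI: prob_space "gauss I" by (rule prob_space_gauss)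
  have "emeasure (gauss I) {g \<in> space (gauss I). (\<Sum>j<k. (\<Sum>i\<in>I. c j i * g i)\<^sup>2) < x}
      = (\<integral>\<^sup>+g. indicator {g \<in> space (gauss I). (\<Sum>j<k. (\<Sum>i\<in>I. c j i * g i)\<^sup>2) < x} g \<partial>gauss I)"
    by (rule nn_integral_indicator[symmetric]) measurable
  also have "... \<le> (\<integral>\<^sup>+g. ennreal (exp (\<theta> * x)) * h (\<lambda>j\<in>{..<k}. \<Sum>i\<in>I. c j i * g i) g \<partial>gauss I)"
  proof (intro nn_integral_mono)
    fix g
    have "ennreal (exp (\<theta> * x)) * h (\<lambda>j\<in>{..<k}. \<Sum>i\<in>I. c j i * g i) g
        = ennreal (exp (\<theta> * (x - (\<Sum>j<k. (\<Sum>i\<in>I. c j i * g i)\<^sup>2))))"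
      by (simp add: h_def prod_ennreal ennreal_mult'[symmetric] exp_sum[symmetric] exp_add[symmetric]
        sum_negf sum_distrib_left[symmetric] right_diff_distrib)
    then show "indicator {g \<in> space (gauss I). (\<Sum>j<k. (\<Sum>i\<in>I. c j i * g i)\<^sup>2) < x} g
        \<le> ennreal (exp (\<theta> * x)) * h (\<lambda>j\<in>{..<k}. \<Sum>i\<in>I. c j i * g i) g"
      using \<theta> by (auto simp: indicator_def)
  qed
  also have "... = ennreal (exp (\<theta> * x)) * (\<integral>\<^sup>+g. h (\<lambda>j\<in>{..<k}. \<Sum>i\<in>I. c j i * g i) g \<partial>gauss I)"
  proof (rule nn_integral_cmult)
    have "(\<lambda>g. h (\<lambda>j\<in>{..<k}. \<Sum>i\<in>I. c j i * g i) g) = (\<lambda>g. \<Prod>j<k. ennreal (exp (- \<theta> * (\<Sum>i\<in>I. c j i * g i)\<^sup>2)))"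
      by (simp add: h_def fun_eq_iff)
    also have "... \<in> borel_measurable (gauss I)" by measurable
    finally show "(\<lambda>g. h (\<lambda>j\<in>{..<k}. \<Sum>i\<in>I. c j i * g i) g) \<in> borel_measurable (gauss I)" .
  qed
  also have "(\<integral>\<^sup>+g. h (\<lambda>j\<in>{..<k}. \<Sum>i\<in>I. c j i * g i) g \<partial>gauss I)
      = (\<integral>\<^sup>+g. \<integral>\<^sup>+y. h (\<lambda>j\<in>{..<k}. - y j) g \<partial>gauss {..<k} \<partial>gauss I)"
  proof (rule gauss_swap[OF I])
    show "(\<lambda>(y, g). h y g) \<in> borel_measurable (PiB {..<k} \<Otimes>\<^sub>M PiB I)"
      unfolding h_def by measurable
  qed (use c in \<open>auto simp: h_def\<close>)
  also have "... = (\<integral>\<^sup>+y. (\<Prod>j<k. ennreal (exp (- \<theta> * (y j)\<^sup>2))) \<partial>gauss {..<k})"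
    using GI.emeasure_space_1 by (simp add: h_def)
  also have "... = ennreal (1 / sqrt (1 + 2 * \<theta>)) ^ k"
    using nn_integral_gauss_prod[of "{..<k}" "\<lambda>_ x. ennreal (exp (- \<theta> * x\<^sup>2))"]
      nn_integral_std_normal_exp[of \<theta>] \<theta> by simp
  also have "ennreal (exp (\<theta> * x)) * ennreal (1 / sqrt (1 + 2 * \<theta>)) ^ k = ennreal (exp (\<theta> * x) * (1 / sqrt (1 + 2 * \<theta>)) ^ k)"
    using \<theta> by (simp add: ennreal_power ennreal_mult'[symmetric])
  also have "... \<le> ennreal (sqrt (exp 1 * x / real k) ^ k)"
  proof (rule ennreal_leI)
    have "exp (\<theta> * x) = exp (1 / 2) ^ k"
      using x by (simp add: \<theta>_def exp_of_nat_mult[symmetric])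
    moreover have "exp (1 / 2 :: real) = sqrt (exp 1)"
      by (rule real_sqrt_unique[symmetric]) (simp_all add: power2_eq_square exp_add[symmetric])
    ultimately have "exp (\<theta> * x) * (1 / sqrt (1 + 2 * \<theta>)) ^ k = (sqrt (exp 1) * (1 / sqrt (1 + 2 * \<theta>))) ^ k"
      by (simp only: power_mult_distrib)
    also have "... \<le> (sqrt (exp 1) * (1 / sqrt (2 * \<theta>))) ^ k"
      using \<theta> by (intro power_mono mult_left_mono divide_left_mono) auto
    also have "sqrt (exp 1) * (1 / sqrt (2 * \<theta>)) = sqrt (exp 1 * x / real k)"
      using x k by (simp add: \<theta>_def real_sqrt_mult real_sqrt_divide)
    finally show "exp (\<theta> * x) * (1 / sqrt (1 + 2 * \<theta>)) ^ k \<le> sqrt (exp 1 * x / real k) ^ k" .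
  qed
  finally show ?thesis by (simp add: mult_left_mono)
qed

section \<open>Distance of a sketch row from the span of the others\<close>

abbreviation sketch_row :: "nat \<Rightarrow> (nat \<Rightarrow> nat \<Rightarrow> real) \<Rightarrow> (nat \<times> nat \<Rightarrow> real) \<Rightarrow> nat \<Rightarrow> nat \<Rightarrow> real" where
  "sketch_row m U g i b \<equiv> \<Sum>a<m. U i a * g (a, b)"

text \<open>Rational coefficients, taken as extensional functions, make the existential range over a
  countable set and thus the event measurable.\<close>

definition near_span :: "nat \<Rightarrow> nat \<Rightarrow> nat \<Rightarrow> real \<Rightarrow> (nat \<Rightarrow> nat \<Rightarrow> real) \<Rightarrow> nat \<Rightarrow> (nat \<times> nat \<Rightarrow> real) \<Rightarrow> bool" where
  "near_span m s \<mu> x U i g \<longleftrightarrow> (\<exists>c\<in>({..<\<mu>} - {i}) \<rightarrow>\<^sub>E \<rat>.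
     (\<Sum>b<s. (sketch_row m U g i b - (\<Sum>j\<in>{..<\<mu>} - {i}. c j * sketch_row m U g j b))\<^sup>2) < x)"

lemma near_span_measurable [measurable]:
  "Measurable.pred (PiB ({..<m} \<times> {..<s})) (near_span m s \<mu> x U i)"
proof -
  have "countable (({..<\<mu>} - {i}) \<rightarrow>\<^sub>E (\<rat> :: real set))"
    by (intro countable_PiE countable_rat) auto
  then show ?thesis unfolding near_span_def[abs_def] pred_def
    by (intro sets.sets_Collect_countable_Ex') measurable
qed

text \<open>Rational coefficients approximate real ones, and the reverse inequality is closed under
  limits.\<close>

lemma not_near_span:
  assumes "\<not> near_span m s \<mu> x U i g"
  shows "ip s (\<lambda>b. sketch_row m U g i b - (\<Sum>j\<in>{..<\<mu>} - {i}. c j * sketch_row m U g j b))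
              (\<lambda>b. sketch_row m U g i b - (\<Sum>j\<in>{..<\<mu>} - {i}. c j * sketch_row m U g j b)) \<ge> x"
proof -
  have "\<forall>t :: real. \<exists>q. (\<forall>n. q n \<in> \<rat>) \<and> q \<longlonglongrightarrow> t"
  proof
    fix t :: real
    have "\<exists>r\<in>\<rat>. t < r \<and> r < t + 1 / real (Suc n)" for n
      by (intro Rats_dense_in_real) simp
    then have "\<forall>n. \<exists>r. r \<in> \<rat> \<and> t < r \<and> r < t + 1 / real (Suc n)" by blast
    from choice[OF this] obtain r where r: "\<And>n. r n \<in> \<rat> \<and> t < r n \<and> r n < t + 1 / real (Suc n)" by blast
    have "r \<longlonglongrightarrow> t"
    proof (rule tendsto_sandwich[of "\<lambda>_. t" r _ "\<lambda>n. t + 1 / real (Suc n)"])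
      show "(\<lambda>n. t + 1 / real (Suc n)) \<longlonglongrightarrow> t"
        using tendsto_add[OF tendsto_const[of t] LIMSEQ_inverse_real_of_nat] by (simp add: inverse_eq_divide)
    qed (use r in \<open>auto intro!: always_eventually less_imp_le\<close>)
    then show "\<exists>q. (\<forall>n. q n \<in> \<rat>) \<and> q \<longlonglongrightarrow> t" using r by blast
  qed
  from choice[OF this] obtain q where q: "\<And>t n. q t n \<in> \<rat>" "\<And>t :: real. q t \<longlonglongrightarrow> t" by blast
  define F where "F = (\<lambda>c. \<Sum>b<s. (sketch_row m U g i b - (\<Sum>j\<in>{..<\<mu>} - {i}. c j * sketch_row m U g j b))\<^sup>2)"
  have F_ge: "F (\<lambda>j. q (c j) n) \<ge> x" for n
  proof -
    have "restrict (\<lambda>j. q (c j) n) ({..<\<mu>} - {i}) \<in> ({..<\<mu>} - {i}) \<rightarrow>\<^sub>E \<rat>" using q(1) by auto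
    then have "F (restrict (\<lambda>j. q (c j) n) ({..<\<mu>} - {i})) \<ge> x"
      using assms unfolding near_span_def F_def by (simp only: not_less Bex_def not_ex de_Morgan_conj) blast
    then show ?thesis by (simp add: F_def)
  qed
  have "(\<lambda>n. F (\<lambda>j. q (c j) n)) \<longlonglongrightarrow> F c"
    unfolding F_def by (intro tendsto_intros q)
  then have "x \<le> F c" by (rule LIMSEQ_le_const) (use F_ge in auto)
  then show ?thesis by (simp add: F_def ip_def power2_eq_square)
qed

text \<open>Row \<open>i\<close> of \<open>U^T G\<close> is independent of the others because
  \<open>U i\<close> is orthogonal to the other \<open>U j\<close>; \<open>gauss_swap\<close>
  replaces it by a fresh Gaussian vector \<open>u\<close>. For fixed other rows, the distance of
  \<open>u\<close> from their span is at least the length of its projection onto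
  \<open>K + 1\<close> orthonormal directions orthogonal to them.\<close>

lemma emeasure_near_span:
  assumes U: "orthofam m \<mu> U" and i: "i < \<mu>" and "\<mu> + K = s" and x: "x > 0"
  shows "emeasure (gauss ({..<m} \<times> {..<s})) {g \<in> space (gauss ({..<m} \<times> {..<s})). near_span m s \<mu> x U i g}
    \<le> ennreal (sqrt (exp 1 * x / real (K + 1)) ^ (K + 1))"
proof -
  define I where "I = {..<m} \<times> {..<s}"
  define J where "J = {..<\<mu>} - {i}"
  define y where "y = (\<lambda>(g :: nat \<times> nat \<Rightarrow> real) j b. \<Sum>a<m. U j a * g (a, b))"
  \<comment> \<open>\<open>c b\<close> is the matrix with \<open>U i\<close> in column
    \<open>b\<close> and zeros elsewhere: its inner product with \<open>g\<close> is entry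
    \<open>b\<close> of row \<open>i\<close>.\<close>
  define c where "c = (\<lambda>(b' :: nat) (a, b :: nat). U i a * of_bool (b' = b))"
  define N where "N = (\<lambda>u g. \<exists>q\<in>J \<rightarrow>\<^sub>E \<rat>. (\<Sum>b<s. (u b - (\<Sum>j\<in>J. q j * y g j b))\<^sup>2) < x)"
  define h :: "(nat \<Rightarrow> real) \<Rightarrow> (nat \<times> nat \<Rightarrow> real) \<Rightarrow> ennreal" where "h = (\<lambda>u g. indicator {(u, g). N u g} (u, g))"
  interpret GI: prob_space "gauss I" by (rule prob_space_gauss)
  have J: "finite J" "card J + K + 1 = s" using i assms(3) by (auto simp: J_def)
  have cL: "(\<Sum>p\<in>I. c b p * g p) = y g i b" if "b < s" for b g
  proof -
    have "(\<Sum>p\<in>I. c b p * g p) = (\<Sum>a<m. \<Sum>b'<s. c b (a, b') * g (a, b'))"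
      by (simp add: I_def sum.cartesian_product)
    also have "... = (\<Sum>a<m. \<Sum>b'<s. if b = b' then U i a * g (a, b') else 0)"
      by (intro sum.cong refl) (simp add: c_def)
    finally have "(\<Sum>p\<in>I. c b p * g p) = (\<Sum>a<m. \<Sum>b'<s. if b = b' then U i a * g (a, b') else 0)" .
    then show ?thesis using that by (simp add: y_def)
  qed
  have c_orth: "(\<Sum>p\<in>I. c b p * c b' p) = of_bool (b = b')" if "b < s" "b' < s" for b b'
  proof -
    have "(\<Sum>p\<in>I. c b p * c b' p) = (\<Sum>a<m. U i a * (U i a * of_bool (b' = b)))"
      using cL[OF that(1), of "c b'"] by (simp add: y_def c_def)
    also have "... = ip_sq m (U i) * of_bool (b' = b)"
      by (simp add: ip_def sum_distrib_right mult.assoc)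
    finally show ?thesis using U i by (auto simp: orthofam_def)
  qed
  have y_inv: "y (\<lambda>p\<in>I. g p + (\<Sum>b\<in>{..<s}. c b p * z b)) j b = y g j b" if "j \<in> J" "b < s" for g z j b
  proof -
    have "(\<Sum>b'\<in>{..<s}. c b' (a, b) * z b') = U i a * z b" for a
    proof -
      have "(\<Sum>b'\<in>{..<s}. c b' (a, b) * z b') = (\<Sum>b'\<in>{..<s}. if b' = b then U i a * z b' else 0)"
        by (intro sum.cong) (auto simp: c_def)
      then show ?thesis using that by simp
    qed
    then have "y (\<lambda>p\<in>I. g p + (\<Sum>b\<in>{..<s}. c b p * z b)) j b = (\<Sum>a<m. U j a * (g (a, b) + U i a * z b))"
      using that by (simp add: y_def I_def)
    also have "... = y g j b + ip m (U j) (U i) * z b"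
      by (simp add: y_def ip_def sum.distrib sum_distrib_left algebra_simps)
    finally show ?thesis using U i that by (simp add: J_def orthofam_def)
  qed
  have N_meas: "Measurable.pred (PiB {..<s} \<Otimes>\<^sub>M PiB I) (\<lambda>p. N (fst p) (snd p))"
  proof -
    have "countable (J \<rightarrow>\<^sub>E (\<rat> :: real set))" using J by (intro countable_PiE countable_rat)
    then show ?thesis unfolding N_def y_def I_def pred_def
      by (intro sets.sets_Collect_countable_Ex') measurable
  qed
  have "emeasure (gauss I) {g \<in> space (gauss I). near_span m s \<mu> x U i g}
      = (\<integral>\<^sup>+g. indicator {g \<in> space (gauss I). near_span m s \<mu> x U i g} g \<partial>gauss I)"
    unfolding I_def by (rule nn_integral_indicator[symmetric]) measurable
  also have "... = (\<integral>\<^sup>+g. h (\<lambda>b\<in>{..<s}. \<Sum>p\<in>I. c b p * g p) g \<partial>gauss I)"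
  proof (rule nn_integral_cong)
    fix g assume g: "g \<in> space (gauss I)"
    have "(\<Sum>b<s. ((\<lambda>b\<in>{..<s}. \<Sum>p\<in>I. c b p * g p) b - (\<Sum>j\<in>J. q j * y g j b))\<^sup>2)
        = (\<Sum>b<s. (y g i b - (\<Sum>j\<in>J. q j * y g j b))\<^sup>2)" for q
      by (intro sum.cong refl) (simp add: cL)
    then have "N (\<lambda>b\<in>{..<s}. \<Sum>p\<in>I. c b p * g p) g \<longleftrightarrow> near_span m s \<mu> x U i g"
      unfolding N_def near_span_def y_def J_def by (simp only:)
    then show "indicator {g \<in> space (gauss I). near_span m s \<mu> x U i g} g = h (\<lambda>b\<in>{..<s}. \<Sum>p\<in>I. c b p * g p) g"
      using g by (simp only: h_def indicator_def mem_Collect_eq prod.case simp_thms)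
  qed
  also have "... = (\<integral>\<^sup>+g. \<integral>\<^sup>+u. h (\<lambda>b\<in>{..<s}. - u b) g \<partial>gauss {..<s} \<partial>gauss I)"
  proof (rule gauss_swap)
    have "(\<lambda>(u, g). h u g) = indicator {p. N (fst p) (snd p)}" by (auto simp: h_def fun_eq_iff indicator_def)
    moreover have "(\<lambda>p. indicator {p. N (fst p) (snd p)} p :: ennreal)
        \<in> borel_measurable (PiB {..<s} \<Otimes>\<^sub>M PiB I)"
      using N_meas by (intro borel_measurable_indicator') simp
    ultimately show "(\<lambda>(u, g). h u g) \<in> borel_measurable (PiB {..<s} \<Otimes>\<^sub>M PiB I)"
      by simp
    show "h u (\<lambda>p\<in>I. g p + (\<Sum>b\<in>{..<s}. c b p * z b)) = h u g" for u g z
    proof -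
      have "(\<Sum>b<s. (u b - (\<Sum>j\<in>J. q j * y (\<lambda>p\<in>I. g p + (\<Sum>b\<in>{..<s}. c b p * z b)) j b))\<^sup>2)
          = (\<Sum>b<s. (u b - (\<Sum>j\<in>J. q j * y g j b))\<^sup>2)" for q
        by (intro sum.cong refl arg_cong[of _ _ "\<lambda>t. (u _ - t)\<^sup>2"]) (simp only: y_inv lessThan_iff)
      then have "N u (\<lambda>p\<in>I. g p + (\<Sum>b\<in>{..<s}. c b p * z b)) = N u g"
        unfolding N_def by (simp only:)
      then show ?thesis by (simp only: h_def indicator_def mem_Collect_eq prod.case)
    qed
  qed (use c_orth in \<open>auto simp: I_def\<close>)
  also have "... \<le> (\<integral>\<^sup>+g. ennreal (sqrt (exp 1 * x / real (K + 1)) ^ (K + 1)) \<partial>gauss I)"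
  proof (intro nn_integral_mono)
    fix g
    obtain f where f: "bij_betw f {..<card J} J"
      using ex_bij_betw_nat_finite[OF J(1)] by (auto simp: atLeast0LessThan)
    \<comment> \<open>The \<open>\<mu> - 1\<close> other rows leave room for \<open>K + 1\<close>
      orthogonal directions in dimension \<open>s = \<mu> + K\<close>.\<close>
    obtain v where v: "orthofam s (K + 1) v"
      and vy: "\<And>l j. l < K + 1 \<Longrightarrow> j < card J \<Longrightarrow> ip s (y g (f j)) (v l) = 0"
      using ex_orthofam_orthogonal[of "K + 1" "card J" s "\<lambda>j. y g (f j)"] J by auto
    have vy': "ip s (v l) (y g j) = 0" if "l < K + 1" "j \<in> J" for l j
    proof -
      from f that(2) have "j \<in> f ` {..<card J}" by (simp add: bij_betw_def)
      then obtain j' where "j' < card J" "j = f j'" by auto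
      then show ?thesis using vy[OF that(1), of j'] by (simp add: ip_commute)
    qed
    have "(\<integral>\<^sup>+u. h (\<lambda>b\<in>{..<s}. - u b) g \<partial>gauss {..<s})
      \<le> (\<integral>\<^sup>+u. indicator {u \<in> space (gauss {..<s}). (\<Sum>l<K + 1. (\<Sum>b<s. v l b * u b)\<^sup>2) < x} u \<partial>gauss {..<s})"
    proof (intro nn_integral_mono)
      fix u assume u: "u \<in> space (gauss {..<s})"
      have "(\<Sum>l<K + 1. (\<Sum>b<s. v l b * u b)\<^sup>2) < x" if "N (\<lambda>b\<in>{..<s}. - u b) g"
      proof -
        obtain q where q: "(\<Sum>b<s. ((\<lambda>b\<in>{..<s}. - u b) b - (\<Sum>j\<in>J. q j * y g j b))\<^sup>2) < x"
          using \<open>N _ g\<close> unfolding N_def by blast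
        define r where "r = (\<lambda>b. - u b - (\<Sum>j\<in>J. q j * y g j b))"
        have "ip s (v l) r = - ip s (v l) u" if "l < K + 1" for l
        proof -
          have "ip s (v l) r = ip s (v l) (\<lambda>b. - u b) - ip s (v l) (\<lambda>b. \<Sum>j\<in>J. q j * y g j b)"
            unfolding r_def by (rule ip_diff_right)
          then show ?thesis unfolding ip_sum_right using vy'[OF that] by (simp add: ip_def sum_negf)
        qed
        then have "(\<Sum>l<K + 1. (\<Sum>b<s. v l b * u b)\<^sup>2) = (\<Sum>l<K + 1. (ip s (v l) r)\<^sup>2)"
          by (intro sum.cong) (auto simp: ip_def)
        also have "... \<le> ip s r r" by (rule bessel[OF v])
        also have "... < x" using q by (simp add: r_def ip_def power2_eq_square)
        finally show ?thesis .
      qed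
      then show "h (\<lambda>b\<in>{..<s}. - u b) g
          \<le> indicator {u \<in> space (gauss {..<s}). (\<Sum>l<K + 1. (\<Sum>b<s. v l b * u b)\<^sup>2) < x} u"
        using u by (auto simp: h_def indicator_def)
    qed
    also have "... = emeasure (gauss {..<s}) {u \<in> space (gauss {..<s}). (\<Sum>l<K + 1. (\<Sum>b<s. v l b * u b)\<^sup>2) < x}"
      by (rule nn_integral_indicator) measurable
    also have "... \<le> ennreal (sqrt (exp 1 * x / real (K + 1)) ^ (K + 1))"
      using v by (intro gauss_orthonormal_small_ball x) (auto simp: orthofam_def ip_def)
    finally show "(\<integral>\<^sup>+u. h (\<lambda>b\<in>{..<s}. - u b) g \<partial>gauss {..<s}) \<le> ennreal (sqrt (exp 1 * x / real (K + 1)) ^ (K + 1))" .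
  qed
  also have "... = ennreal (sqrt (exp 1 * x / real (K + 1)) ^ (K + 1))"
    using GI.emeasure_space_1 by simp
  finally show ?thesis by (simp add: I_def)
qed

section \<open>Numerical estimates\<close>

text \<open>\<open>g\<close> stands for the square of \<gamma>, and the left side is the Chernoff
  bound at \<open>a = 2 g m s\<close>. It equals \<open>q ^ (m s)\<close> for
  \<open>q = sqrt 2 * exp (- g / 2)\<close>, where \<open>q^2 \<le> 0.74\<close> since
  \<open>exp 1 \<ge> 2.71\<close>; \<open>s \<ge> 2\<close> leaves \<open>(2 exp (- g)) ^ m\<close>.
  Two of these factors provide the exponential on the right, the others absorb
  \<open>sqrt m\<close>.\<close>

lemma gaussian_norm_tail_le:
  fixes g :: real
  assumes g: "g > 1" and s: "s \<ge> 2" and m: "m \<ge> 2"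
  shows "exp (- (2 * g * real (m * s)) / 4) * sqrt 2 ^ (m * s)
    \<le> 1 / (4 * (g - 1) * sqrt (pi * real m * g)) * (2 * g / exp (g - 1))\<^sup>2"
proof -
  have e27: "exp (1 :: real) \<ge> 2.71" using e_approx_32 by (simp add: abs_if split: if_split_asm)
  define q where "q = sqrt 2 * exp (- g / 2)"
  have "(exp (- g / 2))\<^sup>2 = exp (- g)"
    using exp_of_nat_mult[of 2 "- g / 2"] by simp
  then have q2: "q\<^sup>2 = 2 * exp (- g)"
    by (simp add: q_def power_mult_distrib)
  have "exp g \<ge> exp 1" using g by simp
  then have "exp g \<ge> 2.71" using e27 by linarith
  then have eg: "2 * exp (- g) \<le> 0.74"
    by (simp add: exp_minus field_simps)
  have q1: "0 \<le> q" "q \<le> 1"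
  proof -
    show "0 \<le> q" by (simp add: q_def)
    have "q\<^sup>2 \<le> 1\<^sup>2" using eg q2 by simp
    then show "q \<le> 1" by (rule power2_le_imp_le) simp
  qed
  have "exp (- (2 * g * real (m * s)) / 4) = exp (- g / 2) ^ (m * s)"
    by (simp add: exp_of_nat_mult[symmetric] field_simps)
  then have "exp (- (2 * g * real (m * s)) / 4) * sqrt 2 ^ (m * s) = q ^ (m * s)"
    by (simp add: q_def power_mult_distrib)
  also have "... \<le> q ^ (2 * m)"
    using q1 s by (intro power_decreasing) (auto simp: mult.commute)
  also have "... = (2 * exp (- g)) ^ (m - 2) * (2 * exp (- g))\<^sup>2"
  proof -
    have "x ^ m = x ^ (m - 2) * x\<^sup>2" for x :: real
      using power_add[of x "m - 2" 2] unfolding le_add_diff_inverse2[OF m] .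
    then show ?thesis by (simp only: power_mult q2)
  qed
  also have "... \<le> 0.74 ^ (m - 2) * (2 * exp (- g))\<^sup>2"
    using eg by (intro mult_right_mono power_mono) auto
  also have "... \<le> 1 / (4 * (g - 1) * sqrt (pi * real m * g)) * (2 * g / exp (g - 1))\<^sup>2"
  proof -
    \<comment> \<open>Equality at \<open>m = 2\<close>; each further step multiplies by at most
      \<open>0.74^2 * 3 / 2 < 1\<close>.\<close>
    have dec: "(0.74\<^sup>2) ^ (m - 2) * real m \<le> (2 :: real)"
      using m
    proof (induction m rule: dec_induct)
      case (step n)
      have "(0.74\<^sup>2) ^ (Suc n - 2) * real (Suc n) = (0.74\<^sup>2) ^ (n - 2) * (0.74\<^sup>2 * real (Suc n))"
      proof -
        have "Suc n - 2 = Suc (n - 2)" using step.hyps by simp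
        then show ?thesis by (simp only: power_Suc mult_ac)
      qed
      also have "... \<le> (0.74\<^sup>2) ^ (n - 2) * real n"
        using step.hyps by (intro mult_left_mono) (auto simp: power2_eq_square)
      finally show ?case using step.IH by simp
    qed simp
    define b where "b = (0.74 :: real) ^ (m - 2) * sqrt (pi * real m)"
    have b0: "b \<ge> 0" by (simp add: b_def)
    have "b\<^sup>2 = ((0.74\<^sup>2) ^ (m - 2) * real m) * pi"
      by (simp add: b_def power_mult_distrib power_mult[symmetric] mult.commute)
    also have "... \<le> 2 * pi" using dec by (intro mult_right_mono) auto
    also have "... \<le> (3 :: real)\<^sup>2" using pi_less_4 by simp
    finally have "b \<le> 3" by (rule power2_le_imp_le) simp
    \<comment> \<open>\<open>(g - 2)^2 \<ge> 0\<close> gives \<open>4 (g - 1) \<le> g^2\<close>,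
      which compares the denominator on the right with the \<open>g^2\<close> in its
      numerator.\<close>
    have "((g - 1) * sqrt g)\<^sup>2 = (g - 1) * (g - 1) * g" using g by (simp add: power2_eq_square)
    also have "... \<le> (g\<^sup>2 / 2)\<^sup>2"
    proof -
      have "4 * (g - 1) \<le> g\<^sup>2" using zero_le_power2[of "g - 2"] by (simp add: power2_eq_square algebra_simps)
      then have "(g - 1) * (4 * (g - 1) * g) \<le> (g - 1) * (g\<^sup>2 * g)" using g by (intro mult_left_mono mult_right_mono) auto
      also have "... \<le> g * (g\<^sup>2 * g)" using g by (intro mult_right_mono) auto
      finally show ?thesis by (simp add: power2_eq_square field_simps)
    qed
    finally have gg: "(g - 1) * sqrt g \<le> g\<^sup>2 / 2" by (rule power2_le_imp_le) simp
    have "(0.74 ^ (m - 2) * (2 * exp (- g))\<^sup>2) * (4 * (g - 1) * sqrt (pi * real m * g))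
        = 16 * (exp (- g))\<^sup>2 * (b * ((g - 1) * sqrt g))"
      by (simp add: b_def real_sqrt_mult power_mult_distrib algebra_simps)
    also have "... \<le> 16 * (exp (- g))\<^sup>2 * (3 * (g\<^sup>2 / 2))"
      using \<open>b \<le> 3\<close> b0 gg g by (intro mult_left_mono mult_mono) auto
    also have "... \<le> (exp (- g))\<^sup>2 * (4 * (exp 1)\<^sup>2 * g\<^sup>2)"
    proof -
      \<comment> \<open>The constant to beat is \<open>16 * 3 / 2 = 24\<close>, and
        \<open>4 * 2.71^2 > 29\<close>.\<close>
      have "(2.71 :: real)\<^sup>2 \<le> (exp 1)\<^sup>2" using e27 by (intro power_mono) auto
      then have "24 \<le> 4 * (exp 1 :: real)\<^sup>2" by (simp add: power2_eq_square)
      then have "24 * g\<^sup>2 \<le> 4 * (exp 1)\<^sup>2 * g\<^sup>2" by (rule mult_right_mono) simp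
      from mult_left_mono[OF this, of "(exp (- g))\<^sup>2"]
      have "(exp (- g))\<^sup>2 * (24 * g\<^sup>2) \<le> (exp (- g))\<^sup>2 * (4 * (exp 1)\<^sup>2 * g\<^sup>2)" by (simp only: zero_le_power2 simp_thms)
      moreover have "16 * (exp (- g))\<^sup>2 * (3 * (g\<^sup>2 / 2)) = (exp (- g))\<^sup>2 * (24 * g\<^sup>2)" by simp
      ultimately show ?thesis by (simp only:)
    qed
    also have "... = (2 * g / exp (g - 1))\<^sup>2"
      by (simp add: exp_diff exp_minus power_mult_distrib power_divide field_simps)
    finally show ?thesis using g m by (simp add: field_simps)
  qed
  finally show ?thesis .
qed

text \<open>The Frobenius bound \<open>t\<close> demanded of the right inverse. The factor 4/3 is
  dictated by the claim: \<open>3/2 * 2 * 4/3 = 4\<close> matches the \<open>2 * 2\<close> on the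
  right of \<open>sthosvd_step_bound\<close>, and \<open>\<mu> + 1\<close> is what the rank pays
  for.\<close>

definition dual_bound :: "nat \<Rightarrow> nat \<Rightarrow> real" where
  "dual_bound \<mu> K = 4 / 3 * (real \<mu> + 1) * sqrt (real (\<mu> + K))"

text \<open>The distance threshold is \<open>\<mu> / t^2\<close>, so that \<open>\<mu>\<close> dual
  vectors have total squared norm at most \<open>t^2\<close>. Since
  \<open>\<mu> + K \<ge> k = K + 1\<close>, the number under the root is at most
  \<open>9 e / (16 k^2 (\<mu> + 1))\<close>, and \<open>1 / (\<mu> + 1)\<close> beats the union
  bound over \<open>\<mu>\<close> rows.\<close>

lemma near_span_tail_le:
  assumes \<mu>: "\<mu> > 0" and K: "K > 0"
  shows "real \<mu> * sqrt (exp 1 * (real \<mu> / (dual_bound \<mu> K)\<^sup>2) / real (K + 1)) ^ (K + 1)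
    \<le> 1 / sqrt (2 * pi * (real K + 1)) * (exp 1 / (real K + 1)) ^ (K + 1)"
proof -
  define k where "k = K + 1"
  have k: "k \<ge> 2" "real k = real K + 1" using K by (auto simp: k_def)
  have e27: "exp (1 :: real) \<ge> 2.71" using e_approx_32 by (simp add: abs_if split: if_split_asm)
  have db: "(dual_bound \<mu> K)\<^sup>2 = 16 / 9 * (real \<mu> + 1)\<^sup>2 * real (\<mu> + K)"
    unfolding dual_bound_def power_mult_distrib by (simp add: power_divide)
  have "exp 1 * (real \<mu> / (dual_bound \<mu> K)\<^sup>2) / real k
      = 9 * exp 1 * real \<mu> / (16 * (real \<mu> + 1)\<^sup>2 * real (\<mu> + K) * real k)"
    unfolding db by simp
  also have "... \<le> 9 * exp 1 * (real \<mu> + 1) / (16 * (real \<mu> + 1)\<^sup>2 * real k * real k)"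
    using \<mu> k by (intro frac_le mult_mono mult_left_mono) (auto simp: k_def)
  also have "... = (1 / (real \<mu> + 1)) * ((9 * exp 1) / (16 * (real k)\<^sup>2))"
  proof -
    have "9 * e * u / (16 * u\<^sup>2 * k * k) = (1 / u) * ((9 * e) / (16 * k\<^sup>2))" if "u > 0" "k > 0" for u k e :: real
      using that by (simp add: power2_eq_square field_simps)
    then show ?thesis using k by simp
  qed
  finally have "sqrt (exp 1 * (real \<mu> / (dual_bound \<mu> K)\<^sup>2) / real k)
      \<le> sqrt (1 / (real \<mu> + 1)) * sqrt ((9 * exp 1) / (16 * (real k)\<^sup>2))"
    by (simp add: real_sqrt_mult[symmetric])
  also have "sqrt ((9 * exp 1) / (16 * (real k)\<^sup>2)) = 3 * sqrt (exp 1) / (4 * real k)"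
    by (simp add: real_sqrt_mult real_sqrt_divide)
  finally have "sqrt (exp 1 * (real \<mu> / (dual_bound \<mu> K)\<^sup>2) / real k) ^ k
      \<le> (sqrt (1 / (real \<mu> + 1)) * (3 * sqrt (exp 1) / (4 * real k))) ^ k"
    by (intro power_mono) auto
  also have "... = sqrt (1 / (real \<mu> + 1)) ^ k * (3 * sqrt (exp 1) / (4 * real k)) ^ k"
    by (rule power_mult_distrib)
  \<comment> \<open>\<open>K > 0\<close> gives \<open>k \<ge> 2\<close>, so two of the
    \<open>k\<close> square roots already combine to \<open>1 / (\<mu> + 1)\<close>.\<close>
  also have "... \<le> sqrt (1 / (real \<mu> + 1)) ^ 2 * (3 * sqrt (exp 1) / (4 * real k)) ^ k"
    using k by (intro mult_right_mono power_decreasing) auto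
  also have "sqrt (1 / (real \<mu> + 1)) ^ 2 = 1 / (real \<mu> + 1)" by simp
  finally have "real \<mu> * sqrt (exp 1 * (real \<mu> / (dual_bound \<mu> K)\<^sup>2) / real k) ^ k
      \<le> real \<mu> * (1 / (real \<mu> + 1) * (3 * sqrt (exp 1) / (4 * real k)) ^ k)"
    by (intro mult_left_mono) auto
  also have "... \<le> (3 * sqrt (exp 1) / (4 * real k)) ^ k"
  proof -
    have "real \<mu> * (1 / (real \<mu> + 1)) \<le> 1" by simp
    from mult_right_mono[OF this, of "(3 * sqrt (exp 1) / (4 * real k)) ^ k"] show ?thesis by simp
  qed
  also have "... \<le> 1 / sqrt (2 * pi * real k) * (exp 1 / real k) ^ k"
  proof -
    \<comment> \<open>What remains is \<open>2 pi k \<le> (16 e / 9) ^ k\<close>; 6.3 exceeds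
      \<open>2 pi\<close>, and 4.8 is below \<open>16 * 2.71 / 9\<close>.\<close>
    have "6.3 * real k \<le> 4.8 ^ k"
      using k(1)
    proof (induction k rule: dec_induct)
      case (step n)
      have "6.3 * real (Suc n) \<le> 4.8 * (6.3 * real n)" using step.hyps by simp
      also have "... \<le> 4.8 * 4.8 ^ n" using step.IH by (rule mult_left_mono) simp
      finally show ?case by simp
    qed (simp add: power2_eq_square)
    moreover have "2 * pi * real k \<le> 6.3 * real k" using pi_approx by (intro mult_right_mono) auto
    ultimately have "2 * pi * real k \<le> 4.8 ^ k" by linarith
    also have "... \<le> (16 * exp 1 / 9) ^ k" using e27 by (intro power_mono) auto
    also have "... = ((4 * sqrt (exp 1) / 3) ^ k)\<^sup>2"
      by (simp add: power_divide power_mult_distrib power_mult[symmetric] mult.commute[of k])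
        (simp add: power_mult power_mult_distrib)
    finally have "sqrt (2 * pi * real k) \<le> (4 * sqrt (exp 1) / 3) ^ k"
      by (intro real_le_lsqrt) auto
    then have "(3 * sqrt (exp 1) / (4 * real k)) ^ k * sqrt (2 * pi * real k)
        \<le> (3 * sqrt (exp 1) / (4 * real k)) ^ k * (4 * sqrt (exp 1) / 3) ^ k"
      by (intro mult_left_mono) auto
    also have "... = (exp 1 / real k) ^ k"
      by (simp add: power_mult_distrib[symmetric])
    finally have "(3 * sqrt (exp 1) / (4 * real k)) ^ k * sqrt (2 * pi * real k) \<le> (exp 1 / real k) ^ k" .
    moreover have "sqrt (2 * pi * real k) > 0" using k by simp
    ultimately have "(3 * sqrt (exp 1) / (4 * real k)) ^ k \<le> (exp 1 / real k) ^ k / sqrt (2 * pi * real k)"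
      by (subst pos_le_divide_eq)
    then show ?thesis by simp
  qed
  finally show ?thesis unfolding k_def by (simp add: add.commute)
qed

text \<open>\<open>3/2 \<Delta>\<close> is the subspace error after rounding. One
  \<open>sqrt m\<close> comes from the trace, the other one from \<open>F\<close>;
  \<open>S \<le> sqrt mx\<close> and \<open>S \<le> sqrt m\<close> replace \<open>S + S\<close> by
  the sum in \<lambda>, and \<open>H\<close> is the remaining factor of \<lambda> up to \<beta>. If
  \<open>\<Delta> = 0\<close> both sides vanish, so the bound on the rank is asked for only when
  \<open>\<Delta> > 0\<close>.\<close>

lemma sthosvd_step_bound:
  fixes \<Delta> \<gamma> \<beta> :: real
  assumes \<Delta>: "\<Delta> \<ge> 0" and r: "\<Delta> > 0 \<Longrightarrow> \<mu> + 1 \<le> r" and s: "\<mu> + K \<le> mx" "\<mu> + K \<le> m" and m: "m > 0"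
    and \<beta>: "\<beta> > 1" and \<gamma>: "\<gamma> > 1"
    and F: "F \<le> sqrt (2 * \<gamma>\<^sup>2 * real (m * (\<mu> + K)))"
  shows "sqrt (real m) * (3 / 2 * \<Delta> * (1 + 2 * F * dual_bound \<mu> K))
    \<le> 2 * (real r * (1 + (sqrt (real mx) + sqrt (real m)) * sqrt (2 * real (\<mu> + K)) * \<gamma> * \<beta>) * real m * \<Delta>)"
proof (cases "\<Delta> = 0")
  case False
  then have \<Delta>: "\<Delta> > 0" and r: "real \<mu> + 1 \<le> real r" using \<Delta> r by force+
  define S where "S = sqrt (real (\<mu> + K))"
  define M where "M = sqrt (real m)"
  have M1: "M \<ge> 1" using m by (simp add: M_def)
  have S0: "S \<ge> 0" by (simp add: S_def)
  have MM: "real m = M * M" by (simp add: M_def)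
  have SX: "S \<le> sqrt (real mx)" "S \<le> M" using s by (auto simp: S_def M_def)
  have F': "F \<le> sqrt 2 * \<gamma> * M * S"
    using F \<gamma> by (simp add: real_sqrt_mult M_def S_def)
  define H where "H = sqrt 2 * \<gamma> * S"
  have H0: "H \<ge> 0" using \<gamma> S0 by (simp add: H_def)
  have "3 / 2 * (1 + 2 * F * dual_bound \<mu> K) \<le> 3 / 2 * (1 + 2 * (sqrt 2 * \<gamma> * M * S) * dual_bound \<mu> K)"
    using F' by (intro mult_left_mono add_left_mono mult_right_mono) (auto simp: dual_bound_def)
  also have "... = 3 / 2 + 4 * (real \<mu> + 1) * M * S * H"
  proof -
    have "dual_bound \<mu> K = 4 / 3 * (real \<mu> + 1) * S" by (simp only: dual_bound_def S_def)
    then show ?thesis unfolding H_def by (simp only:) (simp add: algebra_simps)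
  qed
  also have "... \<le> 2 * real r * M + 4 * real r * M * S * H"
  proof (rule add_mono)
    have "1 * 1 \<le> real r * M" using r M1 by (intro mult_mono) auto
    then show "3 / 2 \<le> 2 * real r * M" by simp
    show "4 * (real \<mu> + 1) * M * S * H \<le> 4 * real r * M * S * H"
      using r M1 S0 H0 by (intro mult_right_mono) auto
  qed
  also have "... = 2 * real r * (1 + (S + S) * H * 1) * M" by (simp add: algebra_simps)
  also have "... \<le> 2 * real r * (1 + (sqrt (real mx) + M) * H * \<beta>) * M"
    using SX S0 H0 \<beta> M1 by (intro mult_left_mono mult_right_mono add_left_mono mult_mono add_mono) auto
  finally have "3 / 2 * (1 + 2 * F * dual_bound \<mu> K) \<le> 2 * real r * (1 + (sqrt (real mx) + M) * H * \<beta>) * M" .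
  then have "(M * \<Delta>) * (3 / 2 * (1 + 2 * F * dual_bound \<mu> K))
      \<le> (M * \<Delta>) * (2 * real r * (1 + (sqrt (real mx) + M) * H * \<beta>) * M)"
    using M1 \<Delta> by (intro mult_left_mono) auto
  moreover have "sqrt (2 * real (\<mu> + K)) = sqrt 2 * S" by (simp only: S_def real_sqrt_mult)
  ultimately show ?thesis
    unfolding M_def[symmetric] by (simp only: MM H_def mult_ac)
qed simp

section \<open>Tensors\<close>

lemma sum_PiE_insert:
  assumes "a \<notin> A"
  shows "(\<Sum>i\<in>Pi\<^sub>E (insert a A) B. f i) = (\<Sum>y\<in>B a. \<Sum>i\<in>Pi\<^sub>E A B. f (i(a := y)))"
proof -
  have "(\<Sum>i\<in>Pi\<^sub>E (insert a A) B. f i) = (\<Sum>p\<in>B a \<times> Pi\<^sub>E A B. f ((snd p)(a := fst p)))"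
    unfolding PiE_insert_eq
    by (subst sum.reindex[OF inj_combinator[OF assms]]) (simp add: case_prod_beta)
  then show ?thesis by (simp add: sum.cartesian_product case_prod_beta)
qed

definition other_index :: "nat \<Rightarrow> (nat \<Rightarrow> nat) \<Rightarrow> nat \<Rightarrow> (nat \<Rightarrow> nat) set" where
  "other_index N d n = (\<Pi>\<^sub>E k\<in>{1..N} - {n}. {..<d k})"

lemma sum_tensor_index:
  assumes "n \<in> {1..N}"
  shows "(\<Sum>i\<in>tensor_index N d. f i) = (\<Sum>i\<in>other_index N d n. \<Sum>y<d n. f (i(n := y)))"
proof -
  have "{1..N} = insert n ({1..N} - {n})" using assms by auto
  then have "(\<Sum>i\<in>tensor_index N d. f i) = (\<Sum>y<d n. \<Sum>i\<in>other_index N d n. f (i(n := y)))"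
    unfolding tensor_index_def other_index_def by (metis sum_PiE_insert Diff_iff singletonI)
  then show ?thesis by (simp add: sum.swap[of _ "{..<d n}"])
qed

lemma other_index_cong: "(\<And>k. k \<in> {1..N} \<Longrightarrow> k \<noteq> n \<Longrightarrow> d k = d' k) \<Longrightarrow> other_index N d n = other_index N d' n"
  unfolding other_index_def by (rule PiE_cong) auto

lemma tensor_index_cong: "(\<And>k. k \<in> {1..N} \<Longrightarrow> d k = d' k) \<Longrightarrow> tensor_index N d = tensor_index N d'"
  unfolding tensor_index_def by (rule PiE_cong) auto

text \<open>Induction on the number of modes: the digit of the highest mode is the quotient of
  \<open>j\<close> by the product \<open>P\<close> of the lower dimensions, and the lower digits
  depend on the remainder only. Mode \<open>n\<close> contributes no digit.\<close>

lemma sum_mixed_radix: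
  fixes d :: "nat \<Rightarrow> nat" and n :: nat and F :: "(nat \<Rightarrow> nat) \<Rightarrow> real"
  defines "w \<equiv> \<lambda>k. \<Prod>m\<in>{1..<k} - {n}. d m"
  shows "(\<Sum>j<(\<Prod>m\<in>{1..N} - {n}. d m). F (\<lambda>k\<in>{1..N} - {n}. (j div w k) mod d k))
    = (\<Sum>i\<in>other_index N d n. F i)"
proof (induction N arbitrary: F)
  case 0
  then show ?case by (simp add: other_index_def PiE_empty_domain restrict_def)
next
  case (Suc N)
  show ?case
  proof (cases "Suc N = n")
    case True
    then have "{1..Suc N} - {n} = {1..N} - {n}" by auto
    then show ?thesis using Suc.IH[of F] by (simp add: other_index_def)
  next
    case False
    define P where "P = (\<Prod>m\<in>{1..N} - {n}. d m)"
    let ?A = "{1..N} - {n}"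
    have ins: "{1..Suc N} - {n} = insert (Suc N) ?A" using False by auto
    have wS: "w (Suc N) = P" unfolding w_def P_def by (rule prod.cong) auto
    have dvd: "w k * d k dvd P" if "k \<in> ?A" for k
    proof -
      have "w k * d k = (\<Prod>m\<in>insert k ({1..<k} - {n}). d m)"
        unfolding w_def by (subst prod.insert) auto
      also have "... dvd P" unfolding P_def using that by (intro prod_dvd_prod_subset) auto
      finally show ?thesis .
    qed
    \<comment> \<open>\<open>w k * d k\<close> divides \<open>P\<close>, so adding a multiple of
      \<open>P\<close> changes \<open>j div w k\<close> by a multiple of \<open>d k\<close>.\<close>
    have dig: "((q * P + j) div w k) mod d k = (j div w k) mod d k" if k: "k \<in> ?A" and "j < P" for q j k
    proof -
      obtain R where R: "P = w k * d k * R" using dvd[OF k] by (auto elim: dvdE)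
      have "w k > 0" using R \<open>j < P\<close> by (cases "w k = 0") auto
      have "q * P + j = j + (d k * R * q) * w k" by (simp add: R algebra_simps)
      moreover have "(j + (d k * R * q) * w k) div w k = d k * R * q + j div w k"
        using \<open>w k > 0\<close> by simp
      ultimately have "(q * P + j) div w k = d k * R * q + j div w k" by (simp only:)
      then show ?thesis by (simp add: mult.assoc)
    qed
    have "(\<Sum>j<(\<Prod>m\<in>{1..Suc N} - {n}. d m). F (\<lambda>k\<in>{1..Suc N} - {n}. (j div w k) mod d k))
      = (\<Sum>j<d (Suc N) * P. F (\<lambda>k\<in>insert (Suc N) ?A. (j div w k) mod d k))"
      unfolding ins P_def by (subst prod.insert) auto
    also have "... = (\<Sum>q<d (Suc N). \<Sum>j<P. F (\<lambda>k\<in>insert (Suc N) ?A. ((q * P + j) div w k) mod d k))"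
      unfolding sum.nat_group[symmetric]
    proof (rule sum.cong[OF refl])
      fix q
      show "(\<Sum>j = q * P..<q * P + P. F (\<lambda>k\<in>insert (Suc N) ?A. (j div w k) mod d k))
          = (\<Sum>j<P. F (\<lambda>k\<in>insert (Suc N) ?A. ((q * P + j) div w k) mod d k))"
        by (rule sum.reindex_bij_witness[of _ "\<lambda>j. q * P + j" "\<lambda>j. j - q * P"]) auto
    qed
    also have "... = (\<Sum>q<d (Suc N). \<Sum>j<P. F ((\<lambda>k\<in>?A. (j div w k) mod d k)(Suc N := q)))"
    proof (intro sum.cong refl)
      fix q j assume qj: "q \<in> {..<d (Suc N)}" "j \<in> {..<P}"
      have "(\<lambda>k\<in>insert (Suc N) ?A. ((q * P + j) div w k) mod d k) = (\<lambda>k\<in>?A. (j div w k) mod d k)(Suc N := q)"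
      proof
        fix k show "(\<lambda>k\<in>insert (Suc N) ?A. ((q * P + j) div w k) mod d k) k = ((\<lambda>k\<in>?A. (j div w k) mod d k)(Suc N := q)) k"
          using qj dig[of k j q] by (cases "k = Suc N") (auto simp: wS restrict_def)
      qed
      then show "F (\<lambda>k\<in>insert (Suc N) ?A. ((q * P + j) div w k) mod d k) = F ((\<lambda>k\<in>?A. (j div w k) mod d k)(Suc N := q))"
        by simp
    qed
    also have "... = (\<Sum>q<d (Suc N). \<Sum>i\<in>other_index N d n. F (i(Suc N := q)))"
    proof (rule sum.cong[OF refl])
      fix q
      show "(\<Sum>j<P. F ((\<lambda>k\<in>?A. (j div w k) mod d k)(Suc N := q))) = (\<Sum>i\<in>other_index N d n. F (i(Suc N := q)))"
        unfolding P_def by (rule Suc.IH[of "\<lambda>i. F (i(Suc N := q))"])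
    qed
    also have "... = (\<Sum>i\<in>other_index (Suc N) d n. F i)"
      unfolding other_index_def ins by (subst sum_PiE_insert) auto
    finally show ?thesis .
  qed
qed

section \<open>Unfoldings and their columns\<close>

lemma unfolding_mat_carrier [simp]: "unfolding_mat N d n T \<in> carrier_mat (d n) (\<Prod>m\<in>{1..N} - {n}. d m)"
  by (simp add: unfolding_mat_def)

text \<open>\<open>h\<close> is an arbitrary function of a column. Gram entries and norms are sums
  over columns, so the order of the columns disappears here.\<close>

lemma sum_cols_unfolding_mat:
  fixes h :: "(nat \<Rightarrow> real) \<Rightarrow> real"
  assumes n: "n \<in> {1..N}" and h: "\<And>u v. (\<And>a. a < d n \<Longrightarrow> u a = v a) \<Longrightarrow> h u = h v"
  shows "(\<Sum>j<(\<Prod>m\<in>{1..N} - {n}. d m). h (\<lambda>a. unfolding_mat N d n T $$ (a, j)))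
    = (\<Sum>i\<in>other_index N d n. h (\<lambda>a. T (i(n := a))))"
proof -
  have "(\<Sum>j<(\<Prod>m\<in>{1..N} - {n}. d m). h (\<lambda>a. unfolding_mat N d n T $$ (a, j)))
    = (\<Sum>j<(\<Prod>m\<in>{1..N} - {n}. d m).
        h (\<lambda>a. T ((\<lambda>k\<in>{1..N} - {n}. (j div (\<Prod>m\<in>{1..<k} - {n}. d m)) mod d k)(n := a))))"
  proof (intro sum.cong refl h)
    fix j a assume "j \<in> {..<(\<Prod>m\<in>{1..N} - {n}. d m)}" "a < d n"
    moreover have "(\<lambda>k\<in>{1..N}. if k = n then a else (j div (\<Prod>m\<in>{1..<k} - {n}. d m)) mod d k)
      = (\<lambda>k\<in>{1..N} - {n}. (j div (\<Prod>m\<in>{1..<k} - {n}. d m)) mod d k)(n := a)"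
      using n by (auto simp: fun_eq_iff restrict_def)
    ultimately show "unfolding_mat N d n T $$ (a, j)
      = T ((\<lambda>k\<in>{1..N} - {n}. (j div (\<Prod>m\<in>{1..<k} - {n}. d m)) mod d k)(n := a))"
      by (simp add: unfolding_mat_def)
  qed
  also have "... = (\<Sum>i\<in>other_index N d n. h (\<lambda>a. T (i(n := a))))"
    by (rule sum_mixed_radix)
  finally show ?thesis .
qed

text \<open>The dimensions are an argument because adjoint mode products relate tensors over
  different index sets.\<close>

definition tip :: "nat \<Rightarrow> (nat \<Rightarrow> nat) \<Rightarrow> tensor \<Rightarrow> tensor \<Rightarrow> real" where
  "tip N d X Y = (\<Sum>i\<in>tensor_index N d. X i * Y i)"

lemma tip_cong:
  assumes "\<And>k. k \<in> {1..N} \<Longrightarrow> d k = d' k" "\<And>i. i \<in> tensor_index N d \<Longrightarrow> X i = X' i"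
    "\<And>i. i \<in> tensor_index N d \<Longrightarrow> Y i = Y' i"
  shows "tip N d X Y = tip N d' X' Y'"
proof -
  have "tensor_index N d = tensor_index N d'" using assms(1) by (rule tensor_index_cong)
  then show ?thesis using assms(2,3) by (simp add: tip_def)
qed

lemma tip_nonneg [simp]: "tip N d X X \<ge> 0"
  by (simp add: tip_def sum_nonneg)

lemma tip_diff: "tip N d (\<lambda>i. X i - Y i) (\<lambda>i. X i - Y i) = tip N d X X - 2 * tip N d X Y + tip N d Y Y"
  by (simp add: tip_def algebra_simps sum.distrib sum_subtractf sum_distrib_left)

lemma tensor_fnorm_power2: "(tensor_fnorm N d X)\<^sup>2 = tip N d X X"
  by (simp add: tensor_fnorm_def tip_def sum_nonneg power2_eq_square)

text \<open>Adjointness in one mode: the sums over the old and the new index in mode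
  \<open>n\<close> are exchanged.\<close>

lemma tip_mode_prod:
  assumes n: "n \<in> {1..N}" and B: "B \<in> carrier_mat r c"
  shows "tip N (d(n := r)) X (mode_prod Y n B) = tip N (d(n := c)) (mode_prod X n (transpose_mat B)) Y"
proof -
  have o: "other_index N (d(n := u)) n = other_index N d n" for u by (rule other_index_cong) auto
  have "tip N (d(n := r)) X (mode_prod Y n B)
      = (\<Sum>i\<in>other_index N d n. \<Sum>a<r. \<Sum>k<c. X (i(n := a)) * Y (i(n := k)) * B $$ (a, k))"
    using B unfolding tip_def sum_tensor_index[OF n] o by (simp add: mode_prod_def sum_distrib_left algebra_simps)
  also have "... = (\<Sum>i\<in>other_index N d n. \<Sum>k<c. \<Sum>a<r. X (i(n := a)) * Y (i(n := k)) * B $$ (a, k))"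
    by (intro sum.cong refl sum.swap)
  also have "... = tip N (d(n := c)) (mode_prod X n (transpose_mat B)) Y"
    using B unfolding tip_def sum_tensor_index[OF n] o by (simp add: mode_prod_def sum_distrib_left algebra_simps)
  finally show ?thesis .
qed

section \<open>Algebra of mode products\<close>

lemma mode_prod_commute:
  assumes "m \<noteq> n"
  shows "mode_prod (mode_prod X m C) n B = mode_prod (mode_prod X n B) m C"
proof
  fix i
  have "mode_prod (mode_prod X m C) n B i
      = (\<Sum>k<dim_col B. \<Sum>l<dim_col C. X (i(n := k, m := l)) * C $$ (i m, l) * B $$ (i n, k))"
    using assms by (simp add: mode_prod_def sum_distrib_right)
  also have "... = (\<Sum>l<dim_col C. \<Sum>k<dim_col B. X (i(n := k, m := l)) * C $$ (i m, l) * B $$ (i n, k))"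
    by (rule sum.swap)
  also have "... = mode_prod (mode_prod X n B) m C i"
    using assms by (simp add: mode_prod_def sum_distrib_left fun_upd_twist algebra_simps)
  finally show "mode_prod (mode_prod X m C) n B i = mode_prod (mode_prod X n B) m C i" .
qed

lemma mode_prods_mode_prod_commute:
  "n < m \<Longrightarrow> mode_prods (mode_prod X m C) B n = mode_prod (mode_prods X B n) m C"
  by (induction n) (simp_all add: mode_prod_commute)

lemma mode_prod_mode_prod:
  assumes "B \<in> carrier_mat r c" "C \<in> carrier_mat p r" "i n < p"
  shows "mode_prod (mode_prod X n B) n C i = mode_prod X n (C * B) i"
proof -
  have "mode_prod (mode_prod X n B) n C i = (\<Sum>l<r. \<Sum>k<c. X (i(n := k)) * B $$ (l, k) * C $$ (i n, l))"
    using assms by (simp add: mode_prod_def sum_distrib_right)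
  also have "... = (\<Sum>k<c. \<Sum>l<r. X (i(n := k)) * B $$ (l, k) * C $$ (i n, l))" by (rule sum.swap)
  also have "... = mode_prod X n (C * B) i"
    using assms by (simp add: mode_prod_def scalar_prod_def sum_distrib_left atLeast0LessThan algebra_simps)
  finally show ?thesis .
qed

lemma mode_prod_one: "i n < c \<Longrightarrow> mode_prod X n (1\<^sub>m c) i = X i"
proof -
  assume i: "i n < c"
  have "mode_prod X n (1\<^sub>m c) i = (\<Sum>k<c. if i n = k then X (i(n := k)) else 0)"
    unfolding mode_prod_def using i by (intro sum.cong) auto
  then show ?thesis using i by simp
qed

abbreviation transposes :: "(nat \<Rightarrow> real mat) \<Rightarrow> nat \<Rightarrow> real mat" where
  "transposes Q \<equiv> \<lambda>k. transpose_mat (Q k)"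

text \<open>Products in different modes commute, so all compressions can be carried out before all
  expansions. The identity is pointwise, at indices where the matrix entries are meaningful.\<close>

lemma mode_prods_projection:
  assumes "\<And>k. k \<in> {1..n} \<Longrightarrow> Q k \<in> carrier_mat (I k) (\<mu> k)" "\<And>k. k \<in> {1..n} \<Longrightarrow> i k < I k"
  shows "mode_prods X (\<lambda>k. Q k * transpose_mat (Q k)) n i
    = mode_prods (mode_prods X (transposes Q) n) Q n i"
  using assms
proof (induction n arbitrary: i)
  case (Suc n)
  define Z where "Z = mode_prods X (transposes Q) n"
  have Q: "Q (Suc n) \<in> carrier_mat (I (Suc n)) (\<mu> (Suc n))" using Suc.prems(1) by simp
  have "mode_prods X (\<lambda>k. Q k * transpose_mat (Q k)) (Suc n) i
      = mode_prod (mode_prods Z Q n) (Suc n) (Q (Suc n) * transpose_mat (Q (Suc n))) i"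
    using Suc.IH Suc.prems Q by (simp add: mode_prod_def Z_def)
  also have "... = mode_prod (mode_prod (mode_prods Z Q n) (Suc n) (transpose_mat (Q (Suc n)))) (Suc n) (Q (Suc n)) i"
    using Q Suc.prems(2) by (intro mode_prod_mode_prod[symmetric]) auto
  also have "... = mode_prods (mode_prods X (transposes Q) (Suc n)) Q (Suc n) i"
    by (simp add: Z_def mode_prods_mode_prod_commute)
  finally show ?case .
qed simp

lemma mode_prods_orthonormal:
  assumes "\<And>k. k \<in> {1..n} \<Longrightarrow> Q k \<in> carrier_mat (I k) (\<mu> k)" "\<And>k. k \<in> {1..n} \<Longrightarrow> orthonormal_mat (Q k)"
    "\<And>k. k \<in> {1..n} \<Longrightarrow> i k < \<mu> k"
  shows "mode_prods (mode_prods X Q n) (transposes Q) n i = X i"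
  using assms
proof (induction n arbitrary: X i)
  case (Suc n)
  define Z where "Z = mode_prods X Q n"
  have Q: "Q (Suc n) \<in> carrier_mat (I (Suc n)) (\<mu> (Suc n))" using Suc.prems(1) by simp
  have QQ: "transpose_mat (Q (Suc n)) * Q (Suc n) = 1\<^sub>m (\<mu> (Suc n))"
    using Suc.prems(2)[of "Suc n"] Q by (simp add: orthonormal_mat_def)
  have "mode_prods (mode_prods X Q (Suc n)) (transposes Q) (Suc n) i
      = mode_prod (mode_prod (mode_prods Z (transposes Q) n) (Suc n) (Q (Suc n))) (Suc n) (transpose_mat (Q (Suc n))) i"
    by (simp add: Z_def mode_prods_mode_prod_commute)
  also have "... = mode_prod (mode_prods Z (transposes Q) n) (Suc n) (1\<^sub>m (\<mu> (Suc n))) i"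
    unfolding QQ[symmetric] using Q Suc.prems(3)[of "Suc n"] by (intro mode_prod_mode_prod) auto
  also have "... = mode_prods Z (transposes Q) n i"
    using Suc.prems(3)[of "Suc n"] by (intro mode_prod_one) simp
  also have "... = X i" unfolding Z_def using Suc.prems by (intro Suc.IH) auto
  finally show ?case .
qed simp

text \<open>\<open>e\<close> is arbitrary in the induction because peeling off mode
  \<open>Suc n\<close> changes its dimension from \<open>I\<close> to \<open>\<mu>\<close> while the
  lower modes are still to be treated.\<close>

lemma tip_mode_prods:
  assumes "n \<le> N" "\<And>k. k \<in> {1..n} \<Longrightarrow> Q k \<in> carrier_mat (I k) (\<mu> k)"
  shows "tip N (\<lambda>k. if k \<le> n then I k else e k) X (mode_prods Y Q n)
    = tip N (\<lambda>k. if k \<le> n then \<mu> k else e k) (mode_prods X (transposes Q) n) Y"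
  using assms
proof (induction n arbitrary: X Y e)
  case 0
  then show ?case by (auto intro!: tip_cong)
next
  case (Suc n)
  let ?d = "\<lambda>k. if k \<le> Suc n then I k else e k"
  let ?e = "e(Suc n := \<mu> (Suc n))"
  have Q: "Q (Suc n) \<in> carrier_mat (I (Suc n)) (\<mu> (Suc n))" using Suc.prems(2) by simp
  have "tip N ?d X (mode_prods Y Q (Suc n))
      = tip N (?d(Suc n := I (Suc n))) X (mode_prod (mode_prods Y Q n) (Suc n) (Q (Suc n)))"
    by (rule tip_cong) (auto simp: le_Suc_eq)
  also have "... = tip N (?d(Suc n := \<mu> (Suc n))) (mode_prod X (Suc n) (transpose_mat (Q (Suc n)))) (mode_prods Y Q n)"
    using Suc.prems(1) by (intro tip_mode_prod Q) simp
  also have "... = tip N (\<lambda>k. if k \<le> n then I k else ?e k) (mode_prod X (Suc n) (transpose_mat (Q (Suc n)))) (mode_prods Y Q n)"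
    by (rule tip_cong) (auto simp: le_Suc_eq)
  also have "... = tip N (\<lambda>k. if k \<le> n then \<mu> k else ?e k)
      (mode_prods (mode_prod X (Suc n) (transpose_mat (Q (Suc n)))) (transposes Q) n) Y"
    using Suc.prems by (intro Suc.IH) auto
  also have "... = tip N (\<lambda>k. if k \<le> Suc n then \<mu> k else e k) (mode_prods X (transposes Q) (Suc n)) Y"
    by (rule tip_cong) (auto simp: mode_prods_mode_prod_commute le_Suc_eq)
  finally show ?case .
qed

text \<open>Pythagoras for an orthogonal projection: moving the \<open>Q k\<close> across the inner
  product turns both the mixed and the squared term into the squared norm of the compressed tensor
  \<open>Z\<close>.\<close>

lemma tip_diff_mode_prods_projection:
  fixes X :: tensor and e :: "nat \<Rightarrow> nat"
  assumes n: "n \<le> N" and Q: "\<And>k. k \<in> {1..n} \<Longrightarrow> Q k \<in> carrier_mat (I k) (\<mu> k)"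
    and orth: "\<And>k. k \<in> {1..n} \<Longrightarrow> orthonormal_mat (Q k)"
  defines "Z \<equiv> mode_prods X (transposes Q) n"
  defines "d \<equiv> \<lambda>k. if k \<le> n then I k else e k"
  shows "tip N d (\<lambda>i. X i - mode_prods Z Q n i) (\<lambda>i. X i - mode_prods Z Q n i)
    = tip N d X X - tip N (\<lambda>k. if k \<le> n then \<mu> k else e k) Z Z"
proof -
  let ?d' = "\<lambda>k. if k \<le> n then \<mu> k else e k"
  have "tip N d X (mode_prods Z Q n) = tip N ?d' Z Z"
    unfolding d_def Z_def using n Q by (rule tip_mode_prods)
  moreover have "tip N d (mode_prods Z Q n) (mode_prods Z Q n)
      = tip N ?d' (mode_prods (mode_prods Z Q n) (transposes Q) n) Z"
    unfolding d_def using n Q by (rule tip_mode_prods)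
  moreover have "tip N ?d' (mode_prods (mode_prods Z Q n) (transposes Q) n) Z = tip N ?d' Z Z"
  proof (rule tip_cong)
    fix i assume "i \<in> tensor_index N ?d'"
    then have "i k < \<mu> k" if "k \<in> {1..n}" for k
      using that n by (auto simp: tensor_index_def PiE_iff dest!: bspec[of _ _ k])
    then show "mode_prods (mode_prods Z Q n) (transposes Q) n i = Z i"
      using Q orth by (intro mode_prods_orthonormal[where I = I and \<mu> = \<mu>]) auto
  qed auto
  ultimately show ?thesis by (simp add: tip_diff)
qed

lemma tip_mode_prods_transpose_le:
  fixes X :: tensor and e :: "nat \<Rightarrow> nat"
  assumes n: "n \<le> N" and Q: "\<And>k. k \<in> {1..n} \<Longrightarrow> Q k \<in> carrier_mat (I k) (\<mu> k)"
    and orth: "\<And>k. k \<in> {1..n} \<Longrightarrow> orthonormal_mat (Q k)"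
  defines "Z \<equiv> mode_prods X (transposes Q) n"
  shows "tip N (\<lambda>k. if k \<le> n then \<mu> k else e k) Z Z \<le> tip N (\<lambda>k. if k \<le> n then I k else e k) X X"
  using tip_diff_mode_prods_projection[OF n Q orth, where X = X and e = e]
    tip_nonneg[of N "\<lambda>k. if k \<le> n then I k else e k" "\<lambda>i. X i - mode_prods Z Q n i"]
  by (simp add: Z_def)

text \<open>The matrix \<open>B\<^sub>n B\<^sub>n\<^sup>T\<close> of the algorithm, as a function of the indices.\<close>

definition sthosvd_gram :: "nat \<Rightarrow> (nat \<Rightarrow> nat) \<Rightarrow> (nat \<Rightarrow> nat) \<Rightarrow> tensor \<Rightarrow> (nat \<Rightarrow> real mat) \<Rightarrow> nat \<Rightarrow> nat \<Rightarrow> nat \<Rightarrow> real" where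
  "sthosvd_gram N I \<mu> T Q n a b =
    (\<Sum>i\<in>other_index N (\<lambda>k. if k < n then \<mu> k else I k) n.
      mode_prods T (transposes Q) (n - 1) (i(n := a)) *
      mode_prods T (transposes Q) (n - 1) (i(n := b)))"

section \<open>Gram matrices of the truncated unfoldings\<close>

abbreviation trunc_cols :: "nat \<Rightarrow> (nat \<Rightarrow> nat) \<Rightarrow> (nat \<Rightarrow> nat) \<Rightarrow> nat \<Rightarrow> nat" where
  "trunc_cols N I \<mu> n \<equiv> \<Prod>m\<in>{1..N} - {n}. if m < n then \<mu> m else I m"

lemma sthosvd_B_carrier:
  "sthosvd_B N I \<mu> T Q n \<in> carrier_mat (I n) (trunc_cols N I \<mu> n)"
  using unfolding_mat_carrier[of N "\<lambda>k. if k < n then \<mu> k else I k" n] by (simp add: sthosvd_B_def)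

lemma sthosvd_gram_eq:
  assumes "n \<in> {1..N}" "a < I n" "b < I n"
  shows "sthosvd_gram N I \<mu> T Q n a b
    = (\<Sum>j<(trunc_cols N I \<mu> n). sthosvd_B N I \<mu> T Q n $$ (a, j) * sthosvd_B N I \<mu> T Q n $$ (b, j))"
  unfolding sthosvd_gram_def sthosvd_B_def
  by (rule sum_cols_unfolding_mat[where h = "\<lambda>u. u a * u b", symmetric]) (use assms in auto)

text \<open>The transpose of the truncated unfolding applied to \<open>x\<close> is \<open>T\<close>
  contracted with \<open>x\<close> in mode \<open>n\<close> and then compressed in the earlier
  modes, and compressing does not increase norms. This is the domination that
  \<open>singval_transpose_mono\<close> asks for.\<close>

lemma sthosvd_B_transpose_le:
  assumes n: "n \<in> {1..N}" and Q: "\<And>k. k \<in> {1..<n} \<Longrightarrow> Q k \<in> carrier_mat (I k) (\<mu> k)"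
    and orth: "\<And>k. k \<in> {1..<n} \<Longrightarrow> orthonormal_mat (Q k)"
  defines "c' \<equiv> (trunc_cols N I \<mu> n)" and "c \<equiv> (\<Prod>m\<in>{1..N} - {n}. I m)"
  shows "ip_sq c' (mat_app_t (I n) (sthosvd_B N I \<mu> T Q n) x)
    \<le> ip_sq c (mat_app_t (I n) (unfolding_mat N I n T) x)"
proof -
  \<comment> \<open>Contraction with the one-row matrix \<open>x'\<close> leaves mode
    \<open>n\<close> with dimension 1 and the single index 0.\<close>
  define e where "e = I(n := 1)"
  define x' where "x' = Matrix.mat 1 (I n) (\<lambda>(_, a). x a)"
  define X where "X = mode_prod T n x'"
  let ?d = "\<lambda>k. if k < n then \<mu> k else I k"
  let ?S = "mode_prods T (transposes Q) (n - 1)"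
  have row: "mode_prod Y n x' (i(n := 0)) = (\<Sum>a<I n. Y (i(n := a)) * x a)" for Y i
    by (simp add: mode_prod_def x'_def)
  have norm: "(\<Sum>j<(\<Prod>m\<in>{1..N} - {n}. d m). (\<Sum>a<d n. unfolding_mat N d n Y $$ (a, j) * x a)\<^sup>2)
      = tip N (d(n := 1)) (mode_prod Y n x') (mode_prod Y n x')" if "d n = I n" for d Y
  proof -
    have o: "other_index N (d(n := 1)) n = other_index N d n" by (rule other_index_cong) auto
    have "(\<Sum>j<(\<Prod>m\<in>{1..N} - {n}. d m). (\<Sum>a<d n. unfolding_mat N d n Y $$ (a, j) * x a)\<^sup>2)
      = (\<Sum>i\<in>other_index N d n. (\<Sum>a<d n. Y (i(n := a)) * x a)\<^sup>2)"
      by (rule sum_cols_unfolding_mat[OF n, where h = "\<lambda>u. (\<Sum>a<d n. u a * x a)\<^sup>2"]) simp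
    then show ?thesis
      unfolding tip_def sum_tensor_index[OF n] o by (simp add: row that power2_eq_square)
  qed
  have "ip_sq c' (mat_app_t (I n) (sthosvd_B N I \<mu> T Q n) x)
      = tip N (?d(n := 1)) (mode_prod ?S n x') (mode_prod ?S n x')"
    using norm[of ?d ?S] by (simp add: ip_def mv_def sthosvd_B_def c'_def power2_eq_square)
  also have "mode_prod ?S n x' = mode_prods X (transposes Q) (n - 1)"
    unfolding X_def using n by (intro mode_prods_mode_prod_commute[symmetric]) auto
  also have "tip N (?d(n := 1)) ... ...
      = tip N (\<lambda>k. if k \<le> n - 1 then \<mu> k else e k) ... ..."
    using n by (intro tip_cong) (auto simp: e_def)
  also have "... \<le> tip N (\<lambda>k. if k \<le> n - 1 then I k else e k) X X"
    using n by (intro tip_mode_prods_transpose_le Q orth) auto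
  also have "... = tip N (I(n := 1)) X X" using n by (intro tip_cong) (auto simp: e_def)
  also have "... = ip_sq c (mat_app_t (I n) (unfolding_mat N I n T) x)"
    using norm[of I T] by (simp add: ip_def mv_def c_def X_def power2_eq_square)
  finally show ?thesis .
qed

text \<open>The squared norms of the compressed tensors telescope: the one before step
  \<open>n\<close> is the trace of the Gram matrix \<open>D\<close>, the one after it the trace of
  \<open>Q^T D Q\<close>.\<close>

lemma sthosvd_approx_error:
  assumes Q: "\<And>k. k \<in> {1..N} \<Longrightarrow> Q k \<in> carrier_mat (I k) (\<mu> k)"
    and orth: "\<And>k. k \<in> {1..N} \<Longrightarrow> orthonormal_mat (Q k)"
  shows "(tensor_fnorm N I (\<lambda>i. T i - sthosvd_approx T Q N i))\<^sup>2
    = (\<Sum>n=1..N. (\<Sum>a<I n. sthosvd_gram N I \<mu> T Q n a a)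
        - (\<Sum>l<\<mu> n. \<Sum>a<I n. \<Sum>b<I n. Q n $$ (a, l) * sthosvd_gram N I \<mu> T Q n a b * Q n $$ (b, l)))"
proof -
  define S where "S = mode_prods T (transposes Q)"
  define d where "d = (\<lambda>n k. if k \<le> n then \<mu> k else I k)"
  have "(tensor_fnorm N I (\<lambda>i. T i - sthosvd_approx T Q N i))\<^sup>2
      = tip N (\<lambda>k. if k \<le> N then I k else I k) (\<lambda>i. T i - mode_prods (S N) Q N i) (\<lambda>i. T i - mode_prods (S N) Q N i)"
    unfolding tensor_fnorm_power2
  proof (rule tip_cong)
    fix i assume "i \<in> tensor_index N I"
    then have "i k < I k" if "k \<in> {1..N}" for k using that by (auto simp: tensor_index_def)
    then have "sthosvd_approx T Q N i = mode_prods (S N) Q N i"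
      unfolding sthosvd_approx_def S_def using Q by (intro mode_prods_projection[where I = I and \<mu> = \<mu>]) auto
    then show "T i - sthosvd_approx T Q N i = T i - mode_prods (S N) Q N i"
      "T i - sthosvd_approx T Q N i = T i - mode_prods (S N) Q N i" by simp_all
  qed auto
  also have "... = tip N (\<lambda>k. if k \<le> N then I k else I k) T T - tip N (d N) (S N) (S N)"
    unfolding S_def d_def by (rule tip_diff_mode_prods_projection[OF order_refl Q orth])
  also have "tip N (\<lambda>k. if k \<le> N then I k else I k) T T = tip N (d 0) (S 0) (S 0)"
    by (rule tip_cong) (auto simp: d_def S_def)
  also have "tip N (d 0) (S 0) (S 0) - tip N (d N) (S N) (S N)
      = (\<Sum>n=1..N. tip N (d (n - 1)) (S (n - 1)) (S (n - 1)) - tip N (d n) (S n) (S n))"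
    using sum_telescope''[of 0 N "\<lambda>n. - tip N (d n) (S n) (S n)"] by (simp add: atLeastSucAtMost_greaterThanAtMost[symmetric])
  also have "... = (\<Sum>n=1..N. (\<Sum>a<I n. sthosvd_gram N I \<mu> T Q n a a)
        - (\<Sum>l<\<mu> n. \<Sum>a<I n. \<Sum>b<I n. Q n $$ (a, l) * sthosvd_gram N I \<mu> T Q n a b * Q n $$ (b, l)))"
  proof (intro sum.cong refl arg_cong2[of _ _ _ _ "(-)"])
    fix n assume n: "n \<in> {1..N}"
    let ?d = "\<lambda>k. if k < n then \<mu> k else I k"
    have dn: "d (n - 1) = ?d" using n by (auto simp: d_def fun_eq_iff)
    have "tip N (d (n - 1)) (S (n - 1)) (S (n - 1))
        = (\<Sum>i\<in>other_index N ?d n. \<Sum>a<I n. S (n - 1) (i(n := a)) * S (n - 1) (i(n := a)))"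
      unfolding tip_def dn sum_tensor_index[OF n] by simp
    also have "... = (\<Sum>a<I n. \<Sum>i\<in>other_index N ?d n. S (n - 1) (i(n := a)) * S (n - 1) (i(n := a)))"
      by (rule sum.swap)
    finally show "tip N (d (n - 1)) (S (n - 1)) (S (n - 1)) = (\<Sum>a<I n. sthosvd_gram N I \<mu> T Q n a a)"
      by (simp add: sthosvd_gram_def S_def)
    have Sn: "S n = mode_prod (S (n - 1)) n (transpose_mat (Q n))"
      using n by (cases n) (auto simp: S_def)
    have o: "other_index N (d n) n = other_index N ?d n" by (rule other_index_cong) (auto simp: d_def)
    have "tip N (d n) (S n) (S n)
        = (\<Sum>i\<in>other_index N ?d n. \<Sum>l<\<mu> n. (\<Sum>a<I n. S (n - 1) (i(n := a)) * Q n $$ (a, l)) * (\<Sum>b<I n. S (n - 1) (i(n := b)) * Q n $$ (b, l)))"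
      using Q[OF n] unfolding tip_def sum_tensor_index[OF n] o Sn by (simp add: mode_prod_def d_def)
    also have "... = (\<Sum>l<\<mu> n. \<Sum>i\<in>other_index N ?d n. \<Sum>a<I n. \<Sum>b<I n. Q n $$ (a, l) * (S (n - 1) (i(n := a)) * S (n - 1) (i(n := b))) * Q n $$ (b, l))"
      by (subst sum.swap) (simp add: sum_product mult_ac)
    also have "... = (\<Sum>l<\<mu> n. \<Sum>a<I n. \<Sum>i\<in>other_index N ?d n. \<Sum>b<I n. Q n $$ (a, l) * (S (n - 1) (i(n := a)) * S (n - 1) (i(n := b))) * Q n $$ (b, l))"
      by (intro sum.cong refl sum.swap)
    also have "... = (\<Sum>l<\<mu> n. \<Sum>a<I n. \<Sum>b<I n. \<Sum>i\<in>other_index N ?d n. Q n $$ (a, l) * (S (n - 1) (i(n := a)) * S (n - 1) (i(n := b))) * Q n $$ (b, l))"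
      by (intro sum.cong refl sum.swap)
    finally show "tip N (d n) (S n) (S n)
        = (\<Sum>l<\<mu> n. \<Sum>a<I n. \<Sum>b<I n. Q n $$ (a, l) * sthosvd_gram N I \<mu> T Q n a b * Q n $$ (b, l))"
      by (simp add: sthosvd_gram_def S_def sum_distrib_left sum_distrib_right)
  qed
  finally show ?thesis .
qed

section \<open>Good sketches and the choice of the subspace\<close>

lemma mat_borel_space [simp]: "space (mat_borel r c) = carrier_mat r c"
  by (simp add: mat_borel_def)

lemma measurable_mat_entries:
  "(\<lambda>A. \<lambda>ij\<in>{..<r} \<times> {..<c}. A $$ ij) \<in> measurable (mat_borel r c) (PiB ({..<r} \<times> {..<c}))"
  unfolding mat_borel_def by (rule measurable_vimage_algebra1) (auto simp: space_PiM)

lemma measurable_mat_entry: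
  assumes "i < r" "j < c"
  shows "(\<lambda>A. A $$ (i, j)) \<in> borel_measurable (mat_borel r c)"
  using measurable_compose[OF measurable_mat_entries measurable_component_singleton, of "(i, j)" r c] assms
  by simp

lemma (in prob_space) std_gaussian_mat_distr:
  assumes G: "std_gaussian_mat M r c G" and "r > 0" "c > 0"
  shows "distr M (PiB ({..<r} \<times> {..<c})) (\<lambda>\<omega>. \<lambda>ij\<in>{..<r} \<times> {..<c}. G \<omega> $$ ij) = gauss ({..<r} \<times> {..<c})"
proof -
  let ?E = "{..<r} \<times> {..<c}"
  have ne: "?E \<noteq> {}" using assms by (auto simp: lessThan_empty_iff)
  have d: "distributed M lborel (\<lambda>\<omega>. G \<omega> $$ ij) std_normal_density" if "ij \<in> ?E" for ij
    using G that unfolding std_gaussian_mat_def by blast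
  have rv: "random_variable borel (\<lambda>\<omega>. G \<omega> $$ ij)" if "ij \<in> ?E" for ij
    using distributed_measurable[OF d[OF that]] by simp
  have "distr M (PiB ?E) (\<lambda>\<omega>. \<lambda>ij\<in>?E. G \<omega> $$ ij) = Pi\<^sub>M ?E (\<lambda>ij. distr M borel (\<lambda>\<omega>. G \<omega> $$ ij))"
    using G indep_vars_iff_distr_eq_PiM'[OF ne rv] by (simp add: std_gaussian_mat_def)
  also have "... = gauss ?E"
    unfolding gauss_def
  proof (rule PiM_cong[OF refl])
    fix ij assume "ij \<in> ?E"
    have "distr M borel (\<lambda>\<omega>. G \<omega> $$ ij) = distr M lborel (\<lambda>\<omega>. G \<omega> $$ ij)"
      by (rule distr_cong) auto
    then show "distr M borel (\<lambda>\<omega>. G \<omega> $$ ij) = std_normal"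
      using distributed_distr_eq_density[OF d[OF \<open>ij \<in> ?E\<close>]] by simp
  qed
  finally show ?thesis .
qed

text \<open>Failure for one fixed subspace \<open>U\<close>, as a condition on the Gaussian array
  alone; this is the part to which independence applies.\<close>

definition bad_sketch :: "nat \<Rightarrow> nat \<Rightarrow> nat \<Rightarrow> real \<Rightarrow> real \<Rightarrow> (nat \<Rightarrow> nat \<Rightarrow> real) \<Rightarrow> (nat \<times> nat \<Rightarrow> real) \<Rightarrow> bool" where
  "bad_sketch m s \<mu> x a U g \<longleftrightarrow> (\<Sum>p\<in>{..<m} \<times> {..<s}. (g p)\<^sup>2) > a \<or> (\<exists>i\<in>{..<\<mu>}. near_span m s \<mu> x U i g)"

lemma bad_sketch_measurable:
  "{g \<in> space (PiB ({..<m} \<times> {..<s})). bad_sketch m s \<mu> x a U g} \<in> sets (PiB ({..<m} \<times> {..<s}))"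
  unfolding bad_sketch_def by measurable

lemma emeasure_bad_sketch:
  assumes U: "orthofam m \<mu> U" and s: "\<mu> + K = s" and x: "x > 0"
  shows "emeasure (gauss ({..<m} \<times> {..<s})) {g \<in> space (gauss ({..<m} \<times> {..<s})). bad_sketch m s \<mu> x a U g}
    \<le> ennreal (exp (- a / 4) * sqrt 2 ^ (m * s) + real \<mu> * sqrt (exp 1 * x / real (K + 1)) ^ (K + 1))"
proof -
  let ?E = "{..<m} \<times> {..<s}"
  let ?G = "gauss ?E"
  let ?N = "\<lambda>i. {g \<in> space ?G. near_span m s \<mu> x U i g}"
  let ?S = "{g \<in> space ?G. (\<Sum>p\<in>?E. (g p)\<^sup>2) > a}"
  have N: "?N i \<in> sets ?G" for i by measurable
  have S: "?S \<in> sets ?G" by measurable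
  have "emeasure ?G {g \<in> space ?G. bad_sketch m s \<mu> x a U g} = emeasure ?G (?S \<union> (\<Union>i\<in>{..<\<mu>}. ?N i))"
    by (rule arg_cong[of _ _ "emeasure ?G"]) (auto simp: bad_sketch_def)
  also have "... \<le> emeasure ?G ?S + emeasure ?G (\<Union>i\<in>{..<\<mu>}. ?N i)"
    using N S by (intro emeasure_subadditive sets.finite_UN) auto
  also have "... \<le> emeasure ?G ?S + (\<Sum>i\<in>{..<\<mu>}. emeasure ?G (?N i))"
    using N by (intro add_left_mono emeasure_subadditive_finite) auto
  also have "... \<le> ennreal (exp (- a / 4) * sqrt 2 ^ card ?E) + (\<Sum>i\<in>{..<\<mu>}. ennreal (sqrt (exp 1 * x / real (K + 1)) ^ (K + 1)))"
    using emeasure_near_span[OF U _ s x]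
    by (intro add_mono sum_mono gauss_sum_squares_upper_tail) auto
  also have "... = ennreal (exp (- a / 4) * sqrt 2 ^ (m * s) + real \<mu> * sqrt (exp 1 * x / real (K + 1)) ^ (K + 1))"
    using x by (simp add: ennreal_plus[symmetric] ennreal_of_nat_eq_real_of_nat ennreal_mult'[symmetric] del: ennreal_plus)
  finally show ?thesis .
qed

section \<open>The matrix D (1 - U U^T) and the choice of U\<close>

definition off_span :: "nat \<Rightarrow> nat \<Rightarrow> (nat \<Rightarrow> nat \<Rightarrow> real) \<Rightarrow> (nat \<Rightarrow> nat \<Rightarrow> real) \<Rightarrow> nat \<Rightarrow> nat \<Rightarrow> real" where
  "off_span m \<mu> U D = (\<lambda>a b. D a b - (\<Sum>l<\<mu>. mv m D (U l) a * U l b))"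

lemma off_span_add: "off_span m \<mu> U (\<lambda>a b. X a b + Y a b) a b = off_span m \<mu> U X a b + off_span m \<mu> U Y a b"
  by (simp add: off_span_def mv_def algebra_simps sum.distrib)

lemma off_span_eq_mv: 
  assumes "b < m"
  shows "off_span m \<mu> U D a b = mv m D (\<lambda>c. orth_compl \<mu> U c b) a"
proof -
  have "mv m D (\<lambda>c. orth_compl \<mu> U c b) a = (\<Sum>c<m. D a c * of_bool (c = b)) - (\<Sum>c<m. \<Sum>l<\<mu>. D a c * U l c * U l b)"
    by (simp add: mv_def orth_compl_def right_diff_distrib sum_subtractf sum_distrib_left mult.assoc)
  also have "(\<Sum>c<m. D a c * of_bool (c = b)) = D a b"
  proof -
    have "(\<Sum>c<m. D a c * of_bool (c = b)) = (\<Sum>c<m. if c = b then D a c else 0)" by (intro sum.cong) auto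
    then show ?thesis using assms by simp
  qed
  also have "(\<Sum>c<m. \<Sum>l<\<mu>. D a c * U l c * U l b) = (\<Sum>l<\<mu>. \<Sum>c<m. D a c * U l c * U l b)" by (rule sum.swap)
  finally show ?thesis by (simp add: off_span_def mv_def sum_distrib_right)
qed

lemma fro_off_span_le:
  assumes "orthofam m \<mu> U"
  shows "fro m m (off_span m \<mu> U X) \<le> fro m m X"
proof -
  have tr: "fro m m F = fro m m (\<lambda>i j. F j i)" for F
    unfolding fro_def' by (subst sum.swap) simp
  have "fro m m (off_span m \<mu> U X) = fro m m (\<lambda>b a. off_span m \<mu> U X a b)" by (rule tr)
  also have "... = fro m m (mm m (orth_compl \<mu> U) (\<lambda>b a. X a b))"
    by (rule fro_cong) (simp add: mm_orth_compl off_span_def mv_def ip_def mult.commute)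
  also have "... \<le> fro m m (\<lambda>b a. X a b)" by (rule fro_orth_compl[OF assms])
  finally show ?thesis by (simp add: tr[of X])
qed

text \<open>The leading eigenspace of \<open>D\<close>, combined with the domination of its
  eigenvalues by those of the original unfolding. Singular values beyond \<open>c\<close> vanish, so
  the sum may stop at the smaller dimension.\<close>

lemma ex_off_span_le:
  assumes A: "A \<in> carrier_mat m c" and B: "B \<in> carrier_mat m c'" and "\<mu> \<le> m"
    and le: "\<And>x. ip_sq c' (mat_app_t m B x)
                 \<le> ip_sq c (mat_app_t m A x)"
    and D: "\<And>a b. a < m \<Longrightarrow> b < m \<Longrightarrow> D a b = (\<Sum>j<c'. B $$ (a, j) * B $$ (b, j))"
  shows "\<exists>U. orthofam m \<mu> U \<and> fro m m (off_span m \<mu> U D) \<le> sqrt (\<Sum>i=\<mu> + 1..min m c. singval i A ^ 4)"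
proof -
  obtain U where U: "orthofam m \<mu> U"
    and eq: "(\<Sum>a<m. \<Sum>b<m. (D a b - (\<Sum>l<\<mu>. mv m D (U l) a * U l b))\<^sup>2) = (\<Sum>i=\<mu>..<m. singval (Suc i) (transpose_mat B) ^ 4)"
    using ex_truncated_eigenspace[OF B \<open>\<mu> \<le> m\<close> D] by blast
  have Bt: "transpose_mat B \<in> carrier_mat c' m" using B by simp
  have "(\<Sum>i=\<mu>..<m. singval (Suc i) (transpose_mat B) ^ 4) \<le> (\<Sum>i=\<mu>..<m. singval (Suc i) A ^ 4)"
    using singval_transpose_mono[OF A B le] singval_spectral(2)[OF Bt] by (intro sum_mono power_mono) auto
  also have "... = (\<Sum>i=\<mu> + 1..m. singval i A ^ 4)"
    using sum.shift_bounds_Suc_ivl[of "\<lambda>k. singval k A ^ 4" \<mu> m] by (simp add: atLeastLessThanSuc_atLeastAtMost)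
  also have "... = (\<Sum>i=\<mu> + 1..min m c. singval i A ^ 4)"
    using singval_spectral(4)[OF A] by (intro sum.mono_neutral_right) auto
  finally have "fro m m (off_span m \<mu> U D) \<le> sqrt (\<Sum>i=\<mu> + 1..min m c. singval i A ^ 4)"
    unfolding fro_def' off_span_def eq by simp
  then show ?thesis using U by blast
qed

text \<open>Rounding needs a positive tolerance, so \<open>\<Delta> = 0\<close> is treated exactly:
  if \<open>A A^T\<close> annihilates the column \<open>x\<close> of \<open>1 - U U^T\<close>, then
  so does \<open>A^T\<close>, hence by domination \<open>B^T\<close>, hence \<open>D\<close>. One
  \<open>U\<close> then serves every \<open>D\<close>.\<close>

lemma off_span_eq_0_mono:
  assumes le: "\<And>x. ip_sq c' (mat_app_t m B x)
                 \<le> ip_sq c (mat_app_t m A x)"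
    and D: "\<And>a b. a < m \<Longrightarrow> b < m \<Longrightarrow> D a b = (\<Sum>j<c'. B $$ (a, j) * B $$ (b, j))"
    and S: "\<And>a b. a < m \<Longrightarrow> b < m \<Longrightarrow> S a b = (\<Sum>j<c. A $$ (a, j) * A $$ (b, j))"
    and 0: "\<And>a b. a < m \<Longrightarrow> b < m \<Longrightarrow> off_span m \<mu> U S a b = 0"
    and ab: "a < m" "b < m"
  shows "off_span m \<mu> U D a b = 0"
proof -
  have gram: "mv m E x a = mat_app k C (mat_app_t m C x) a"
    if "\<And>a b. a < m \<Longrightarrow> b < m \<Longrightarrow> E a b = (\<Sum>j<k. C $$ (a, j) * C $$ (b, j))" "a < m"
    for E :: "nat \<Rightarrow> nat \<Rightarrow> real" and C :: "real mat" and k x a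
  proof -
    have "mv m E x a = (\<Sum>b<m. \<Sum>j<k. C $$ (a, j) * C $$ (b, j) * x b)"
      unfolding mv_def using that by (intro sum.cong) (auto simp: sum_distrib_right)
    also have "... = (\<Sum>j<k. \<Sum>b<m. C $$ (a, j) * C $$ (b, j) * x b)" by (rule sum.swap)
    finally show ?thesis by (simp add: mv_def sum_distrib_left mult.assoc)
  qed
  define x where "x = (\<lambda>c. orth_compl \<mu> U c b)"
  have "ip_sq c (mat_app_t m A x) = ip m x (mv m S x)"
    unfolding ip_mv by (rule ip_cong) (simp_all add: gram[where E = S and k = c and C = A, OF S])
  also have "... = 0"
    using 0 ab(2) by (simp add: ip_def off_span_eq_mv x_def)
  finally have "ip_sq c' (mat_app_t m B x) = 0"
    using le[of x] ip_self_nonneg[of c' "mat_app_t m B x"] by linarith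
  then have z: "mat_app_t m B x j = 0" if "j < c'" for j using ip_self_eq_0 that by blast
  have "off_span m \<mu> U D a b = mat_app c' B (mat_app_t m B x) a"
    unfolding off_span_eq_mv[OF ab(2)] x_def by (rule gram[OF D ab(1)])
  also have "... = 0" using z by (simp add: mv_def[of c'])
  finally show ?thesis .
qed

text \<open>The best subspace \<open>U\<close> depends on the matrix \<open>D\<close>, hence on the past of the algorithm. Rounding
  the entries of \<open>D\<close> makes the choice of \<open>U\<close> countable, so that independence can be applied for each
  rounded value separately; the price is the factor 3/2.\<close>

definition grid_cell :: "nat \<Rightarrow> real \<Rightarrow> (nat \<Rightarrow> nat \<Rightarrow> real) \<Rightarrow> nat \<times> nat \<Rightarrow> int" where
  "grid_cell m \<eta> D = (\<lambda>(a, b)\<in>{..<m} \<times> {..<m}. \<lfloor>D a b / \<eta>\<rfloor>)"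

abbreviation dominated_gram :: "nat \<Rightarrow> nat \<Rightarrow> nat \<Rightarrow> real mat \<Rightarrow> (nat \<Rightarrow> nat \<Rightarrow> real) \<Rightarrow> real mat \<Rightarrow> bool" where
  "dominated_gram m c c' A D B \<equiv> B \<in> carrier_mat m c' \<and>
       (\<forall>a<m. \<forall>b<m. D a b = (\<Sum>j<c'. B $$ (a, j) * B $$ (b, j))) \<and>
       (\<forall>x. ip_sq c' (mat_app_t m B x)
                 \<le> ip_sq c (mat_app_t m A x))"

text \<open>Each nonempty cell takes the optimal \<open>U\<close> of one representative. Every other
  member differs from it by at most \<open>\<Delta> / 2\<close> in Frobenius norm, and
  \<open>D \<mapsto> D (1 - U U^T)\<close> is linear and contracting.\<close>

lemma ex_subspace_per_cell:
  assumes A: "A \<in> carrier_mat m c" and m: "\<mu> \<le> m" "m > 0"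
    and \<D>: "\<And>D. D \<in> \<D> \<Longrightarrow> \<exists>B. dominated_gram m c c' A D B"
  defines "\<Delta> \<equiv> sqrt (\<Sum>i=\<mu> + 1..min m c. singval i A ^ 4)"
  shows "\<exists>\<eta> V. \<eta> > 0 \<and> (\<forall>z. orthofam m \<mu> (V z)) \<and>
    (\<forall>D\<in>\<D>. fro m m (off_span m \<mu> (V (grid_cell m \<eta> D)) D) \<le> 3 / 2 * \<Delta>)"
proof -
  have ex: "\<exists>U. orthofam m \<mu> U \<and> fro m m (off_span m \<mu> U D) \<le> \<Delta>" if D: "D \<in> \<D>" for D
  proof -
    from \<D>[OF D] obtain B where B: "dominated_gram m c c' A D B" ..
    show ?thesis unfolding \<Delta>_def
    proof (rule ex_off_span_le[OF A _ m(1)])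
      show "B \<in> carrier_mat m c'" using B by (rule conjunct1)
      show "ip_sq c' (mat_app_t m B x)
          \<le> ip_sq c (mat_app_t m A x)" for x
        by (rule spec[OF B[THEN conjunct2, THEN conjunct2]])
      show "D a b = (\<Sum>j<c'. B $$ (a, j) * B $$ (b, j))" if "a < m" "b < m" for a b
        using B that by (simp only:)
    qed
  qed
  define S where "S = (\<lambda>a b. \<Sum>j<c. A $$ (a, j) * A $$ (b, j))"
  obtain U0 where U0: "orthofam m \<mu> U0" "fro m m (off_span m \<mu> U0 S) \<le> \<Delta>"
    using ex_off_span_le[OF A A m(1), of S] by (auto simp: S_def \<Delta>_def)
  show ?thesis
  proof (cases "\<Delta> = 0")
    case True
    have "fro m m (off_span m \<mu> U0 S) = 0" using U0(2) True fro_nonneg[of m m "off_span m \<mu> U0 S"] by linarith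
    then have "(\<Sum>a<m. \<Sum>b<m. (off_span m \<mu> U0 S a b)\<^sup>2) = 0" unfolding fro_power2[symmetric] by simp
    then have z: "off_span m \<mu> U0 S a b = 0" if "a < m" "b < m" for a b
      using that by (simp add: sum_nonneg_eq_0_iff sum_nonneg)
    have "fro m m (off_span m \<mu> U0 D) = 0" if D: "D \<in> \<D>" for D
    proof -
      from \<D>[OF D] obtain B where B: "dominated_gram m c c' A D B" ..
      have "off_span m \<mu> U0 D a b = 0" if "a < m" "b < m" for a b
      proof (rule off_span_eq_0_mono[where S = S])
        show "ip_sq c' (mat_app_t m B x)
            \<le> ip_sq c (mat_app_t m A x)" for x
          by (rule spec[OF B[THEN conjunct2, THEN conjunct2]])
        show "D a b = (\<Sum>j<c'. B $$ (a, j) * B $$ (b, j))" if "a < m" "b < m" for a b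
          using B that by (simp only:)
      qed (use that z in \<open>simp_all add: S_def\<close>)
      then show ?thesis by (simp add: fro_def')
    qed
    then show ?thesis using U0 True by (intro exI[of _ 1] exI[of _ "\<lambda>_. U0"]) auto
  next
    case False
    then have \<Delta>: "\<Delta> > 0" using fro_nonneg[of m m "off_span m \<mu> U0 S"] U0(2) by linarith
    \<comment> \<open>Makes \<open>m \<eta> = \<Delta> / 2\<close>, where \<open>m \<eta>\<close>
      bounds the Frobenius norm of an \<open>m\<close> by \<open>m\<close> matrix with entries at
      most \<open>\<eta>\<close> in absolute value.\<close>
    define \<eta> where "\<eta> = \<Delta> / (2 * real m)"
    have \<eta>: "\<eta> > 0" using \<Delta> m by (simp add: \<eta>_def)
    have "\<exists>U. orthofam m \<mu> U \<and> (\<forall>D\<in>\<D>. grid_cell m \<eta> D = z \<longrightarrow> fro m m (off_span m \<mu> U D) \<le> 3 / 2 * \<Delta>)" for z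
    proof (cases "\<exists>D\<in>\<D>. grid_cell m \<eta> D = z")
      \<comment> \<open>Cells without a member still receive an orthonormal family, because the
        choice is made for all \<open>z\<close>.\<close>
      case False
      then show ?thesis using U0(1) by auto
    next
      case True
      then obtain D' where D': "D' \<in> \<D>" "grid_cell m \<eta> D' = z" by auto
      obtain U where U: "orthofam m \<mu> U" "fro m m (off_span m \<mu> U D') \<le> \<Delta>" using ex[OF D'(1)] by blast
      have "fro m m (off_span m \<mu> U D) \<le> 3 / 2 * \<Delta>" if cell: "grid_cell m \<eta> D = z" for D
      proof -
        define X where "X = (\<lambda>a b. D a b - D' a b)"
        have X: "\<bar>X a b\<bar> \<le> \<eta>" if ab: "a < m" "b < m" for a b
        proof -
          have "\<lfloor>D a b / \<eta>\<rfloor> = \<lfloor>D' a b / \<eta>\<rfloor>"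
            using fun_cong[OF trans[OF cell D'(2)[symmetric]], of "(a, b)"] ab by (simp add: grid_cell_def)
          then have "\<bar>D a b / \<eta> - D' a b / \<eta>\<bar> < 1"
            using floor_correct[of "D a b / \<eta>"] floor_correct[of "D' a b / \<eta>"] by linarith
          then have "\<bar>X a b / \<eta>\<bar> < 1" by (simp add: X_def diff_divide_distrib)
          then show ?thesis using \<eta> by (simp add: field_simps)
        qed
        have "(fro m m X)\<^sup>2 \<le> (\<Sum>a<m. \<Sum>b<m. \<eta>\<^sup>2)"
          unfolding fro_power2 using X \<eta> by (intro sum_mono) (auto simp: abs_le_square_iff[symmetric])
        also have "... = (real m * \<eta>)\<^sup>2" by (simp add: power2_eq_square)
        finally have "fro m m X \<le> real m * \<eta>" by (rule power2_le_imp_le) (use \<eta> in simp)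
        also have "... = \<Delta> / 2" using m by (simp add: \<eta>_def)
        finally have "fro m m (off_span m \<mu> U X) \<le> \<Delta> / 2" using fro_off_span_le[OF U(1), of X] by linarith
        moreover have "off_span m \<mu> U D = (\<lambda>a b. off_span m \<mu> U D' a b + off_span m \<mu> U X a b)"
          unfolding off_span_add[symmetric] by (simp add: X_def fun_eq_iff)
        then have "fro m m (off_span m \<mu> U D) \<le> fro m m (off_span m \<mu> U D') + fro m m (off_span m \<mu> U X)"
          using fro_triangle by simp
        ultimately show ?thesis using U(2) by simp
      qed
      then show ?thesis using U(1) by auto
    qed
    then have "\<forall>z. \<exists>U. orthofam m \<mu> U \<and> (\<forall>D\<in>\<D>. grid_cell m \<eta> D = z \<longrightarrow> fro m m (off_span m \<mu> U D) \<le> 3 / 2 * \<Delta>)"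
      by blast
    from choice[OF this] obtain V where V: "\<forall>z. orthofam m \<mu> (V z) \<and>
        (\<forall>D\<in>\<D>. grid_cell m \<eta> D = z \<longrightarrow> fro m m (off_span m \<mu> (V z) D) \<le> 3 / 2 * \<Delta>)" ..
    show ?thesis using \<eta> V by (intro exI[of _ \<eta>] exI[of _ V]) simp
  qed
qed

section \<open>Measurability of the Gram matrices\<close>

lemma mode_prods_measurable:
  assumes meas: "\<And>k r c. k \<in> {1..n} \<Longrightarrow> r < I k \<Longrightarrow> c < \<mu> k \<Longrightarrow> (\<lambda>\<omega>. Q k \<omega> $$ (r, c)) \<in> borel_measurable W"
    and Q: "\<And>k \<omega>. k \<in> {1..n} \<Longrightarrow> \<omega> \<in> space W \<Longrightarrow> Q k \<omega> \<in> carrier_mat (I k) (\<mu> k)"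
    and i: "\<And>k. k \<in> {1..n} \<Longrightarrow> i k < \<mu> k"
  shows "(\<lambda>\<omega>. mode_prods T (\<lambda>k. transpose_mat (Q k \<omega>)) n i) \<in> borel_measurable W"
  using assms
proof (induction n arbitrary: i)
  case (Suc n)
  have "(\<lambda>\<omega>. mode_prods T (\<lambda>k. transpose_mat (Q k \<omega>)) (Suc n) i) \<in> borel_measurable W
    \<longleftrightarrow> (\<lambda>\<omega>. \<Sum>l<I (Suc n). mode_prods T (\<lambda>k. transpose_mat (Q k \<omega>)) n (i(Suc n := l)) * Q (Suc n) \<omega> $$ (l, i (Suc n)))
        \<in> borel_measurable W"
  proof (rule measurable_cong)
    fix \<omega> assume "\<omega> \<in> space W"
    then have "Q (Suc n) \<omega> \<in> carrier_mat (I (Suc n)) (\<mu> (Suc n))" using Suc.prems(2) by simp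
    then show "mode_prods T (\<lambda>k. transpose_mat (Q k \<omega>)) (Suc n) i
      = (\<Sum>l<I (Suc n). mode_prods T (\<lambda>k. transpose_mat (Q k \<omega>)) n (i(Suc n := l)) * Q (Suc n) \<omega> $$ (l, i (Suc n)))"
      using Suc.prems(3)[of "Suc n"] by (simp add: mode_prod_def)
  qed
  moreover have "..."
    using Suc.prems by (intro borel_measurable_sum borel_measurable_times Suc.IH) auto
  ultimately show ?case by simp
qed simp

text \<open>The measure \<open>W\<close> is left open: it carries the sigma-algebra of the past
  where independence is applied, and is the whole space for the final event.\<close>

lemma sthosvd_gram_measurable:
  assumes n: "n \<in> {1..N}"
    and meas: "\<And>k r c. k \<in> {1..<n} \<Longrightarrow> r < I k \<Longrightarrow> c < \<mu> k \<Longrightarrow> (\<lambda>\<omega>. Q k \<omega> $$ (r, c)) \<in> borel_measurable W"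
    and Q: "\<And>k \<omega>. k \<in> {1..<n} \<Longrightarrow> \<omega> \<in> space W \<Longrightarrow> Q k \<omega> \<in> carrier_mat (I k) (\<mu> k)"
  shows "(\<lambda>\<omega>. sthosvd_gram N I \<mu> T (\<lambda>k. Q k \<omega>) n a b) \<in> borel_measurable W"
proof -
  have "(\<lambda>\<omega>. mode_prods T (\<lambda>k. transpose_mat (Q k \<omega>)) (n - 1) (i(n := a))) \<in> borel_measurable W"
    if "i \<in> other_index N (\<lambda>k. if k < n then \<mu> k else I k) n" for i a
  proof (rule mode_prods_measurable[where I = I and \<mu> = \<mu>])
    fix k assume k: "k \<in> {1..n - 1}"
    then have "k \<in> {1..N} - {n}" "k < n" using n by auto
    then show "(i(n := a)) k < \<mu> k" using that by (auto simp: other_index_def PiE_iff dest!: bspec[of _ _ k])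
  qed (use n in \<open>auto intro!: meas Q\<close>)
  then show ?thesis unfolding sthosvd_gram_def by (intro borel_measurable_sum borel_measurable_times)
qed

section \<open>The error bound\<close>

definition sthosvd_step_error :: "nat \<Rightarrow> (nat \<Rightarrow> nat) \<Rightarrow> (nat \<Rightarrow> nat) \<Rightarrow> tensor \<Rightarrow> (nat \<Rightarrow> real mat) \<Rightarrow> nat \<Rightarrow> real" where
  "sthosvd_step_error N I \<mu> T Q n = (\<Sum>a<I n. sthosvd_gram N I \<mu> T Q n a a)
    - (\<Sum>l<\<mu> n. \<Sum>a<I n. \<Sum>b<I n. Q n $$ (a, l) * sthosvd_gram N I \<mu> T Q n a b * Q n $$ (b, l))"

text \<open>Purely deterministic. With the threshold \<open>\<mu> / t^2\<close>, the
  \<open>\<mu>\<close> dual vectors have squared norm at most \<open>t^2 / \<mu>\<close> each, which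
  adds up to the \<open>t^2\<close> of \<open>sketch_projection_error\<close>.\<close>

lemma step_error_if_not_bad_sketch:
  assumes n: "n \<in> {1..N}" and \<mu>: "\<mu> n > 0"
    and run: "sthosvd_run N I \<mu> K 1 T G Q" and G: "G n \<in> carrier_mat (I n) (\<mu> n + K)"
    and U: "orthofam (I n) (\<mu> n) U"
    and \<kappa>: "fro (I n) (I n) (off_span (I n) (\<mu> n) U (sthosvd_gram N I \<mu> T Q n)) \<le> \<kappa>"
    and t: "t > 0"
    and good: "\<not> bad_sketch (I n) (\<mu> n + K) (\<mu> n) (real (\<mu> n) / t\<^sup>2) a U (\<lambda>p\<in>{..<I n} \<times> {..<\<mu> n + K}. G n $$ p)"
  shows "mat_fnorm (G n) \<le> sqrt a"
    and "sthosvd_step_error N I \<mu> T Q n \<le> sqrt (real (I n)) * (\<kappa> * (1 + 2 * mat_fnorm (G n) * t))"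
proof -
  let ?m = "I n" and ?s = "\<mu> n + K"
  define g where "g = (\<lambda>p\<in>{..<?m} \<times> {..<?s}. G n $$ p)"
  have g: "g (i, j) = G n $$ (i, j)" if "i < ?m" "j < ?s" for i j using that by (simp add: g_def)
  have norm: "mat_fnorm (G n) = sqrt (\<Sum>p\<in>{..<?m} \<times> {..<?s}. (g p)\<^sup>2)"
    using G by (simp add: mat_fnorm_def sum.cartesian_product' g)
  show "mat_fnorm (G n) \<le> sqrt a"
    using good unfolding norm by (simp add: bad_sketch_def g_def[symmetric])
  define y where "y = (\<lambda>i b. \<Sum>a<?m. U i a * g (a, b))"
  have x: "real (\<mu> n) / t\<^sup>2 > 0" using \<mu> t by simp
  have "\<exists>f. (\<forall>i<\<mu> n. ip_sq ?s (f i) \<le> 1 / (real (\<mu> n) / t\<^sup>2)) \<and> (\<forall>i<\<mu> n. \<forall>j<\<mu> n. ip ?s (y j) (f i) = of_bool (i = j))"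
  proof (rule ex_dual_family[OF x])
    fix i c assume "i < \<mu> n"
    then have "\<not> near_span ?m ?s (\<mu> n) (real (\<mu> n) / t\<^sup>2) U i g"
      using good by (auto simp: bad_sketch_def g_def)
    from not_near_span[OF this, of c]
    show "real (\<mu> n) / t\<^sup>2 \<le> ip_sq ?s (\<lambda>a. y i a - (\<Sum>j\<in>{..<\<mu> n} - {i}. c j * y j a))"
      by (simp add: y_def)
  qed
  then obtain f where f: "\<And>i. i < \<mu> n \<Longrightarrow> ip_sq ?s (f i) \<le> 1 / (real (\<mu> n) / t\<^sup>2)"
    and dual: "\<And>i j. i < \<mu> n \<Longrightarrow> j < \<mu> n \<Longrightarrow> ip ?s (y j) (f i) = of_bool (i = j)" by blast
  have "(\<Sum>i<\<mu> n. ip_sq ?s (f i)) \<le> (\<Sum>i<\<mu> n. 1 / (real (\<mu> n) / t\<^sup>2))" using f by (intro sum_mono) auto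
  also have "... = t\<^sup>2" using \<mu> by simp
  finally have f_sum: "(\<Sum>i<\<mu> n. ip_sq ?s (f i)) \<le> t\<^sup>2" .
  define B where "B = sthosvd_B N I \<mu> T Q n"
  have B: "B \<in> carrier_mat ?m (trunc_cols N I \<mu> n)"
    unfolding B_def by (rule sthosvd_B_carrier)
  have C: "sthosvd_C N I \<mu> 1 T G Q n = B * transpose_mat B * G n"
    using B by (simp add: sthosvd_C_def B_def[symmetric])
  obtain R where R: "R \<in> carrier_mat (\<mu> n) ?s"
    and QR: "mat_fnorm (Q n * R - B * transpose_mat B * G n)
        \<le> sqrt (\<Sum>k=\<mu> n + 1..?s. (singval k (B * transpose_mat B * G n))\<^sup>2)"
    and Q: "Q n \<in> carrier_mat ?m (\<mu> n)" "orthonormal_mat (Q n)"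
    using run n unfolding sthosvd_run_def C[symmetric] by blast
  show "sthosvd_step_error N I \<mu> T Q n \<le> sqrt (real (I n)) * (\<kappa> * (1 + 2 * mat_fnorm (G n) * t))"
    unfolding sthosvd_step_error_def
  proof (rule sketch_projection_error[OF B Q G R QR _ U _ _ f_sum])
    show "sthosvd_gram N I \<mu> T Q n a b
      = (\<Sum>j<(trunc_cols N I \<mu> n). B $$ (a, j) * B $$ (b, j))"
      if "a < ?m" "b < ?m" for a b
      unfolding B_def by (rule sthosvd_gram_eq) (use n that in auto)
    show "fro ?m ?m (\<lambda>a b. sthosvd_gram N I \<mu> T Q n a b
        - (\<Sum>l<\<mu> n. mv ?m (sthosvd_gram N I \<mu> T Q n) (U l) a * U l b)) \<le> \<kappa>"
      using \<kappa> by (simp add: off_span_def)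
    show "ip ?s (\<lambda>b. \<Sum>a<?m. U j a * G n $$ (a, b)) (f i) = of_bool (i = j)" if "i < \<mu> n" "j < \<mu> n" for i j
    proof -
      have "ip ?s (\<lambda>b. \<Sum>a<?m. U j a * G n $$ (a, b)) (f i) = ip ?s (y j) (f i)"
        by (rule ip_cong) (simp_all add: y_def g)
      then show ?thesis using dual[OF that] by simp
    qed
  qed (use t in simp)
qed

definition step_failure :: "nat \<Rightarrow> (nat \<Rightarrow> nat) \<Rightarrow> (nat \<Rightarrow> nat) \<Rightarrow> nat \<Rightarrow> real \<Rightarrow> nat \<Rightarrow> real" where
  "step_failure N I \<mu> K \<gamma> n =
     1 / (4 * (\<gamma>\<^sup>2 - 1) * sqrt (pi * real (max_dim_trunc N I \<mu> K n) * \<gamma>\<^sup>2)) * (2 * \<gamma>\<^sup>2 / exp (\<gamma>\<^sup>2 - 1))\<^sup>2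
   + 1 / sqrt (2 * pi * (real K + 1)) * (exp 1 / (real K + 1)) ^ (K + 1)
   + 1 / (4 * (\<gamma>\<^sup>2 - 1) * sqrt (pi * real (I n) * \<gamma>\<^sup>2)) * (2 * \<gamma>\<^sup>2 / exp (\<gamma>\<^sup>2 - 1))\<^sup>2"

text \<open>The norm tail is charged to the summand with \<open>I n\<close>, the union over the rows
  to the one with \<open>K + 1\<close>.\<close>

lemma (in prob_space) prob_bad_sketch_le:
  assumes G: "std_gaussian_mat M (I n) (\<mu> n + K) (G n)" and U: "orthofam (I n) (\<mu> n) U"
    and \<mu>: "\<mu> n > 0" and K: "K > 0" and le: "\<mu> n + K \<le> I n" and \<gamma>: "\<gamma> > 1"
  shows "prob {\<omega> \<in> space M. bad_sketch (I n) (\<mu> n + K) (\<mu> n) (real (\<mu> n) / (dual_bound (\<mu> n) K)\<^sup>2)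
      (2 * \<gamma>\<^sup>2 * real (I n * (\<mu> n + K))) U (\<lambda>p\<in>{..<I n} \<times> {..<\<mu> n + K}. G n \<omega> $$ p)} \<le> step_failure N I \<mu> K \<gamma> n"
proof -
  let ?m = "I n" and ?s = "\<mu> n + K" and ?x = "real (\<mu> n) / (dual_bound (\<mu> n) K)\<^sup>2"
  let ?a = "2 * \<gamma>\<^sup>2 * real (?m * ?s)"
  let ?E = "{..<?m} \<times> {..<?s}"
  let ?P = "PiB ?E"
  let ?X = "\<lambda>\<omega>. \<lambda>p\<in>?E. G n \<omega> $$ p"
  have db: "dual_bound (\<mu> n) K > 0" using \<mu> by (simp add: dual_bound_def)
  have x: "?x > 0" using \<mu> db by simp
  have g1: "\<gamma>\<^sup>2 > 1" using \<gamma> by (simp add: one_less_power)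
  have X: "?X \<in> measurable M ?P"
    using G measurable_compose[OF _ measurable_mat_entries] by (auto simp: std_gaussian_mat_def)
  have "ennreal (prob {\<omega> \<in> space M. bad_sketch ?m ?s (\<mu> n) ?x ?a U (?X \<omega>)})
      = emeasure M (?X -` {g \<in> space ?P. bad_sketch ?m ?s (\<mu> n) ?x ?a U g} \<inter> space M)"
    unfolding emeasure_eq_measure
    by (rule arg_cong[of _ _ "\<lambda>S. ennreal (prob S)"]) (auto simp: space_PiM)
  also have "... = emeasure (distr M ?P ?X) {g \<in> space ?P. bad_sketch ?m ?s (\<mu> n) ?x ?a U g}"
    by (rule emeasure_distr[symmetric, OF X bad_sketch_measurable])
  also have "... = emeasure (gauss ?E) {g \<in> space (gauss ?E). bad_sketch ?m ?s (\<mu> n) ?x ?a U g}"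
    using std_gaussian_mat_distr[OF G] \<mu> le by (simp add: space_PiM)
  also have "... \<le> ennreal (exp (- ?a / 4) * sqrt 2 ^ (?m * ?s) + real (\<mu> n) * sqrt (exp 1 * ?x / real (K + 1)) ^ (K + 1))"
    by (rule emeasure_bad_sketch[OF U refl x])
  finally have "prob {\<omega> \<in> space M. bad_sketch ?m ?s (\<mu> n) ?x ?a U (?X \<omega>)}
      \<le> exp (- ?a / 4) * sqrt 2 ^ (?m * ?s) + real (\<mu> n) * sqrt (exp 1 * ?x / real (K + 1)) ^ (K + 1)"
    using x by (subst (asm) ennreal_le_iff) auto
  also have "... \<le> 1 / (4 * (\<gamma>\<^sup>2 - 1) * sqrt (pi * real ?m * \<gamma>\<^sup>2)) * (2 * \<gamma>\<^sup>2 / exp (\<gamma>\<^sup>2 - 1))\<^sup>2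
      + 1 / sqrt (2 * pi * (real K + 1)) * (exp 1 / (real K + 1)) ^ (K + 1)"
    using gaussian_norm_tail_le[OF g1, of ?s ?m] near_span_tail_le[OF \<mu> K] \<mu> K le by (intro add_mono) auto
  also have "... \<le> step_failure N I \<mu> K \<gamma> n"
    using g1 by (simp add: step_failure_def)
  finally show ?thesis .
qed

text \<open>The cell of \<open>D\<close> is determined by the past and the bad event of the subspace
  of a cell by \<open>G n\<close>, so the two are independent. Summing over the disjoint cells gives
  the same bound as if \<open>U\<close> had been fixed in advance.\<close>

lemma (in prob_space) sthosvd_step_failure_event:
  assumes n: "n \<in> {1..N}" and \<mu>: "\<mu> n > 0" and K: "K > 0"
    and le: "\<mu> n + K \<le> min_dim_trunc N I \<mu> n" and \<beta>: "\<beta> > 1" and \<gamma>: "\<gamma> > 1"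
    and rand: "randomized_sthosvd M N I \<mu> K 1 T G Q"
  shows "\<exists>F\<in>events. prob F \<le> step_failure N I \<mu> K \<gamma> n \<and>
    (\<forall>\<omega>\<in>space M - F. sthosvd_step_error N I \<mu> T (\<lambda>n. Q n \<omega>) n
      \<le> 2 * (real (mat_rank (unfolding_mat N I n T)) * (1 + sthosvd_lambda N I \<mu> K \<gamma> \<beta> n) * real (I n) * tail_Delta N I \<mu> T n))"
proof -
  define m where "m = I n"
  define s where "s = \<mu> n + K"
  define A where "A = unfolding_mat N I n T"
  define c where "c = (\<Prod>k\<in>{1..N} - {n}. I k)"
  define c' where "c' = (trunc_cols N I \<mu> n)"
  define \<Delta> where "\<Delta> = tail_Delta N I \<mu> T n"
  have sm: "s \<le> m" using le by (simp add: s_def m_def min_dim_trunc_def)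
  have A: "A \<in> carrier_mat m c" unfolding A_def m_def c_def by (rule unfolding_mat_carrier)
  have \<Delta>: "\<Delta> = sqrt (\<Sum>i=\<mu> n + 1..min m c. singval i A ^ 4)"
    by (simp add: \<Delta>_def tail_Delta_def min_dim_def m_def c_def A_def)
  have run: "sthosvd_run N I \<mu> K 1 T (\<lambda>n. G n \<omega>) (\<lambda>n. Q n \<omega>)" if "\<omega> \<in> space M" for \<omega>
    using rand that by (simp add: randomized_sthosvd_def)
  have Qc: "Q k \<omega> \<in> carrier_mat (I k) (\<mu> k)" and Qo: "orthonormal_mat (Q k \<omega>)"
    if "\<omega> \<in> space M" "k \<in> {1..N}" for k \<omega>
    using run[OF that(1)] that(2) by (auto simp: sthosvd_run_def)
  have G: "std_gaussian_mat M (I k) (\<mu> k + K) (G k)" and Q: "Q k \<in> measurable M (mat_borel (I k) (\<mu> k))"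
    if "k \<in> {1..N}" for k
    using rand that by (auto simp: randomized_sthosvd_def)
  have Gm: "G k \<in> measurable M (mat_borel (I k) (\<mu> k + K))" if "k \<in> {1..N}" for k
    using G[OF that] by (simp add: std_gaussian_mat_def)
  define D where "D = (\<lambda>\<omega>. sthosvd_gram N I \<mu> T (\<lambda>n. Q n \<omega>) n)"
  have "\<exists>\<eta> V. \<eta> > 0 \<and> (\<forall>z. orthofam m (\<mu> n) (V z)) \<and>
    (\<forall>X\<in>D ` space M. fro m m (off_span m (\<mu> n) (V (grid_cell m \<eta> X)) X) \<le> 3 / 2 * \<Delta>)"
    unfolding \<Delta>
  proof (rule ex_subspace_per_cell[OF A, where c' = c'])
    show "\<mu> n \<le> m" "m > 0" using sm \<mu> by (auto simp: s_def)
    fix X assume "X \<in> D ` space M"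
    then obtain \<omega> where \<omega>: "\<omega> \<in> space M" and X: "X = D \<omega>" by blast
    let ?B = "sthosvd_B N I \<mu> T (\<lambda>n. Q n \<omega>) n"
    have "?B \<in> carrier_mat m c'" unfolding m_def c'_def by (rule sthosvd_B_carrier)
    moreover have "\<forall>a<m. \<forall>b<m. X a b = (\<Sum>j<c'. ?B $$ (a, j) * ?B $$ (b, j))"
      using sthosvd_gram_eq[OF n] by (simp add: X D_def m_def c'_def)
    moreover have "\<forall>x. ip_sq c' (mat_app_t m ?B x)
        \<le> ip_sq c (mat_app_t m A x)"
      unfolding m_def c'_def c_def A_def
      using n \<omega> by (intro allI sthosvd_B_transpose_le Qc Qo) auto
    ultimately show "\<exists>B. dominated_gram m c c' A X B" by blast
  qed
  then obtain \<eta> V where "\<eta> > 0" and V: "\<And>z. orthofam m (\<mu> n) (V z)"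
    and VD: "\<And>\<omega>. \<omega> \<in> space M \<Longrightarrow> fro m m (off_span m (\<mu> n) (V (grid_cell m \<eta> (D \<omega>))) (D \<omega>)) \<le> 3 / 2 * \<Delta>"
    by blast
  define x where "x = real (\<mu> n) / (dual_bound (\<mu> n) K)\<^sup>2"
  define a where "a = 2 * \<gamma>\<^sup>2 * real (m * s)"
  define E where "E = {..<m} \<times> {..<s}"
  \<comment> \<open>Extensional integer arrays on a finite index set: countably many cells.\<close>
  define Z where "Z = (({..<m} \<times> {..<m}) \<rightarrow>\<^sub>E (UNIV :: int set))"
  define Az where "Az = (\<lambda>z. {\<omega> \<in> space M. grid_cell m \<eta> (D \<omega>) = z})"
  define Bz where "Bz = (\<lambda>z. {\<omega> \<in> space M. bad_sketch m s (\<mu> n) x a (V z) (\<lambda>p\<in>E. G n \<omega> $$ p)})"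
  define H where "H = (\<lambda>\<omega>. \<lambda>k\<in>{1..<n}. (G k \<omega>, Q k \<omega>))"
  define PH where "PH = Pi\<^sub>M {1..<n} (\<lambda>k. mat_borel (I k) (\<mu> k + K) \<Otimes>\<^sub>M mat_borel (I k) (\<mu> k))"
  define Past where "Past = vimage_algebra (space M) H PH"
  have indep: "indep_set (sets (vimage_algebra (space M) (G n) (mat_borel m s))) (sets Past)"
    using rand n by (simp add: randomized_sthosvd_def Past_def H_def PH_def m_def s_def)
  have space_Past: "space Past = space M" by (simp add: Past_def)
  have nN: "k \<in> {1..N}" if "k \<in> {1..<n}" for k using that n by auto
  have H: "H \<in> measurable Past PH"
    unfolding Past_def
  proof (rule measurable_vimage_algebra1)
    show "H \<in> space M \<rightarrow> space PH"
      using measurable_space[OF Gm[OF nN]] Qc[OF _ nN]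
      by (auto simp: H_def PH_def space_PiM space_pair_measure PiE_iff)
  qed
  have Q_Past: "(\<lambda>\<omega>. Q k \<omega> $$ (i, j)) \<in> borel_measurable Past" if k: "k \<in> {1..<n}" and ij: "i < I k" "j < \<mu> k" for k i j
  proof -
    have "(\<lambda>\<omega>. H \<omega> k) \<in> measurable Past (mat_borel (I k) (\<mu> k + K) \<Otimes>\<^sub>M mat_borel (I k) (\<mu> k))"
      using measurable_compose[OF H[unfolded PH_def] measurable_component_singleton[OF k]] .
    from measurable_compose[OF measurable_compose[OF this measurable_snd] measurable_mat_entry[OF ij]]
    show ?thesis using k by (simp add: H_def)
  qed
  have D_Past: "(\<lambda>\<omega>. D \<omega> i j) \<in> borel_measurable Past" for i j
    unfolding D_def
    by (rule sthosvd_gram_measurable[OF n Q_Past]) (use Qc nN in \<open>auto simp: space_Past\<close>)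
  have Az: "Az z \<in> sets Past" if z: "z \<in> Z" for z
  proof -
    \<comment> \<open>Membership in a cell is a finite conjunction of conditions on floors of scaled
      Gram entries, each measurable with respect to \<open>Past\<close>.\<close>
    have "grid_cell m \<eta> X = z \<longleftrightarrow> (\<forall>p\<in>{..<m} \<times> {..<m}. \<lfloor>X (fst p) (snd p) / \<eta>\<rfloor> = z p)" for X
      using z unfolding grid_cell_def Z_def by (force simp: fun_eq_iff PiE_iff extensional_def restrict_def)
    then have "Az z = {\<omega> \<in> space Past. \<forall>p\<in>{..<m} \<times> {..<m}. \<lfloor>D \<omega> (fst p) (snd p) / \<eta>\<rfloor> = z p}"
      by (simp add: Az_def space_Past)
    also have "... \<in> sets Past"
    proof (rule sets.sets_Collect_finite_All)
      fix p
      have "(\<lambda>\<omega>. D \<omega> (fst p) (snd p) / \<eta>) \<in> borel_measurable Past"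
        using D_Past by (intro borel_measurable_divide) auto
      then show "{\<omega> \<in> space Past. \<lfloor>D \<omega> (fst p) (snd p) / \<eta>\<rfloor> = z p} \<in> sets Past"
        by measurable
    qed simp
    finally show ?thesis .
  qed
  have Bz: "Bz z \<in> sets (vimage_algebra (space M) (G n) (mat_borel m s))" for z
  proof -
    have "{C \<in> space (mat_borel m s). bad_sketch m s (\<mu> n) x a (V z) (\<lambda>p\<in>E. C $$ p)}
        = (\<lambda>C. \<lambda>p\<in>E. C $$ p) -` {g \<in> space (PiB E). bad_sketch m s (\<mu> n) x a (V z) g} \<inter> space (mat_borel m s)"
      by (auto simp: space_PiM)
    also have "... \<in> sets (mat_borel m s)"
      unfolding E_def by (rule measurable_sets[OF measurable_mat_entries bad_sketch_measurable])
    finally have "G n -` {C \<in> space (mat_borel m s). bad_sketch m s (\<mu> n) x a (V z) (\<lambda>p\<in>E. C $$ p)} \<inter> space M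
        \<in> sets (vimage_algebra (space M) (G n) (mat_borel m s))" by (rule in_vimage_algebra)
    also have "G n -` {C \<in> space (mat_borel m s). bad_sketch m s (\<mu> n) x a (V z) (\<lambda>p\<in>E. C $$ p)} \<inter> space M = Bz z"
      using measurable_space[OF Gm[OF n]] by (auto simp: Bz_def m_def s_def)
    finally show ?thesis .
  qed
  have AzM: "Az z \<in> events" if "z \<in> Z" for z using Az[OF that] indep_setD_ev2[OF indep] by blast
  have BzM: "Bz z \<in> events" for z using Bz indep_setD_ev1[OF indep] by blast
  define \<delta> where "\<delta> = step_failure N I \<mu> K \<gamma> n"
  have pB: "prob (Bz z) \<le> \<delta>" for z
    unfolding Bz_def \<delta>_def x_def a_def E_def m_def s_def
    using V[of z] sm by (intro prob_bad_sketch_le G[OF n] \<mu> K \<gamma>) (auto simp: m_def s_def)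
  have \<delta>0: "\<delta> \<ge> 0" using order_trans[OF measure_nonneg pB] .
  have pAB: "prob (Az z \<inter> Bz z) \<le> \<delta> * prob (Az z)" if "z \<in> Z" for z
  proof -
    have "prob (Bz z \<inter> Az z) = prob (Bz z) * prob (Az z)" by (rule indep_setD[OF indep Bz Az[OF that]])
    also have "... \<le> \<delta> * prob (Az z)" by (intro mult_right_mono pB) simp
    finally show ?thesis by (simp add: Int_commute)
  qed
  have Z: "countable Z" unfolding Z_def by (intro countable_PiE) auto
  \<comment> \<open>Failure means that the current cell is some \<open>z\<close> and the subspace
    assigned to this \<open>z\<close> is bad for \<open>G n\<close>.\<close>
  define F where "F = (\<Union>z\<in>Z. Az z \<inter> Bz z)"
  have F: "F \<in> events" unfolding F_def using Z AzM BzM by (intro sets.countable_UN') auto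
  have "emeasure M F = (\<integral>\<^sup>+z. emeasure M (Az z \<inter> Bz z) \<partial>count_space Z)"
    unfolding F_def by (rule emeasure_UN_countable) (use Z AzM BzM in \<open>auto simp: disjoint_family_on_def Az_def\<close>)
  also have "... \<le> (\<integral>\<^sup>+z. ennreal \<delta> * emeasure M (Az z) \<partial>count_space Z)"
  proof (rule nn_integral_mono)
    fix z assume "z \<in> space (count_space Z)"
    then show "emeasure M (Az z \<inter> Bz z) \<le> ennreal \<delta> * emeasure M (Az z)"
      using pAB[of z] \<delta>0 by (simp add: emeasure_eq_measure ennreal_mult'[symmetric])
  qed
  also have "... = ennreal \<delta> * (\<integral>\<^sup>+z. emeasure M (Az z) \<partial>count_space Z)" by (rule nn_integral_cmult) simp
  also have "(\<integral>\<^sup>+z. emeasure M (Az z) \<partial>count_space Z) = emeasure M (\<Union>z\<in>Z. Az z)"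
    by (rule emeasure_UN_countable[symmetric]) (use Z AzM in \<open>auto simp: disjoint_family_on_def Az_def\<close>)
  also have "ennreal \<delta> * ... \<le> ennreal \<delta> * 1"
    by (intro mult_left_mono) (auto simp: emeasure_le_1)
  finally have "prob F \<le> \<delta>" using \<delta>0 by (simp add: emeasure_eq_measure)
  moreover have "sthosvd_step_error N I \<mu> T (\<lambda>n. Q n \<omega>) n
      \<le> 2 * (real (mat_rank A) * (1 + sthosvd_lambda N I \<mu> K \<gamma> \<beta> n) * real m * \<Delta>)"
    if \<omega>: "\<omega> \<in> space M - F" for \<omega>
  proof -
    have \<omega>M: "\<omega> \<in> space M" using \<omega> by simp
    define z where "z = grid_cell m \<eta> (D \<omega>)"
    have "z \<in> Z" by (auto simp: z_def Z_def grid_cell_def)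
    then have "\<omega> \<notin> Bz z" using \<omega> by (auto simp: F_def Az_def z_def)
    then have good: "\<not> bad_sketch m s (\<mu> n) x a (V z) (\<lambda>p\<in>E. G n \<omega> $$ p)" using \<omega>M by (simp add: Bz_def)
    have GC: "G n \<omega> \<in> carrier_mat m s" using measurable_space[OF Gm[OF n] \<omega>M] by (simp add: m_def s_def)
    have db: "dual_bound (\<mu> n) K > 0" using \<mu> by (simp add: dual_bound_def)
    note step = step_error_if_not_bad_sketch[where G = "\<lambda>n. G n \<omega>" and Q = "\<lambda>n. Q n \<omega>" and t = "dual_bound (\<mu> n) K"
        and a = a and U = "V z" and \<kappa> = "3 / 2 * \<Delta>", OF n \<mu> run[OF \<omega>M], folded m_def s_def, folded x_def E_def,
        OF GC V VD[OF \<omega>M, folded z_def, unfolded D_def] db good]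
    \<comment> \<open>A positive tail contains a positive singular value, and by monotonicity the
      one of index \<open>\<mu> + 1\<close> is then positive.\<close>
    have "\<mu> n + 1 \<le> mat_rank A" if "\<Delta> > 0"
    proof -
      have "singval (Suc (\<mu> n)) A > 0"
      proof (rule ccontr)
        assume "\<not> singval (Suc (\<mu> n)) A > 0"
        then have "singval i A = 0" if "i \<ge> \<mu> n + 1" for i
          using singval_spectral(2,3)[OF A, of i] singval_spectral(3)[OF A, of "Suc (\<mu> n)" i] that by force
        then have "\<Delta> = 0" unfolding \<Delta> by simp
        with that show False by simp
      qed
      then show ?thesis using mat_rank_gt_if_singval_pos[OF A] by fastforce
    qed
    moreover have "\<Delta> \<ge> 0" unfolding \<Delta> by (simp add: sum_nonneg)
    moreover have "\<mu> n + K \<le> max_dim_trunc N I \<mu> K n" by (simp add: max_dim_trunc_def)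
    ultimately have "sqrt (real m) * (3 / 2 * \<Delta> * (1 + 2 * mat_fnorm (G n \<omega>) * dual_bound (\<mu> n) K))
        \<le> 2 * (real (mat_rank A) * (1 + (sqrt (real (max_dim_trunc N I \<mu> K n)) + sqrt (real m)) * sqrt (2 * real (\<mu> n + K)) * \<gamma> * \<beta>) * real m * \<Delta>)"
      using sm \<mu> \<beta> \<gamma> step(1) by (intro sthosvd_step_bound) (auto simp: a_def s_def)
    with step(2) show ?thesis by (simp add: sthosvd_lambda_def m_def)
  qed
  ultimately show ?thesis using F unfolding \<delta>_def m_def A_def \<Delta>_def by blast
qed

text \<open>Through the step errors the total error becomes measurable, so that the success set is
  an event.\<close>

lemma (in prob_space) sthosvd_step_error_measurable:
  assumes n: "n \<in> {1..N}" and rand: "randomized_sthosvd M N I \<mu> K q T G Q"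
  shows "(\<lambda>\<omega>. sthosvd_step_error N I \<mu> T (\<lambda>n. Q n \<omega>) n) \<in> borel_measurable M"
proof -
  have Q: "Q k \<in> measurable M (mat_borel (I k) (\<mu> k))" if "k \<in> {1..N}" for k
    using rand that by (auto simp: randomized_sthosvd_def)
  have entry: "(\<lambda>\<omega>. Q k \<omega> $$ (i, j)) \<in> borel_measurable M" if "k \<in> {1..N}" "i < I k" "j < \<mu> k" for k i j
    by (rule measurable_compose[OF Q[OF that(1)] measurable_mat_entry[OF that(2,3)]])
  have gram: "(\<lambda>\<omega>. sthosvd_gram N I \<mu> T (\<lambda>n. Q n \<omega>) n a b) \<in> borel_measurable M" for a b
    by (rule sthosvd_gram_measurable[OF n, where I = I and \<mu> = \<mu>])
      (use n entry measurable_space[OF Q] in auto)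
  show ?thesis unfolding sthosvd_step_error_def
    using n by (intro borel_measurable_diff borel_measurable_sum borel_measurable_times gram entry) auto
qed

theorem corollary5:
  fixes M :: "'w measure" and N K :: nat and I \<mu> :: "nat \<Rightarrow> nat"
    and T :: tensor and G Q :: "nat \<Rightarrow> 'w \<Rightarrow> real mat" and \<beta> \<gamma> :: real
  assumes "prob_space M"
    and "N \<ge> 1" and "K > 0"
    and "\<And>n. n \<in> {1..N} \<Longrightarrow> I n > 0"
    and "\<And>n. n \<in> {1..N} \<Longrightarrow> \<mu> n > 0"
    and "\<And>n. n \<in> {1..N} \<Longrightarrow> \<mu> n + K \<le> min_dim_trunc N I \<mu> n"
    and "\<beta> > 1" and "\<gamma> > 1"
    and "success_bound N I \<mu> K \<gamma> \<ge> 0"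
    and "randomized_sthosvd M N I \<mu> K 1 T G Q"
  shows "\<P>(\<omega> in M.
            (tensor_fnorm N I (\<lambda>i. T i - sthosvd_approx T (\<lambda>n. Q n \<omega>) N i))\<^sup>2
              \<le> 2 * (\<Sum>n=1..N. real (mat_rank (unfolding_mat N I n T))
                        * (1 + sthosvd_lambda N I \<mu> K \<gamma> \<beta> n) * real (I n)
                        * tail_Delta N I \<mu> T n))
          \<ge> success_bound N I \<mu> K \<gamma>"
proof -
  interpret prob_space M by fact
  define b where "b = (\<lambda>n. real (mat_rank (unfolding_mat N I n T))
      * (1 + sthosvd_lambda N I \<mu> K \<gamma> \<beta> n) * real (I n) * tail_Delta N I \<mu> T n)"
  define err where "err = (\<lambda>n \<omega>. sthosvd_step_error N I \<mu> T (\<lambda>n. Q n \<omega>) n)"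
  define S where "S = {\<omega> \<in> space M. (tensor_fnorm N I (\<lambda>i. T i - sthosvd_approx T (\<lambda>n. Q n \<omega>) N i))\<^sup>2
      \<le> 2 * (\<Sum>n=1..N. b n)}"
  have total: "(tensor_fnorm N I (\<lambda>i. T i - sthosvd_approx T (\<lambda>n. Q n \<omega>) N i))\<^sup>2 = (\<Sum>n=1..N. err n \<omega>)"
    if "\<omega> \<in> space M" for \<omega>
    unfolding err_def sthosvd_step_error_def
    using assms(10) that by (intro sthosvd_approx_error) (auto simp: randomized_sthosvd_def sthosvd_run_def)
  have "\<forall>n\<in>{1..N}. \<exists>F. F \<in> events \<and> prob F \<le> step_failure N I \<mu> K \<gamma> n \<and> (\<forall>\<omega>\<in>space M - F. err n \<omega> \<le> 2 * b n)"
    using sthosvd_step_failure_event[OF _ assms(5) assms(3) assms(6) assms(7,8,10)] unfolding err_def b_def by blast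
  from bchoice[OF this] obtain F where F: "\<And>n. n \<in> {1..N} \<Longrightarrow> F n \<in> events"
    "\<And>n. n \<in> {1..N} \<Longrightarrow> prob (F n) \<le> step_failure N I \<mu> K \<gamma> n"
    "\<And>n \<omega>. n \<in> {1..N} \<Longrightarrow> \<omega> \<in> space M - F n \<Longrightarrow> err n \<omega> \<le> 2 * b n" by blast
  \<comment> \<open>Monotonicity of the probability below asks for the larger set to be an
    event.\<close>
  have S: "S \<in> events"
  proof -
    have "S = {\<omega> \<in> space M. (\<Sum>n=1..N. err n \<omega>) \<le> 2 * (\<Sum>n=1..N. b n)}"
      unfolding S_def using total by auto
    also have "... \<in> events"
      using assms(10) unfolding err_def
      by (intro borel_measurable_le borel_measurable_sum borel_measurable_const sthosvd_step_error_measurable) auto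
    finally show ?thesis .
  qed
  have FU: "(\<Union>n\<in>{1..N}. F n) \<in> events" using F(1) by (intro sets.finite_UN) auto
  \<comment> \<open>Union bound over the steps; the dependence between their failure events is
    irrelevant for it.\<close>
  have "success_bound N I \<mu> K \<gamma> = 1 - (\<Sum>n=1..N. step_failure N I \<mu> K \<gamma> n)"
    by (simp add: success_bound_def step_failure_def)
  also have "... \<le> 1 - (\<Sum>n=1..N. prob (F n))" using F(2) by (intro diff_left_mono sum_mono) auto
  also have "... \<le> 1 - prob (\<Union>n\<in>{1..N}. F n)"
    using F(1) by (intro diff_left_mono finite_measure_subadditive_finite) auto
  also have "... = prob (space M - (\<Union>n\<in>{1..N}. F n))" using prob_compl[OF FU] by simp
  also have "... \<le> prob S"
  proof (rule finite_measure_mono[OF _ S])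
    show "space M - (\<Union>n\<in>{1..N}. F n) \<subseteq> S"
      unfolding S_def using F(3) total by (auto simp: sum_distrib_left intro!: sum_mono)
  qed
  finally show ?thesis unfolding S_def b_def by simp
qed

end
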